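(* Let $\mathcal{A}$ be a separable unital $C^*$-algebra or a type $I$ factor, and let $\mathcal{H}$ be a separable Hilbert space. Then $S_{\mathcal{H}}(\mathcal{A})$ is the closure, in the bounded weak (BW) topology, of the $C^*$-convex hull of its $C^*$-extreme points.
   Context: Hilbert spaces are complex. $S_{\mathcal{H}}(\mathcal{A})$ is the set of all unital completely positive (UCP) maps $\mathcal{A}\to\mathcal{B}(\mathcal{H})$. A type $I$ factor is a von Neumann algebra of the form $\mathcal{B}(\mathcal{G})$ (up to isomorphism) for a Hilbert space $\mathcal{G}$. The BW-topology on $S_{\mathcal{H}}(\mathcal{A})$ is the topology in which a net $\phi_i$ converges to $\phi$ if and only if $\phi_i(a)\to\phi(a)$ in the weak operator topology for every $a\in\mathcal{A}$. The $C^*$-convex hull of a subset $K\subseteq S_{\mathcal{H}}(\mathcal{A})$ is $\{\sum_{i=1}^nT_i^*\phi_i(\cdot)T_i : n\in\mathbb{N},\ \phi_i\in K,\ T_i\in\mathcal{B}(\mathcal{H}),\ \sum_{i=1}^nT_i^*T_i=I_{\mathcal{H}}\}$. A map $\phi\in S_{\mathcal{H}}(\mathcal{A})$ is a $C^*$-extreme point of $S_{\mathcal{H}}(\mathcal{A})$ if whenever $\phi(\cdot)=\sum_{i=1}^n T_i^*\phi_i(\cdot)T_i$ with $\phi_i\in S_{\mathcal{H}}(\mathcal{A})$ and invertible $T_i\in\mathcal{B}(\mathcal{H})$ satisfying $\sum_{i=1}^nT_i^*T_i=I_{\mathcal{H}}$, then for each $i$ there is a unitary $U_i\in\mathcal{B}(\mathcal{H})$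 with $\phi_i(\cdot)=U_i^*\phi(\cdot)U_i$. *)

theory Defs
  imports "HOL-Analysis.Analysis"
begin

section \<open>Unital C*-algebras\<close>

class scaleC =
  fixes scaleC :: "complex \<Rightarrow> 'a \<Rightarrow> 'a"  (infixr \<open>*\<^sub>C\<close> 75)

class complex_vector = scaleC + real_vector +
  assumes scaleC_add_right: "c *\<^sub>C (x + y) = c *\<^sub>C x + c *\<^sub>C y"
    and scaleC_add_left: "(c + d) *\<^sub>C x = c *\<^sub>C x + d *\<^sub>C x"
    and scaleC_scaleC: "c *\<^sub>C (d *\<^sub>C x) = (c * d) *\<^sub>C x"
    and scaleC_one: "1 *\<^sub>C x = x"
    and scaleR_scaleC: "r *\<^sub>R x = complex_of_real r *\<^sub>C x"

definition clinear :: "('a::complex_vector \<Rightarrow> 'b::complex_vector) \<Rightarrow> bool" where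
  "clinear f \<longleftrightarrow> (\<forall>x y. f (x + y) = f x + f y) \<and> (\<forall>c x. f (c *\<^sub>C x) = c *\<^sub>C f x)"

class star =
  fixes star :: "'a \<Rightarrow> 'a"  (\<open>(_\<^sup>\<star>)\<close> [1000] 999)

text \<open>The unit law comes from \<^class>\<open>monoid_mult\<close> rather than \<^class>\<open>ring_1\<close>, so the zero
  algebra is admitted; this makes \<open>B(H)\<close> an instance also when \<open>H\<close> is the zero space.\<close>

class cstar_algebra_1 = complex_vector + real_normed_algebra + banach + monoid_mult + star +
  assumes scaleC_mult_left: "(c *\<^sub>C x) * y = c *\<^sub>C (x * y)"
    and scaleC_mult_right: "x * (c *\<^sub>C y) = c *\<^sub>C (x * y)"
    and norm_scaleC: "norm (c *\<^sub>C x) = cmod c * norm x"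
    and star_add: "(x + y)\<^sup>\<star> = x\<^sup>\<star> + y\<^sup>\<star>"
    and star_scaleC: "(c *\<^sub>C x)\<^sup>\<star> = cnj c *\<^sub>C x\<^sup>\<star>"
    and star_mult: "(x * y)\<^sup>\<star> = y\<^sup>\<star> * x\<^sup>\<star>"
    and star_star: "(x\<^sup>\<star>)\<^sup>\<star> = x"
    and cstar_identity: "norm (x\<^sup>\<star> * x) = (norm x)\<^sup>2"

definition star_isomorphism :: "('a::cstar_algebra_1 \<Rightarrow> 'b::cstar_algebra_1) \<Rightarrow> bool" where
  "star_isomorphism f \<longleftrightarrow> bij f \<and> clinear f \<and>
     (\<forall>x y. f (x * y) = f x * f y) \<and> (\<forall>x. f (x\<^sup>\<star>) = (f x)\<^sup>\<star>)"

definition invertible_elem :: "'a::cstar_algebra_1 \<Rightarrow> bool" where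
  "invertible_elem x \<longleftrightarrow> (\<exists>y. x * y = 1 \<and> y * x = 1)"

definition unitary_elem :: "'a::cstar_algebra_1 \<Rightarrow> bool" where
  "unitary_elem u \<longleftrightarrow> u\<^sup>\<star> * u = 1 \<and> u * u\<^sup>\<star> = 1"


section \<open>Unital completely positive maps\<close>

text \<open>An \<open>n \<times> n\<close> matrix over an algebra is a function of two indices, of which only the values
  with indices below \<open>n\<close> matter. Positivity in the C*-algebra \<open>M\<^sub>n(A)\<close> means being of
  the form \<open>b\<^sup>\<star> b\<close>, where \<open>(b\<^sup>\<star>)\<^sub>i\<^sub>k = (b\<^sub>k\<^sub>i)\<^sup>\<star>\<close>.\<close>

definition matrix_positive :: "nat \<Rightarrow> (nat \<Rightarrow> nat \<Rightarrow> 'a::cstar_algebra_1) \<Rightarrow> bool" where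
  "matrix_positive n a \<longleftrightarrow> (\<exists>b. \<forall>i<n. \<forall>j<n. a i j = (\<Sum>k<n. (b k i)\<^sup>\<star> * b k j))"

definition completely_positive :: "('a::cstar_algebra_1 \<Rightarrow> 'b::cstar_algebra_1) \<Rightarrow> bool" where
  "completely_positive \<phi> \<longleftrightarrow> clinear \<phi> \<and>
     (\<forall>n a. matrix_positive n a \<longrightarrow> matrix_positive n (\<lambda>i j. \<phi> (a i j)))"


section \<open>Hilbert spaces\<close>

text \<open>The inner product is conjugate linear in the first argument. The real inner product, and
  hence the norm and the metric, are those of the underlying real Hilbert space.\<close>

class chilbert_space = complex_vector + real_inner + banach +
  fixes cinner :: "'a \<Rightarrow> 'a \<Rightarrow> complex"
  assumes cinner_commute: "cinner x y = cnj (cinner y x)"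
    and cinner_add_right: "cinner x (y + z) = cinner x y + cinner x z"
    and cinner_scaleC_right: "cinner x (c *\<^sub>C y) = c * cinner x y"
    and inner_eq_Re_cinner: "inner x y = Re (cinner x y)"

lemma cinner_add_left: "cinner (x + y) z = cinner x z + cinner y z"
  for x y z :: "'a::chilbert_space"
  by (metis cinner_add_right cinner_commute complex_cnj_add)

lemma cinner_scaleC_left: "cinner (c *\<^sub>C x) y = cnj c * cinner x y"
  for x y :: "'a::chilbert_space"
  by (metis cinner_scaleC_right cinner_commute complex_cnj_mult)

lemma cinner_self: "cinner x x = complex_of_real ((norm x)\<^sup>2)"
  for x :: "'a::chilbert_space"
proof -
  have "Im (cinner x x) = 0"
    using arg_cong[OF cinner_commute[of x x], of Im] by simp
  moreover have "Re (cinner x x) = (norm x)\<^sup>2"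
    by (simp add: power2_norm_eq_inner inner_eq_Re_cinner)
  ultimately show ?thesis
    by (simp add: complex_eq_iff)
qed

lemma norm_scaleC_hilbert: "norm (c *\<^sub>C x) = cmod c * norm x"
  for x :: "'a::chilbert_space"
proof -
  have "complex_of_real ((norm (c *\<^sub>C x))\<^sup>2) = cnj c * (c * cinner x x)"
    unfolding cinner_self[symmetric] cinner_scaleC_left cinner_scaleC_right
    by (simp add: mult.left_commute)
  also have "\<dots> = complex_of_real ((cmod c * norm x)\<^sup>2)"
    unfolding cinner_self
    by (metis complex_norm_square mult.assoc mult.commute of_real_mult power_mult_distrib)
  finally have "(norm (c *\<^sub>C x))\<^sup>2 = (cmod c * norm x)\<^sup>2"
    using of_real_eq_iff by blast
  then show ?thesis
    by simp
qed

lemma cinner_eq_Re: "cinner x y = Complex (inner x y) (inner (\<i> *\<^sub>C x) y)"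
  for x y :: "'a::chilbert_space"
  by (simp add: complex_eq_iff inner_eq_Re_cinner cinner_scaleC_left)

lemma cinner_ext:
  fixes x y :: "'a::chilbert_space"
  assumes "\<And>z. cinner z x = cinner z y"
  shows "x = y"
proof -
  have "inner (x - y) x = inner (x - y) y"
    using assms by (simp add: inner_eq_Re_cinner)
  then have "inner (x - y) (x - y) = 0"
    by (simp add: inner_diff_right)
  then show ?thesis
    by simp
qed

lemma bounded_linear_cinner_right: "bounded_linear (\<lambda>y. cinner x y)"
  for x :: "'a::chilbert_space"
proof -
  have "bounded_linear (\<lambda>y. complex_of_real (inner x y) + \<i> * complex_of_real (inner (\<i> *\<^sub>C x) y))"
    by (intro bounded_linear_add bounded_linear_const_mult
        bounded_linear_compose[OF bounded_linear_of_real] bounded_linear_inner_right)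
  moreover have "(\<lambda>y. cinner x y)
      = (\<lambda>y. complex_of_real (inner x y) + \<i> * complex_of_real (inner (\<i> *\<^sub>C x) y))"
    by (rule ext, subst cinner_eq_Re) (simp add: complex_eq_iff)
  ultimately show ?thesis
    by simp
qed

instantiation complex :: chilbert_space
begin
definition scaleC_complex :: "complex \<Rightarrow> complex \<Rightarrow> complex" where "scaleC_complex c x = c * x"
definition cinner_complex :: "complex \<Rightarrow> complex \<Rightarrow> complex" where "cinner_complex x y = cnj x * y"
instance
  by standard (simp_all add: scaleC_complex_def cinner_complex_def algebra_simps
      scaleR_conv_of_real inner_complex_def)
end

lemma riesz_representation_real:
  fixes g :: "'a::{real_inner,banach} \<Rightarrow> real"
  assumes g: "bounded_linear g"
  shows "\<exists>y. \<forall>x. g x = inner y x"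
proof -
  interpret g: bounded_linear g by (rule g)
  define F where "F x = inner x x - 2 * g x" for x
  obtain K where K: "\<And>x. \<bar>g x\<bar> \<le> norm x * K"
    using g.bounded by auto
  have lower: "- K\<^sup>2 \<le> F x" for x
  proof -
    have "0 \<le> (norm x - K)\<^sup>2" by simp
    then have "2 * (norm x * K) \<le> (norm x)\<^sup>2 + K\<^sup>2"
      by (simp add: power2_diff)
    moreover have "g x \<le> norm x * K"
      using K[of x] by linarith
    ultimately show ?thesis
      unfolding F_def power2_norm_eq_inner[symmetric] by linarith
  qed
  then have bdd: "bdd_below (range F)"
    by (intro bdd_belowI2)
  define m where "m = (INF x. F x)"
  have m_le: "m \<le> F x" for x
    unfolding m_def by (rule cINF_lower[OF bdd]) simp
  have par: "(norm (x - y))\<^sup>2 \<le> 2 * (F x - m) + 2 * (F y - m)" for x y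
  proof -
    have "F ((1/2) *\<^sub>R (x + y)) = (F x + F y) / 2 - (norm (x - y))\<^sup>2 / 4"
      unfolding F_def power2_norm_eq_inner g.scaleR g.add
      by (simp add: inner_add inner_diff inner_commute field_simps)
    with m_le[of "(1/2) *\<^sub>R (x + y)"] show ?thesis
      by (simp add: field_simps)
  qed
  have "\<exists>x. F x < m + inverse (real (Suc n))" for n
  proof -
    have "m < m + inverse (real (Suc n))" by simp
    then show ?thesis
      unfolding m_def by (subst (asm) cINF_less_iff) (use bdd in auto)
  qed
  then obtain X where X: "\<And>n. F (X n) < m + inverse (real (Suc n))"
    by metis
  have "Cauchy X"
  proof (rule metric_CauchyI)
    fix e :: real assume "0 < e"
    then obtain N where N: "inverse (real (Suc N)) < e\<^sup>2 / 4"
      using reals_Archimedean[of "e\<^sup>2 / 4"] by auto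
    have "dist (X p) (X q) < e" if "p \<ge> N" "q \<ge> N" for p q
    proof -
      have *: "F (X k) - m < e\<^sup>2 / 4" if "k \<ge> N" for k
      proof -
        have "inverse (real (Suc k)) \<le> inverse (real (Suc N))"
          using that by (intro le_imp_inverse_le) auto
        with X[of k] N show ?thesis by linarith
      qed
      have "2 * (F (X p) - m) + 2 * (F (X q) - m) < e\<^sup>2"
        using add_strict_mono[OF *[OF that(1)] *[OF that(2)]] by argo
      with par have "(norm (X p - X q))\<^sup>2 < e\<^sup>2"
        by (rule le_less_trans)
      then show ?thesis
        using \<open>0 < e\<close> by (simp add: dist_norm power_less_imp_less_base)
    qed
    then show "\<exists>M. \<forall>p\<ge>M. \<forall>q\<ge>M. dist (X p) (X q) < e"
      by blast
  qed
  then obtain y where y: "X \<longlonglongrightarrow> y"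
    using Cauchy_convergent_iff convergent_def by blast
  have "(\<lambda>n. F (X n)) \<longlonglongrightarrow> F y"
    unfolding F_def by (intro tendsto_intros y g.tendsto)
  moreover have "(\<lambda>n. m + inverse (real (Suc n))) \<longlonglongrightarrow> m + 0"
    by (intro tendsto_intros LIMSEQ_inverse_real_of_nat)
  ultimately have "F y \<le> m + 0"
    by (rule LIMSEQ_le) (use X less_imp_le in blast)
  then have Fy: "F y \<le> m"
    by simp
  have "g x = inner y x" for x
  proof (rule ccontr)
    assume ne: "g x \<noteq> inner y x"
    define d where "d = inner y x - g x"
    have "x \<noteq> 0"
      using ne g.zero by auto
    then have pos: "0 < inner x x" by simp
    define t where "t = - d / inner x x"
    have "F (y + t *\<^sub>R x) = F y + t * (t * inner x x) + 2 * t * d"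
      unfolding F_def d_def g.scaleR g.add
      by (simp add: inner_add inner_commute algebra_simps)
    also have "t * inner x x = - d"
      using pos by (simp add: t_def)
    finally have "F (y + t *\<^sub>R x) = F y + t * d"
      by (simp add: algebra_simps)
    moreover have "t * d < 0"
    proof -
      have "t * d = - (d\<^sup>2 / inner x x)"
        by (simp add: t_def power2_eq_square)
      moreover have "0 < d\<^sup>2 / inner x x"
        using pos ne by (simp add: d_def)
      ultimately show ?thesis
        by simp
    qed
    ultimately show False
      using m_le[of "y + t *\<^sub>R x"] Fy by linarith
  qed
  then show ?thesis by blast
qed


section \<open>Bounded operators\<close>

typedef (overloaded) 'h bop = "{T :: 'h::chilbert_space \<Rightarrow>\<^sub>L 'h. \<forall>c x. T (c *\<^sub>C x) = c *\<^sub>C T x}"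
  morphisms blinfun_of_bop Bop
proof
  show "0 \<in> {T :: 'h \<Rightarrow>\<^sub>L 'h. \<forall>c x. T (c *\<^sub>C x) = c *\<^sub>C T x}"
    using scaleC_add_right[where x=0 and y="0::'h"] by simp
qed

setup_lifting type_definition_bop

lift_definition bop_apply :: "'h::chilbert_space bop \<Rightarrow> 'h \<Rightarrow> 'h" is blinfun_apply .

lemma bop_eqI: "(\<And>x. bop_apply S x = bop_apply T x) \<Longrightarrow> S = T"
  by transfer (auto intro: blinfun_eqI)

lemma bop_apply_scaleC: "bop_apply T (c *\<^sub>C x) = c *\<^sub>C bop_apply T x"
  by transfer simp

lemma bounded_linear_bop_apply: "bounded_linear (bop_apply T)"
  by transfer (rule blinfun.bounded_linear_right)

lemma bounded_linear_scaleC_hilbert: "bounded_linear (\<lambda>x::'a::chilbert_space. c *\<^sub>C x)"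
  by (rule bounded_linear_intro[where K = "cmod c"])
    (simp_all add: scaleC_add_right scaleR_scaleC scaleC_scaleC norm_scaleC_hilbert mult.commute)

lift_definition blinfun_scaleC :: "complex \<Rightarrow> 'h::chilbert_space \<Rightarrow>\<^sub>L 'h" is "\<lambda>c x. c *\<^sub>C x"
  by (rule bounded_linear_scaleC_hilbert)

instantiation bop :: (chilbert_space) "{real_normed_algebra, monoid_mult, scaleC}"
begin

lift_definition zero_bop :: "'a bop" is 0
  using scaleC_add_right[where x=0 and y="0::'a"] by simp

lift_definition plus_bop :: "'a bop \<Rightarrow> 'a bop \<Rightarrow> 'a bop" is "(+)"
  by (simp add: blinfun.add_left scaleC_add_right)

lift_definition scaleC_bop :: "complex \<Rightarrow> 'a bop \<Rightarrow> 'a bop"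
  is "\<lambda>c T. blinfun_scaleC c o\<^sub>L T"
  by (simp add: blinfun_scaleC.rep_eq scaleC_scaleC mult.commute)

lift_definition scaleR_bop :: "real \<Rightarrow> 'a bop \<Rightarrow> 'a bop" is scaleR
  by (simp add: blinfun.scaleR_left scaleR_scaleC scaleC_scaleC mult.commute)

definition uminus_bop :: "'a bop \<Rightarrow> 'a bop" where "- T = (- 1) *\<^sub>R T" for T :: "'a bop"

definition minus_bop :: "'a bop \<Rightarrow> 'a bop \<Rightarrow> 'a bop" where "S - T = S + (- T)" for S T :: "'a bop"

lift_definition one_bop :: "'a bop" is id_blinfun by simp

lift_definition times_bop :: "'a bop \<Rightarrow> 'a bop \<Rightarrow> 'a bop" is "(o\<^sub>L)" by simp

lift_definition norm_bop :: "'a bop \<Rightarrow> real" is norm .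

definition dist_bop :: "'a bop \<Rightarrow> 'a bop \<Rightarrow> real" where "dist_bop S T = norm (S - T)"

definition sgn_bop :: "'a bop \<Rightarrow> 'a bop" where "sgn_bop T = inverse (norm T) *\<^sub>R T"

definition uniformity_bop :: "('a bop \<times> 'a bop) filter" where
  "uniformity_bop = (INF e\<in>{0<..}. principal {(S, T). dist S T < e})"

definition open_bop :: "'a bop set \<Rightarrow> bool" where
  "open_bop U = (\<forall>S\<in>U. \<forall>\<^sub>F (S', T) in uniformity. S' = S \<longrightarrow> T \<in> U)"

instance
proof
  fix R S T :: "'a bop" and r q :: real and U :: "'a bop set"
  show "R + S + T = R + (S + T)" "R + S = S + R" "0 + R = R"
    by (transfer, simp)+
  show "- R + R = 0" "R - S = R + - S"
    unfolding minus_bop_def uminus_bop_def by (transfer, simp)+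
  show "r *\<^sub>R (S + T) = r *\<^sub>R S + r *\<^sub>R T" "(r + q) *\<^sub>R S = r *\<^sub>R S + q *\<^sub>R S"
    "r *\<^sub>R q *\<^sub>R S = (r * q) *\<^sub>R S" "1 *\<^sub>R S = S"
    by (transfer, simp add: scaleR_add_right scaleR_add_left)+
  show "R * S * T = R * (S * T)" "1 * R = R" "R * 1 = R"
    by (transfer, auto intro: blinfun_eqI)+
  show "(R + S) * T = R * T + S * T" "R * (S + T) = R * S + R * T"
    by (transfer, auto intro!: blinfun_eqI simp: blinfun.bilinear_simps)+
  show "(r *\<^sub>R S) * T = r *\<^sub>R (S * T)" "S * (r *\<^sub>R T) = r *\<^sub>R (S * T)"
    by (transfer, auto intro!: blinfun_eqI simp: blinfun.bilinear_simps)+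
  show "(norm S = 0) = (S = 0)" "norm (S + T) \<le> norm S + norm T"
    "norm (r *\<^sub>R S) = \<bar>r\<bar> * norm S" "norm (S * T) \<le> norm S * norm T"
    by (transfer, simp add: norm_triangle_ineq norm_blinfun_compose)+
  show "sgn S = inverse (norm S) *\<^sub>R S" "dist S T = norm (S - T)"
    "(uniformity :: ('a bop \<times> 'a bop) filter) = (INF e\<in>{0<..}. principal {(S, T). dist S T < e})"
    "open U = (\<forall>S\<in>U. \<forall>\<^sub>F (S', T) in uniformity. S' = S \<longrightarrow> T \<in> U)"
    by (rule sgn_bop_def dist_bop_def uniformity_bop_def open_bop_def)+
qed

end

lemma bop_apply_simps:
  "bop_apply 0 x = 0"
  "bop_apply 1 x = x"
  "bop_apply (S + T) x = bop_apply S x + bop_apply T x"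
  "bop_apply (S * T) x = bop_apply S (bop_apply T x)"
  "bop_apply (c *\<^sub>C T) x = c *\<^sub>C bop_apply T x"
  "bop_apply (r *\<^sub>R T) x = r *\<^sub>R bop_apply T x"
  by (transfer, simp add: blinfun.bilinear_simps blinfun_scaleC.rep_eq)+

lemma blinfun_of_bop_diff: "blinfun_of_bop (S - T) = blinfun_of_bop S - blinfun_of_bop T"
  unfolding minus_bop_def uminus_bop_def by transfer simp

lemma norm_bop_apply: "norm (bop_apply T x) \<le> norm T * norm x"
  by transfer (rule norm_blinfun)

lemma norm_bop_bound: "0 \<le> b \<Longrightarrow> (\<And>x. norm (bop_apply T x) \<le> b * norm x) \<Longrightarrow> norm T \<le> b"
  by transfer (rule norm_blinfun_bound)

lemma bop_adjoint_exists: "\<exists>S. \<forall>x y. cinner (bop_apply S x) y = cinner x (bop_apply T y)"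
  for T :: "'h::chilbert_space bop"
proof -
  have "\<exists>z. \<forall>y. cinner z y = cinner x (bop_apply T y)" for x
  proof -
    have "bounded_linear (\<lambda>y. inner x (bop_apply T y))"
      by (rule bounded_linear_compose[OF bounded_linear_inner_right bounded_linear_bop_apply])
    then obtain z where z: "\<And>y. inner x (bop_apply T y) = inner z y"
      using riesz_representation_real by blast
    have "cinner z y = cinner x (bop_apply T y)" for y
    proof (rule complex_eqI)
      show "Re (cinner z y) = Re (cinner x (bop_apply T y))"
        using z[of y] by (simp add: inner_eq_Re_cinner)
      show "Im (cinner z y) = Im (cinner x (bop_apply T y))"
        using z[of "\<i> *\<^sub>C y"]
        by (simp add: inner_eq_Re_cinner bop_apply_scaleC cinner_scaleC_right)
    qed
    then show ?thesis by blast
  qed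
  then obtain S where S: "\<And>x y. cinner (S x) y = cinner x (bop_apply T y)"
    by metis
  have S': "cinner y (S x) = cinner (bop_apply T y) x" for x y
    by (metis S cinner_commute)
  have add: "S (x + y) = S x + S y" for x y
    by (rule cinner_ext) (simp add: S' cinner_add_right)
  have scale: "S (c *\<^sub>C x) = c *\<^sub>C S x" for c x
    by (rule cinner_ext) (simp add: S' cinner_scaleC_right)
  have bound: "norm (S x) \<le> norm x * norm T" for x
  proof -
    have "(norm (S x))\<^sup>2 = inner x (bop_apply T (S x))"
      by (simp add: power2_norm_eq_inner inner_eq_Re_cinner S)
    also have "\<dots> \<le> norm x * norm (bop_apply T (S x))"
      by (rule norm_cauchy_schwarz)
    also have "\<dots> \<le> norm x * (norm T * norm (S x))"
      by (intro mult_left_mono norm_bop_apply norm_ge_zero)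
    finally have "norm (S x) * norm (S x) \<le> (norm x * norm T) * norm (S x)"
      by (simp add: power2_eq_square mult.assoc)
    then show ?thesis
      by (cases "S x = 0") simp_all
  qed
  have "bounded_linear S"
    by (rule bounded_linear_intro[OF add _ bound]) (simp add: scaleR_scaleC scale)
  then have "bop_apply (Bop (Blinfun S)) = S"
    by (simp add: bop_apply.rep_eq Bop_inverse bounded_linear_Blinfun_apply scale)
  then show ?thesis
    using S by metis
qed

instantiation bop :: (chilbert_space) cstar_algebra_1
begin

definition star_bop :: "'a bop \<Rightarrow> 'a bop" where
  "star_bop T = (SOME S. \<forall>x y. cinner (bop_apply S x) y = cinner x (bop_apply T y))"

lemma cinner_star_left: "cinner (bop_apply (T\<^sup>\<star>) x) y = cinner x (bop_apply T y)"
  for T :: "'a bop"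
  using someI_ex[OF bop_adjoint_exists[of T]] unfolding star_bop_def by blast

lemma cinner_star_right: "cinner x (bop_apply (T\<^sup>\<star>) y) = cinner (bop_apply T x) y"
  for T :: "'a bop"
  by (metis cinner_star_left cinner_commute)

lemma norm_star_le: "norm (T\<^sup>\<star> * T) \<ge> (norm T)\<^sup>2" for T :: "'a bop"
proof -
  have "norm (bop_apply T x) \<le> sqrt (norm (T\<^sup>\<star> * T)) * norm x" for x
  proof -
    have "(norm (bop_apply T x))\<^sup>2 = inner x (bop_apply (T\<^sup>\<star> * T) x)"
      by (simp add: power2_norm_eq_inner inner_eq_Re_cinner bop_apply_simps cinner_star_right)
    also have "\<dots> \<le> norm x * norm (bop_apply (T\<^sup>\<star> * T) x)"
      by (rule norm_cauchy_schwarz)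
    also have "\<dots> \<le> norm x * (norm (T\<^sup>\<star> * T) * norm x)"
      by (intro mult_left_mono norm_bop_apply norm_ge_zero)
    also have "\<dots> = (sqrt (norm (T\<^sup>\<star> * T)) * norm x)\<^sup>2"
      by (simp add: power2_eq_square)
    finally show ?thesis
      by (rule power2_le_imp_le) simp
  qed
  then have "norm T \<le> sqrt (norm (T\<^sup>\<star> * T))"
    by (intro norm_bop_bound) auto
  then show ?thesis
    by (simp add: real_le_rsqrt sqrt_ge_absD)
qed

instance
proof
  fix R S T :: "'a bop" and c d :: complex and r :: real
  note ap = bop_apply_simps scaleC_add_right scaleC_add_left scaleC_scaleC scaleC_one
    scaleR_scaleC bop_apply_scaleC
  show "c *\<^sub>C (S + T) = c *\<^sub>C S + c *\<^sub>C T" "(c + d) *\<^sub>C T = c *\<^sub>C T + d *\<^sub>C T"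
    "c *\<^sub>C d *\<^sub>C T = (c * d) *\<^sub>C T" "1 *\<^sub>C T = T" "r *\<^sub>R T = complex_of_real r *\<^sub>C T"
    "(c *\<^sub>C S) * T = c *\<^sub>C (S * T)" "S * (c *\<^sub>C T) = c *\<^sub>C (S * T)"
    by (rule bop_eqI, simp add: ap)+
  have norm_le: "norm (c *\<^sub>C T) \<le> cmod c * norm T" for c and T :: "'a bop"
    by (rule norm_bop_bound)
      (auto simp: ap norm_scaleC_hilbert mult.assoc intro!: mult_left_mono norm_bop_apply)
  show "norm (c *\<^sub>C T) = cmod c * norm T"
  proof (cases "c = 0")
    case True
    then show ?thesis
      using norm_le[of 0 T] by simp
  next
    case False
    have "T = inverse c *\<^sub>C c *\<^sub>C T"
      using False by (intro bop_eqI) (simp add: ap)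
    then have "norm T \<le> cmod (inverse c) * norm (c *\<^sub>C T)"
      using norm_le by metis
    then have "cmod c * norm T \<le> cmod c * (cmod (inverse c) * norm (c *\<^sub>C T))"
      by (rule mult_left_mono) simp
    also have "\<dots> = norm (c *\<^sub>C T)"
      using False by (simp add: norm_inverse flip: mult.assoc)
    finally have "cmod c * norm T \<le> norm (c *\<^sub>C T)" .
    then show ?thesis
      using norm_le[of c T] by linarith
  qed
  note st = cinner_star_left cinner_star_right ap cinner_add_left cinner_add_right
    cinner_scaleC_left cinner_scaleC_right
  show "(S + T)\<^sup>\<star> = S\<^sup>\<star> + T\<^sup>\<star>" "(c *\<^sub>C T)\<^sup>\<star> = cnj c *\<^sub>C T\<^sup>\<star>"
    "(S * T)\<^sup>\<star> = T\<^sup>\<star> * S\<^sup>\<star>" and star_star: "\<And>T :: 'a bop. (T\<^sup>\<star>)\<^sup>\<star> = T"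
    by (rule bop_eqI, rule cinner_ext, simp add: st)+
  have le: "norm T \<le> norm (T\<^sup>\<star>)" for T :: "'a bop"
  proof -
    have "norm T * norm T \<le> norm (T\<^sup>\<star>) * norm T"
      using norm_star_le[of T] norm_mult_ineq[of "T\<^sup>\<star>" T] by (simp add: power2_eq_square)
    then show ?thesis
      by (cases "T = 0") simp_all
  qed
  have "norm (T\<^sup>\<star>) = norm T"
    using le[of T] le[of "T\<^sup>\<star>"] by (simp add: star_star)
  then show "norm (T\<^sup>\<star> * T) = (norm T)\<^sup>2"
    using norm_star_le[of T] norm_mult_ineq[of "T\<^sup>\<star>" T] by (simp add: power2_eq_square)
next
  fix X :: "nat \<Rightarrow> 'a bop"
  assume "Cauchy X"
  have dist: "dist S T = dist (blinfun_of_bop S) (blinfun_of_bop T)" for S T :: "'a bop"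
    by (simp add: dist_norm norm_bop.rep_eq blinfun_of_bop_diff)
  have "Cauchy (\<lambda>n. blinfun_of_bop (X n))"
    using \<open>Cauchy X\<close> by (simp add: Cauchy_def dist)
  then obtain L where L: "(\<lambda>n. blinfun_of_bop (X n)) \<longlonglongrightarrow> L"
    using Cauchy_convergent_iff convergent_def by blast
  have "L (c *\<^sub>C x) = c *\<^sub>C L x" for c x
  proof (rule LIMSEQ_unique)
    show "(\<lambda>n. blinfun_of_bop (X n) (c *\<^sub>C x)) \<longlonglongrightarrow> L (c *\<^sub>C x)"
      by (intro tendsto_intros L)
    have "(\<lambda>n. c *\<^sub>C blinfun_of_bop (X n) x) \<longlonglongrightarrow> c *\<^sub>C L x"
      by (intro bounded_linear.tendsto[OF bounded_linear_scaleC_hilbert] tendsto_intros L)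
    then show "(\<lambda>n. blinfun_of_bop (X n) (c *\<^sub>C x)) \<longlonglongrightarrow> c *\<^sub>C L x"
      by (simp add: bop_apply_scaleC[unfolded bop_apply.rep_eq])
  qed
  then have "blinfun_of_bop (Bop L) = L"
    by (simp add: Bop_inverse)
  with L have "X \<longlonglongrightarrow> Bop L"
    by (simp add: tendsto_iff dist)
  then show "convergent X"
    by (rule convergentI)
qed

end


section \<open>UCP maps into \<open>B(H)\<close>, the BW topology and C*-convexity\<close>

definition ucp_maps :: "('a::cstar_algebra_1 \<Rightarrow> 'h::chilbert_space bop) set" where
  "ucp_maps = {\<phi>. completely_positive \<phi> \<and> \<phi> 1 = 1}"

definition weak_operator_topology :: "'h::chilbert_space bop topology" where
  "weak_operator_topology =
     pullback_topology UNIV (\<lambda>T. \<lambda>(x, y). cinner x (bop_apply T y)) euclidean"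

definition bw_topology :: "('a::cstar_algebra_1 \<Rightarrow> 'h::chilbert_space bop) topology" where
  "bw_topology = subtopology (product_topology (\<lambda>_. weak_operator_topology) UNIV) ucp_maps"

lemma topspace_weak_operator_topology: "topspace weak_operator_topology = UNIV"
  by (simp add: weak_operator_topology_def topspace_pullback_topology)

lemma topspace_bw_topology: "topspace bw_topology = ucp_maps"
  by (simp add: bw_topology_def topspace_weak_operator_topology)

lemma limitin_weak_operator_topology:
  "limitin weak_operator_topology f T F \<longleftrightarrow>
     (\<forall>x y. ((\<lambda>i. cinner x (bop_apply (f i) y)) \<longlongrightarrow> cinner x (bop_apply T y)) F)"
proof -
  define \<iota> :: "'a bop \<Rightarrow> 'a \<times> 'a \<Rightarrow> complex" where
    "\<iota> = (\<lambda>T. \<lambda>(x, y). cinner x (bop_apply T y))"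
  have "limitin weak_operator_topology f T F \<longleftrightarrow> ((\<lambda>i. \<iota> (f i)) \<longlongrightarrow> \<iota> T) F"
    unfolding limitin_def tendsto_def topspace_weak_operator_topology
    by (auto simp: weak_operator_topology_def \<iota>_def[symmetric] openin_pullback_topology)
  also have "\<dots> \<longleftrightarrow> limitin (product_topology (\<lambda>_. euclidean) UNIV) (\<lambda>i. \<iota> (f i)) (\<iota> T) F"
    by (simp only: euclidean_product_topology limitin_canonical_iff)
  also have "\<dots> \<longleftrightarrow> (\<forall>p. ((\<lambda>i. \<iota> (f i) p) \<longlongrightarrow> \<iota> T p) F)"
    by (simp add: limitin_componentwise)
  finally show ?thesis
    by (simp add: \<iota>_def split_paired_all)
qed

text \<open>A net converges iff its eventuality filter does, so this is the defining property of the
  BW topology on the set of UCP maps.\<close>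

lemma limitin_bw_topology:
  "limitin bw_topology f \<phi> F \<longleftrightarrow> \<phi> \<in> ucp_maps \<and> (\<forall>\<^sub>F i in F. f i \<in> ucp_maps) \<and>
     (\<forall>a. limitin weak_operator_topology (\<lambda>i. f i a) (\<phi> a) F)"
  by (auto simp: bw_topology_def limitin_subtopology limitin_componentwise
      topspace_weak_operator_topology)

definition cstar_convex_hull ::
  "('a::cstar_algebra_1 \<Rightarrow> 'h::chilbert_space bop) set \<Rightarrow> ('a \<Rightarrow> 'h bop) set" where
  "cstar_convex_hull K = {\<psi>. \<exists>(n::nat) \<phi> T. 1 \<le> n \<and> (\<forall>i\<in>{1..n}. \<phi> i \<in> K) \<and>
     (\<Sum>i=1..n. (T i)\<^sup>\<star> * T i) = 1 \<and> \<psi> = (\<lambda>a. \<Sum>i=1..n. (T i)\<^sup>\<star> * \<phi> i a * T i)}"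

definition cstar_extreme_points :: "('a::cstar_algebra_1 \<Rightarrow> 'h::chilbert_space bop) set" where
  "cstar_extreme_points = {\<psi> \<in> ucp_maps. \<forall>(n::nat) \<phi> T.
     (\<forall>i\<in>{1..n}. \<phi> i \<in> ucp_maps \<and> invertible_elem (T i)) \<longrightarrow>
     (\<Sum>i=1..n. (T i)\<^sup>\<star> * T i) = 1 \<longrightarrow>
     \<psi> = (\<lambda>a. \<Sum>i=1..n. (T i)\<^sup>\<star> * \<phi> i a * T i) \<longrightarrow>
     (\<forall>i\<in>{1..n}. \<exists>U. unitary_elem U \<and> \<phi> i = (\<lambda>a. U\<^sup>\<star> * \<psi> a * U))}"

end

theory Submission
  imports Defs "HOL-Library.Complex_Order" "HOL-Library.Function_Algebras"
begin

text \<open>A pure state \<open>f\<close> of \<open>A\<close>, elements \<open>d\<^sub>0, \<dots>, d\<^sub>k\<^sub>-\<^sub>1\<close> orthonormal for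
  \<open>(a, b) \<mapsto> f (a\<^sup>* b)\<close> and orthonormal vectors \<open>e\<^sub>0, \<dots>, e\<^sub>k\<^sub>-\<^sub>1\<close> of \<open>H\<close> give the UCP map that is
  \<open>\<Sum> f (d\<^sub>i\<^sup>* a d\<^sub>j) |e\<^sub>i\<rangle> \<langle>e\<^sub>j|\<close> on the span of the \<open>e\<^sub>i\<close> and \<open>f (d\<^sub>0\<^sup>* a d\<^sub>0)\<close> times the identity on its
  orthogonal complement. It is C*-extreme: a completely positive \<open>\<Theta>\<close> below such a map \<open>\<phi>\<close> is
  \<open>R\<^sup>* \<phi>(\<sqdot>) R\<close> with \<open>R\<close> leaving each of the lines \<open>\<complex> e\<^sub>0, \<dots>, \<complex> e\<^sub>k\<^sub>-\<^sub>1\<close> invariant, and if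
  \<open>\<Theta> = T\<^sup>* \<psi>(\<sqdot>) T\<close> with \<open>T\<close> invertible then \<open>R T\<^sup>-\<^sup>1\<close> is unitary.

  These maps suffice. Fix a UCP map \<open>\<phi>\<close> and a finite-dimensional subspace of \<open>H\<close> with basis \<open>e\<close>.
  Gram-Schmidt in the pre-Hilbert space \<open>A\<^sup>n\<close> with kernel \<open>\<langle>e\<^sub>j, \<phi>(a) e\<^sub>l\<rangle>\<close> writes this kernel,
  up to a small error on finitely many \<open>a\<close>, as a sum of kernels \<open>g (c\<^sub>j\<^sup>* a c\<^sub>l)\<close> with positive
  functionals \<open>g\<close>, and Krein-Milman in the state space makes every \<open>g\<close> a pure state. Each
  \<open>f (c\<^sub>j\<^sup>* a c\<^sub>l)\<close> is a compression \<open>T\<^sup>* \<phi>'(\<sqdot>) T\<close> of one of the C*-extreme points above.\<close>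

text \<open>The extreme maps come from asking when every map dominated by \<phi> is a compression of
  \<phi> itself. Dilate \<phi> to the irreducible representation of the pure state, tensored with
  the identity on a multiplicity space. Its commutant consists of the operators on the multiplicity
  space, so dominated maps correspond to positive operators \<open>D\<close> there, and
  \<open>D\<close> has to be written as \<open>star C * C\<close> with a \<open>C\<close> that
  respects the embedding of \<open>H\<close> into the dilation. Only the vector \<open>e 0\<close>
  of the multiplicity space carries more than one \<open>d i\<close>, so the single demand on
  \<open>C\<close> is that it maps \<open>e 0\<close> to a multiple of itself. A square root of
  \<open>D\<close> followed by a suitable reflection does this.

  GNS and Stinespring spaces enter only through their forms. Their vectors are represented by finite
  families, an orthogonal projection becomes a near-minimiser of the distance, and irreducibility
  becomes the statement that some \<open>b r * c\<close> tend to 1 in the seminorm of the state. No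
  completion is formed.\<close>

interpretation scaleC_right: additive "scaleC c :: 'a::complex_vector \<Rightarrow> 'a"
  by standard (rule scaleC_add_right)

interpretation scaleC_left: additive "\<lambda>c. c *\<^sub>C x" for x :: "'a::complex_vector"
  by standard (rule scaleC_add_left)

interpretation cinner_right: additive "cinner x"
  by standard (rule cinner_add_right)

interpretation cinner_left: additive "\<lambda>x. cinner x y"
  by standard (rule cinner_add_left)

interpretation bop_right: additive "bop_apply T"
  by standard (metis linear_simps(1) bounded_linear_bop_apply)

interpretation bop_left: additive "\<lambda>T. bop_apply T x"
  by standard (rule bop_apply_simps)

interpretation star: additive "star :: 'a::cstar_algebra_1 \<Rightarrow> 'a"
  by standard (rule star_add)

lemmas cspace_simps = scaleC_right.zero scaleC_left.zero scaleC_add_right scaleC_add_left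
  scaleC_right.diff scaleC_left.diff scaleC_right.minus scaleC_left.minus scaleC_scaleC scaleC_one

lemmas cinner_simps = cinner_right.zero cinner_left.zero cinner_add_right cinner_add_left
  cinner_right.diff cinner_left.diff cinner_right.minus cinner_left.minus
  cinner_scaleC_right cinner_scaleC_left

lemmas bop_simps = bop_apply_simps bop_right.zero bop_right.add bop_right.diff bop_right.minus
  bop_left.diff bop_left.minus bop_apply_scaleC

lemma star_one [simp]: "star (1::'a::cstar_algebra_1) = 1"
  by (metis mult_1_right star_mult star_star mult_1_left)

lemma star_scaleR: "star (r *\<^sub>R x) = r *\<^sub>R star x" for x :: "'a::cstar_algebra_1"
  by (simp add: scaleR_scaleC star_scaleC)

lemma norm_star [simp]: "norm (star x) = norm x" for x :: "'a::cstar_algebra_1"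
proof -
  have "norm x \<le> norm (star x)" for x :: 'a
  proof (cases "x = 0")
    case False
    have "norm x * norm x \<le> norm (star x) * norm x"
      using norm_mult_ineq[of "star x" x] by (simp add: cstar_identity power2_eq_square)
    then show ?thesis
      using False by simp
  qed simp
  from this[of x] this[of "star x"] show ?thesis
    by (simp add: star_star)
qed

lemma bounded_linear_star: "bounded_linear (star :: 'a::cstar_algebra_1 \<Rightarrow> 'a)"
  by (rule bounded_linear_intro[where K = 1]) (simp_all add: star_add star_scaleR)

text \<open>The pointwise structure serves families in \<open>A\<close> and in \<open>H\<close> as
  vectors of semi-inner products, operator matrices, and functionals on \<open>A\<close> as points
  of a convex set.\<close>

instantiation "fun" :: (type, real_vector) real_vector
begin
definition scaleR_fun :: "real \<Rightarrow> ('a \<Rightarrow> 'b) \<Rightarrow> 'a \<Rightarrow> 'b" where "scaleR_fun r f = (\<lambda>x. r *\<^sub>R f x)"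
instance
  by standard (auto simp: scaleR_fun_def fun_eq_iff scaleR_add_right scaleR_add_left)
end

instantiation "fun" :: (type, complex_vector) complex_vector
begin
definition scaleC_fun :: "complex \<Rightarrow> ('a \<Rightarrow> 'b) \<Rightarrow> 'a \<Rightarrow> 'b" where "scaleC_fun c f = (\<lambda>x. c *\<^sub>C f x)"
instance
  by standard
    (auto simp: scaleC_fun_def scaleR_fun_def fun_eq_iff scaleC_add_right scaleC_add_left
      scaleC_scaleC scaleC_one scaleR_scaleC)
end

lemma scaleC_fun_apply [simp]: "(c *\<^sub>C f) x = c *\<^sub>C f x"
  by (simp add: scaleC_fun_def)

lemma complex_nonneg_iff: "0 \<le> z \<longleftrightarrow> 0 \<le> Re z \<and> Im z = 0"
  by (auto simp: less_eq_complex_def)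

lemma complex_nonneg_eq: "0 \<le> z \<Longrightarrow> z = complex_of_real (Re z)"
  by (simp add: complex_nonneg_iff complex_eq_iff)



lemma cnj_mult_self: "cnj z * z = complex_of_real ((cmod z)\<^sup>2)"
  by (metis complex_norm_square mult.commute)

lemma cinner_nonneg [simp]: "0 \<le> cinner x x"
  by (simp add: cinner_self complex_nonneg_iff)


section \<open>Semi-inner products\<close>

text \<open>Definiteness is left out, so the forms of states and kernels are covered without passing
  to a quotient. The order on the complex numbers makes \<open>B u u\<close> real.\<close>

locale semi_inner =
  fixes B :: "'v::complex_vector \<Rightarrow> 'v \<Rightarrow> complex"
  assumes add_right: "B u (v + w) = B u v + B u w"
    and add_left: "B (u + v) w = B u w + B v w"
    and scaleC_right: "B u (c *\<^sub>C v) = c * B u v"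
    and scaleC_left: "B (c *\<^sub>C u) v = cnj c * B u v"
    and nonneg: "0 \<le> B u u"
begin

sublocale right: additive "B u" by standard (rule add_right)
sublocale left: additive "\<lambda>u. B u v" by standard (rule add_left)

lemmas simps = add_right add_left scaleC_right scaleC_left right.diff left.diff right.zero left.zero
  right.minus left.minus

text \<open>Polarisation: the diagonal values at \<open>u + v\<close> and at
  \<open>u + \<i> *\<^sub>C v\<close> are real.\<close>

lemma commute: "B u v = cnj (B v u)"
proof -
  have "0 \<le> B (u + v) (u + v)" "0 \<le> B (u + \<i> *\<^sub>C v) (u + \<i> *\<^sub>C v)" "0 \<le> B u u" "0 \<le> B v v"
    by (rule nonneg)+
  then show ?thesis
    by (simp add: simps complex_nonneg_iff complex_eq_iff)
qed

text \<open>Moving \<open>u\<close> by \<open>- r * B v u\<close> times \<open>v\<close> lowers the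
  square by \<open>2 * r * b - r\<^sup>2 * b * c\<close>, which near-minimality caps at \<delta>.
  The best \<open>r\<close> is \<open>1 / c\<close>, and for \<open>c = 0\<close> an arbitrary
  \<open>r\<close> forces \<open>b = 0\<close>. Taking \<open>Re (B u u)\<close> for \<delta> turns
  the hypothesis into positivity and the conclusion into Cauchy-Schwarz.\<close>

lemma near_orthogonal:
  assumes "\<And>t. Re (B u u) - \<delta> \<le> Re (B (u + t *\<^sub>C v) (u + t *\<^sub>C v))"
  shows "(cmod (B v u))\<^sup>2 \<le> \<delta> * Re (B v v)"
proof -
  define b c where "b = (cmod (B v u))\<^sup>2" and "c = Re (B v v)"
  have c: "0 \<le> c" "B v v = c"
    using nonneg[of v] by (auto simp: c_def complex_nonneg_iff complex_eq_iff)
  have *: "2 * r * b - r\<^sup>2 * b * c \<le> \<delta>" for r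
  proof -
    have "B (u + (- r * B v u) *\<^sub>C v) (u + (- r * B v u) *\<^sub>C v)
        = B u u - 2 * r * (cnj (B v u) * B v u) + r\<^sup>2 * (cnj (B v u) * B v u) * c"
      by (simp add: simps c(2) commute[of u v] power2_eq_square algebra_simps)
    then have "Re (B (u + (- r * B v u) *\<^sub>C v) (u + (- r * B v u) *\<^sub>C v))
        = Re (B u u) - 2 * r * b + r\<^sup>2 * b * c"
      unfolding cnj_mult_self b_def[symmetric] by (simp flip: of_real_power)
    with assms[of "- r * B v u"] show ?thesis
      by simp
  qed
  show ?thesis
  proof (cases "c = 0")
    case True
    have "b = 0"
    proof (rule ccontr)
      assume "b \<noteq> 0"
      then have "b > 0"
        by (simp add: b_def)
      then show False
        using *[of "(\<delta> + 1) / (2 * b)"] True by (simp add: field_simps)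
    qed
    then show ?thesis
      using True by (simp add: b_def c_def)
  next
    case False
    with c have "c > 0" by simp
    then show ?thesis
      using *[of "1 / c"] unfolding b_def[symmetric] c_def[symmetric]
      by (simp add: power_divide power2_eq_square[of c] field_simps)
  qed
qed

lemma cauchy_schwarz: "(cmod (B v u))\<^sup>2 \<le> Re (B u u) * Re (B v v)"
  by (rule near_orthogonal) (use nonneg complex_nonneg_iff in force)

lemma null_left: "B u u = 0 \<Longrightarrow> B u v = 0"
  using cauchy_schwarz[of u v] by simp

lemma null_right: "B u u = 0 \<Longrightarrow> B v u = 0"
  using null_left[of u v] commute[of v u] by simp

text \<open>A residual of zero length is dropped instead of normalised, so \<open>k\<close> may fall
  short of \<open>n\<close> and each \<open>v j\<close> is recovered only up to a null vector. Null
  vectors are invisible to \<open>B\<close>, which is enough for a degenerate form; the last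
  property returns the vectors themselves when the form is definite.\<close>

lemma gram_schmidt:
  fixes v :: "nat \<Rightarrow> 'v" and n :: nat
  obtains k d t where "k \<le> n" "\<And>i j. i < k \<Longrightarrow> j < k \<Longrightarrow> B (d i) (d j) = (if i = j then 1 else 0)"
    "\<And>j w. j < n \<Longrightarrow> B w (v j) = (\<Sum>i<k. t i j * B w (d i))"
    "\<And>j. j < n \<Longrightarrow> B (v j - (\<Sum>i<k. t i j *\<^sub>C d i)) (v j - (\<Sum>i<k. t i j *\<^sub>C d i)) = 0"
proof -
  define null where "null u \<longleftrightarrow> B u u = 0" for u
  define P where "P n k d \<longleftrightarrow> k \<le> n \<and> (\<forall>i<k. \<forall>j<k. B (d i) (d j) = (if i = j then 1 else 0)) \<and>
      (\<forall>j<n. \<exists>t. null (v j - (\<Sum>i<k. t i *\<^sub>C d i)))" for n k and d :: "nat \<Rightarrow> 'v"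
  have "\<exists>k d. P n k d" for n
  proof (induction n)
    case 0
    show ?case by (auto simp: P_def)
  next
    case (Suc n)
    then obtain k d where "P n k d"
      by blast
    then have k: "k \<le> n" and d: "\<And>i j. i < k \<Longrightarrow> j < k \<Longrightarrow> B (d i) (d j) = (if i = j then 1 else 0)"
      and t: "\<And>j. j < n \<Longrightarrow> \<exists>t. null (v j - (\<Sum>i<k. t i *\<^sub>C d i))"
      by (auto simp: P_def)
    define w where "w = v n - (\<Sum>i<k. B (d i) (v n) *\<^sub>C d i)"
    show ?case
    proof (cases "null w")
      case True
      then have "P (Suc n) k d"
        using k d t unfolding P_def w_def by (auto simp: less_Suc_eq)
      then show ?thesis by blast
    next
      case False
      define r where "r = sqrt (Re (B w w))"
      have "B w w \<noteq> 0"
        using False by (simp add: null_def)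
      then have Bw: "0 < Re (B w w)" "B w w = Re (B w w)"
        using nonneg[of w] by (auto simp: complex_nonneg_iff complex_eq_iff)
      then have r: "r > 0" "B w w = r * r"
        by (auto simp: r_def simp flip: of_real_mult)
      have dw: "B (d i) w = 0" if "i < k" for i
      proof -
        have "(\<Sum>j<k. B (d j) (v n) * B (d i) (d j)) = (\<Sum>j<k. if j = i then B (d j) (v n) else 0)"
          using that by (intro sum.cong) (auto simp: d)
        then show ?thesis
          using that by (simp add: w_def simps right.sum)
      qed
      have wd: "B w (d i) = 0" if "i < k" for i
        using dw[OF that] commute[of w "d i"] by simp
      define e where "e = d(k := (1 / r) *\<^sub>C w)"
      have e: "B (e i) (e j) = (if i = j then 1 else 0)" if "i < Suc k" "j < Suc k" for i j
        using that r by (auto simp: e_def less_Suc_eq d dw wd simps)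
      have "\<exists>t. null (v j - (\<Sum>i<Suc k. t i *\<^sub>C e i))" if j: "j < Suc n" for j
      proof (cases "j = n")
        case True
        have "v j - (\<Sum>i<Suc k. (if i < k then B (d i) (v n) else r) *\<^sub>C e i) = 0"
          using r True by (simp add: e_def w_def scaleC_scaleC scaleC_one)
        then show ?thesis
          unfolding null_def using right.zero[of 0] by metis
      next
        case False
        then obtain t where t: "null (v j - (\<Sum>i<k. t i *\<^sub>C d i))"
          using t[of j] j by (auto simp: less_Suc_eq)
        have "(\<Sum>i<Suc k. (if i < k then t i else 0) *\<^sub>C e i) = (\<Sum>i<k. t i *\<^sub>C d i)"
          by (simp add: e_def scaleC_left.zero cong: sum.cong_simp)
        then show ?thesis
          using t by (intro exI[of _ "\<lambda>i. if i < k then t i else 0"]) (simp only:)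
      qed
      then have "P (Suc n) (Suc k) e"
        using k e unfolding P_def by auto
      then show ?thesis by blast
    qed
  qed
  then obtain k d where "P n k d"
    by blast
  then have k: "k \<le> n" and d: "\<And>i j. i < k \<Longrightarrow> j < k \<Longrightarrow> B (d i) (d j) = (if i = j then 1 else 0)"
    and "\<forall>j. \<exists>t. j < n \<longrightarrow> null (v j - (\<Sum>i<k. t i *\<^sub>C d i))"
    by (auto simp: P_def)
  then obtain t where t: "\<And>j. j < n \<Longrightarrow> null (v j - (\<Sum>i<k. t j i *\<^sub>C d i))"
    by metis
  show ?thesis
  proof (rule that[of k d "\<lambda>i j. t j i"])
    show "B w (v j) = (\<Sum>i<k. t j i * B w (d i))" if "j < n" for w j
      using null_right[OF t[OF that, unfolded null_def], of w]
      by (simp add: simps right.sum)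
  qed (use k d t in \<open>auto simp: null_def\<close>)
qed

end

interpretation hilbert: semi_inner "cinner :: 'h::chilbert_space \<Rightarrow> 'h \<Rightarrow> complex"
  by standard (simp_all add: cinner_simps)


section \<open>Square roots of positive elements\<close>

text \<open>A scalar majorant of the iteration \<open>y \<mapsto> (h + y\<^sup>2) / 2\<close>, whose limit satisfies
  \<open>(1 - y)\<^sup>2 = 1 - h\<close>. The bound is sharp enough to treat \<open>\<parallel>h\<parallel> = 1\<close>.\<close>

definition sqrt_iterate :: "nat \<Rightarrow> real" where
  "sqrt_iterate k = ((\<lambda>s. (1 + s * s) / 2) ^^ k) 0"

lemma sqrt_iterate_Suc: "sqrt_iterate (Suc k) = (1 + sqrt_iterate k * sqrt_iterate k) / 2"
  by (simp add: sqrt_iterate_def)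

lemma sqrt_iterate_bounds: "0 \<le> sqrt_iterate k" "sqrt_iterate k \<le> 1"
proof -
  have "0 \<le> sqrt_iterate k \<and> sqrt_iterate k \<le> 1"
  proof (induction k)
    case 0
    show ?case by (simp add: sqrt_iterate_def)
  next
    case (Suc k)
    then have "sqrt_iterate k * sqrt_iterate k \<le> 1 * 1"
      by (intro mult_mono) auto
    with Suc show ?case
      by (simp add: sqrt_iterate_Suc)
  qed
  then show "0 \<le> sqrt_iterate k" "sqrt_iterate k \<le> 1" by auto
qed

lemma sqrt_iterate_incseq: "incseq sqrt_iterate"
proof (rule incseq_SucI)
  fix k
  have "0 \<le> (1 - sqrt_iterate k)\<^sup>2" by simp
  then show "sqrt_iterate k \<le> sqrt_iterate (Suc k)"
    by (simp add: sqrt_iterate_Suc power2_eq_square algebra_simps)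
qed

lemma sqrt_iterate_convergent: "convergent sqrt_iterate"
proof (rule Bseq_monoseq_convergent)
  show "Bseq sqrt_iterate"
    by (rule BseqI'[where K = 1]) (simp add: sqrt_iterate_bounds)
qed (rule incseq_imp_monoseq[OF sqrt_iterate_incseq])



lemma dominated_convergent:
  fixes y :: "nat \<Rightarrow> 'b::banach"
  assumes "\<And>k. norm (y (Suc k) - y k) \<le> sqrt_iterate (Suc k) - sqrt_iterate k"
  shows "convergent y"
proof -
  have *: "norm (y (m + p) - y m) \<le> sqrt_iterate (m + p) - sqrt_iterate m" for m p
  proof (induction p)
    case (Suc p)
    have "norm (y (m + Suc p) - y m) \<le> norm (y (Suc (m + p)) - y (m + p)) + norm (y (m + p) - y m)"
      by (rule order_trans[OF _ norm_triangle_ineq]) simp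
    with Suc assms[of "m + p"] show ?case
      by simp
  qed simp
  have sqrt_Cauchy: "Cauchy sqrt_iterate"
    using sqrt_iterate_convergent by (simp add: Cauchy_convergent_iff)
  have "Cauchy y"
    unfolding Cauchy_altdef2
  proof (intro allI impI)
    fix e :: real assume "0 < e"
    then obtain N where N: "\<forall>n\<ge>N. dist (sqrt_iterate n) (sqrt_iterate N) < e"
      using sqrt_Cauchy unfolding Cauchy_altdef2 by blast
    have "dist (y n) (y N) < e" if "N \<le> n" for n
      using N[rule_format, OF that] *[of N "n - N"] that by (simp add: dist_norm)
    then show "\<exists>N. \<forall>n\<ge>N. dist (y n) (y N) < e"
      by blast
  qed
  then show ?thesis
    by (simp add: Cauchy_convergent_iff)
qed

text \<open>This takes the place of functional calculus in \<open>A\<close>: it exhibits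
  \<open>1 - h\<close> as \<open>star b * b\<close>, hence as an element on which positive
  functionals are non-negative.\<close>

lemma cstar_sqrt_one_minus:
  fixes h :: "'a::cstar_algebra_1"
  assumes h: "star h = h" "norm h \<le> 1"
  obtains b where "star b = b" "b * b = 1 - h"
proof -
  define y where "y k = ((\<lambda>z. (1/2) *\<^sub>R (h + z * z)) ^^ k) 0" for k
  have ySuc: "y (Suc k) = (1/2) *\<^sub>R (h + y k * y k)" for k
    by (simp add: y_def)
  have y0: "y 0 = 0"
    by (simp add: y_def)
  have norm_y: "norm (y k) \<le> sqrt_iterate k" for k
  proof (induction k)
    case (Suc k)
    have "norm (h + y k * y k) \<le> norm h + norm (y k) * norm (y k)"
      by (rule order_trans[OF norm_triangle_ineq add_left_mono[OF norm_mult_ineq]])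
    also have "\<dots> \<le> 1 + sqrt_iterate k * sqrt_iterate k"
      using h(2) Suc by (intro add_mono mult_mono) (auto simp: sqrt_iterate_bounds)
    finally show ?case
      by (simp add: ySuc sqrt_iterate_Suc)
  qed (simp add: y0 sqrt_iterate_def)
  have step: "norm (y (Suc k) - y k) \<le> sqrt_iterate (Suc k) - sqrt_iterate k" for k
  proof (induction k)
    case 0
    show ?case
      using h(2) by (simp add: ySuc y0 sqrt_iterate_def)
  next
    case (Suc k)
    \<comment> \<open>The difference of two squares is split without commuting
      \<open>y (Suc k)\<close> and \<open>y k\<close>. The scalar majorant obeys the same identity,
      so the induction closes exactly.\<close>
    have "y (Suc (Suc k)) - y (Suc k)
        = (1/2) *\<^sub>R (y (Suc k) * (y (Suc k) - y k) + (y (Suc k) - y k) * y k)"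
      unfolding ySuc[of "Suc k"] by (subst (3) ySuc) (simp add: algebra_simps)
    also have "norm \<dots> \<le> (1/2) * (norm (y (Suc k)) * norm (y (Suc k) - y k)
        + norm (y (Suc k) - y k) * norm (y k))"
      by (simp add: order_trans[OF norm_triangle_ineq add_mono[OF norm_mult_ineq norm_mult_ineq]])
    also have "\<dots> \<le> (1/2) * (sqrt_iterate (Suc k) * (sqrt_iterate (Suc k) - sqrt_iterate k)
        + (sqrt_iterate (Suc k) - sqrt_iterate k) * sqrt_iterate k)"
      using Suc norm_y[of k] norm_y[of "Suc k"]
      by (intro mult_left_mono add_mono mult_mono)
        (auto simp: sqrt_iterate_bounds incseq_SucD[OF sqrt_iterate_incseq])
    also have "\<dots> = sqrt_iterate (Suc (Suc k)) - sqrt_iterate (Suc k)"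
    proof -
      define s S where "s = sqrt_iterate k" and "S = sqrt_iterate (Suc k)"
      have "S = (1 + s * s) / 2"
        by (simp add: s_def S_def sqrt_iterate_Suc)
      then have "(1/2) * (S * (S - s) + (S - s) * s) = (1 + S * S) / 2 - S"
        by (simp add: field_simps)
      then show ?thesis
        by (simp add: s_def S_def sqrt_iterate_Suc[of "Suc k"])
    qed
    finally show ?case .
  qed
  obtain Y where Y: "y \<longlonglongrightarrow> Y"
    using dominated_convergent[OF step] convergent_def by blast
  have "(\<lambda>k. y (Suc k)) \<longlonglongrightarrow> (1/2) *\<^sub>R (h + Y * Y)"
    unfolding ySuc by (intro tendsto_intros Y)
  with Y have fix_Y: "Y = (1/2) *\<^sub>R (h + Y * Y)"
    using LIMSEQ_Suc LIMSEQ_unique by blast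
  have "star (y k) = y k" for k
    by (induction k) (simp_all add: y0 ySuc star_scaleR star_add star_mult h(1) star.zero)
  then have "star Y = Y"
    using bounded_linear.tendsto[OF bounded_linear_star Y] Y LIMSEQ_unique by fastforce
  moreover have "h + Y * Y = Y + Y"
    using arg_cong[OF fix_Y, of "\<lambda>z. 2 *\<^sub>R z"] by (simp add: scaleR_2)
  then have "(1 - Y) * (1 - Y) = 1 - h"
    by (simp add: algebra_simps)
  ultimately show ?thesis
    by (intro that[of "1 - Y"]) (auto simp: star.diff)
qed

section \<open>Positive kernels over a C*-algebra\<close>

text \<open>A family \<open>\<theta> j k\<close> is one linear functional on the
  \<open>n\<close>-by-\<open>n\<close> matrices over \<open>A\<close>, and this is its GNS form on
  matrices with a single row. Every \<open>star b * b\<close> is the sum of such terms over the rows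
  of \<open>b\<close>, so positivity on rows is positivity of the functional.\<close>

definition kernel_form ::
  "nat \<Rightarrow> (nat \<Rightarrow> nat \<Rightarrow> 'a::cstar_algebra_1 \<Rightarrow> complex) \<Rightarrow> (nat \<Rightarrow> 'a) \<Rightarrow> (nat \<Rightarrow> 'a) \<Rightarrow> complex" where
  "kernel_form n \<theta> u v = (\<Sum>j<n. \<Sum>k<n. \<theta> j k (star (u j) * v k))"

definition positive_kernel :: "nat \<Rightarrow> (nat \<Rightarrow> nat \<Rightarrow> 'a::cstar_algebra_1 \<Rightarrow> complex) \<Rightarrow> bool" where
  "positive_kernel n \<theta> \<longleftrightarrow>
     (\<forall>j<n. \<forall>k<n. clinear (\<theta> j k)) \<and> (\<forall>u. 0 \<le> kernel_form n \<theta> u u)"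

definition positive_functional :: "('a::cstar_algebra_1 \<Rightarrow> complex) \<Rightarrow> bool" where
  "positive_functional f \<longleftrightarrow> clinear f \<and> (\<forall>a. 0 \<le> f (star a * a))"

lemma clinear_add: "clinear f \<Longrightarrow> f (x + y) = f x + f y"
  by (simp add: clinear_def)

lemma clinear_scaleC: "clinear f \<Longrightarrow> f (c *\<^sub>C x) = c *\<^sub>C f x"
  by (simp add: clinear_def)

lemma clinear_additive: "clinear f \<Longrightarrow> Modules.additive f"
  by standard (simp add: clinear_add)

lemmas clinear_zero = additive.zero[OF clinear_additive]
lemmas clinear_minus = additive.minus[OF clinear_additive]
lemmas clinear_diff = additive.diff[OF clinear_additive]
lemmas clinear_sum = additive.sum[OF clinear_additive]
lemmas clinear_simps = clinear_zero clinear_add clinear_minus clinear_diff clinear_scaleC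

lemma scaleC_complex [simp]: "c *\<^sub>C (z::complex) = c * z"
  by (simp add: scaleC_complex_def)

lemma kernel_form_semi_inner:
  assumes "positive_kernel n \<theta>"
  shows "semi_inner (kernel_form n \<theta>)"
proof
  have lin: "clinear (\<theta> j k)" if "j < n" "k < n" for j k
    using assms that by (auto simp: positive_kernel_def)
  fix u v w :: "nat \<Rightarrow> 'a" and c
  show "kernel_form n \<theta> u (v + w) = kernel_form n \<theta> u v + kernel_form n \<theta> u w"
    unfolding kernel_form_def sum.distrib[symmetric]
    by (intro sum.cong) (simp_all add: distrib_left clinear_add lin)
  show "kernel_form n \<theta> (u + v) w = kernel_form n \<theta> u w + kernel_form n \<theta> v w"
    unfolding kernel_form_def sum.distrib[symmetric]
    by (intro sum.cong) (simp_all add: distrib_right star_add clinear_add lin)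
  show "kernel_form n \<theta> u (c *\<^sub>C v) = c * kernel_form n \<theta> u v"
    unfolding kernel_form_def sum_distrib_left
    by (intro sum.cong) (simp_all add: scaleC_mult_right clinear_scaleC lin)
  show "kernel_form n \<theta> (c *\<^sub>C u) v = cnj c * kernel_form n \<theta> u v"
    unfolding kernel_form_def sum_distrib_left
    by (intro sum.cong) (simp_all add: star_scaleC scaleC_mult_left clinear_scaleC lin)
  show "0 \<le> kernel_form n \<theta> u u"
    using assms by (simp add: positive_kernel_def)
qed

lemma kernel_form_mult_shift:
  "kernel_form n \<theta> (\<lambda>j. a * u j) v = kernel_form n \<theta> u (\<lambda>j. star a * v j)"
  by (simp add: kernel_form_def star_mult mult.assoc)

lemma cstar_contraction_defect:
  fixes a :: "'a::cstar_algebra_1"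
  assumes "a \<noteq> 0"
  obtains b where "star b = b" "b * b = 1 - (1 / (norm a)\<^sup>2) *\<^sub>R (star a * a)"
proof (rule cstar_sqrt_one_minus)
  show "star ((1 / (norm a)\<^sup>2) *\<^sub>R (star a * a)) = (1 / (norm a)\<^sup>2) *\<^sub>R (star a * a)"
    by (simp add: star_scaleR star_mult star_star)
  show "norm ((1 / (norm a)\<^sup>2) *\<^sub>R (star a * a)) \<le> 1"
    using assms by (simp add: cstar_identity)
qed (use that in blast)

text \<open>For \<open>a \<noteq> 0\<close> the gap between the two sides is
  \<open>(norm a)\<^sup>2\<close> times the form at the row \<open>b * u j\<close>, where
  \<open>b\<close> is the square root from \<open>cstar_contraction_defect\<close>.\<close>

lemma kernel_form_mult_bound:
  assumes "positive_kernel n \<theta>"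
  shows "Re (kernel_form n \<theta> (\<lambda>j. a * u j) (\<lambda>j. a * u j)) \<le> (norm a)\<^sup>2 * Re (kernel_form n \<theta> u u)"
proof -
  interpret semi_inner "kernel_form n \<theta>"
    by (rule kernel_form_semi_inner[OF assms])
  show ?thesis
  proof (cases "a = 0")
    case True
    then have "(\<lambda>j. a * u j) = 0"
      by auto
    then show ?thesis
      using True by (simp add: right.zero)
  next
    case False
    obtain b where b: "star b = b" "b * b = 1 - (1 / (norm a)\<^sup>2) *\<^sub>R (star a * a)"
      using cstar_contraction_defect[OF False] by blast
    have "kernel_form n \<theta> (\<lambda>j. b * u j) (\<lambda>j. b * u j) = kernel_form n \<theta> u (\<lambda>j. (b * b) * u j)"
      by (simp add: kernel_form_mult_shift b(1) mult.assoc)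
    also have "(\<lambda>j. (b * b) * u j)
        = u - complex_of_real (1 / (norm a)\<^sup>2) *\<^sub>C (\<lambda>j. star a * (a * u j))"
      by (rule ext) (simp add: b(2) left_diff_distrib scaleC_fun_def scaleC_mult_left mult.assoc scaleR_scaleC)
    also have "kernel_form n \<theta> u \<dots> = kernel_form n \<theta> u u
        - complex_of_real (1 / (norm a)\<^sup>2) * kernel_form n \<theta> (\<lambda>j. a * u j) (\<lambda>j. a * u j)"
      by (simp only: right.diff scaleC_right kernel_form_mult_shift)
    finally have "0 \<le> Re (kernel_form n \<theta> u u)
        - (1 / (norm a)\<^sup>2) * Re (kernel_form n \<theta> (\<lambda>j. a * u j) (\<lambda>j. a * u j))"
      using nonneg[of "\<lambda>j. b * u j"] by (simp add: complex_nonneg_iff)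
    then show ?thesis
      using False by (simp add: field_simps)
  qed
qed

lemma positive_kernel_functional:
  "positive_functional f \<Longrightarrow> positive_kernel 1 (\<lambda>_ _. f)"
  by (simp add: positive_functional_def positive_kernel_def kernel_form_def)

lemma positive_functional_clinear: "positive_functional f \<Longrightarrow> clinear f"
  by (simp add: positive_functional_def)

lemma positive_functional_semi_inner:
  assumes "positive_functional f"
  shows "semi_inner (\<lambda>a b. f (star a * b))"
proof -
  have f: "clinear f" "\<And>a. 0 \<le> f (star a * a)"
    using assms by (auto simp: positive_functional_def)
  show ?thesis
    by standard (simp_all add: f clinear_simps distrib_left distrib_right star_add star_scaleC
        scaleC_mult_right scaleC_mult_left)
qed

lemma positive_functional_mult_bound:
  assumes "positive_functional f"
  shows "Re (f (star (a * b) * (a * b))) \<le> (norm a)\<^sup>2 * Re (f (star b * b))"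
  using kernel_form_mult_bound[OF positive_kernel_functional[OF assms], of a "\<lambda>_. b"]
  by (simp add: kernel_form_def)

lemma positive_functional_star:
  assumes "positive_functional f"
  shows "f (star a) = cnj (f a)"
  using semi_inner.commute[OF positive_functional_semi_inner[OF assms], of a 1] by simp

text \<open>Positivity alone makes a functional bounded, so states can be defined without continuity
  and still form a compact set.\<close>

lemma positive_functional_bound:
  assumes "positive_functional f"
  shows "cmod (f a) \<le> norm a * Re (f 1)"
proof -
  interpret semi_inner "\<lambda>a b. f (star a * b)"
    by (rule positive_functional_semi_inner[OF assms])
  have pos: "0 \<le> Re (f 1)"
    using nonneg[of 1] by (simp add: complex_nonneg_iff)
  have "(cmod (f a))\<^sup>2 \<le> Re (f (star a * a)) * Re (f 1)"
    using cauchy_schwarz[of 1 a] by simp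
  also have "\<dots> \<le> ((norm a)\<^sup>2 * Re (f 1)) * Re (f 1)"
    using positive_functional_mult_bound[OF assms, of a 1] pos by (intro mult_right_mono) auto
  also have "\<dots> = (norm a * Re (f 1))\<^sup>2"
    by (simp add: power2_eq_square)
  finally show ?thesis
    by (rule power2_le_imp_le) (simp add: pos)
qed

lemma near_minimizer:
  fixes G :: "'b \<Rightarrow> real"
  assumes "\<And>x. 0 \<le> G x" "0 < \<delta>"
  obtains x where "\<And>y. G x - \<delta> \<le> G y"
proof -
  have bdd: "bdd_below (range G)"
    using assms(1) by (intro bdd_belowI2)
  have "(INF x. G x) < (INF x. G x) + \<delta>"
    using assms(2) by simp
  then obtain x where "G x < (INF x. G x) + \<delta>"
    by (subst (asm) cINF_less_iff) (use bdd in auto)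
  moreover have "(INF x. G x) \<le> G y" for y
    by (rule cINF_lower[OF bdd]) simp
  ultimately show ?thesis
    by (intro that[of x]) (smt (verit))
qed

section \<open>Approximation of a positive kernel by compressed functionals\<close>

definition kernel_of :: "(('a::cstar_algebra_1 \<Rightarrow> complex) \<times> (nat \<Rightarrow> 'a)) list \<Rightarrow> nat \<Rightarrow> nat \<Rightarrow> 'a \<Rightarrow> complex" where
  "kernel_of xs j k a = (\<Sum>(g, c)\<leftarrow>xs. g (star (c j) * a * c k))"

lemma kernel_of_simps [simp]:
  "kernel_of [] j k a = 0"
  "kernel_of ((g, c) # xs) j k a = g (star (c j) * a * c k) + kernel_of xs j k a"
  "kernel_of (xs @ ys) j k a = kernel_of xs j k a + kernel_of ys j k a"
  by (simp_all add: kernel_of_def)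

definition slot :: "nat \<Rightarrow> 'a::zero \<Rightarrow> nat \<Rightarrow> 'a" where
  "slot k a = (\<lambda>i. if i = k then a else 0)"

lemma kernel_form_slot:
  assumes "positive_kernel n \<theta>" "j < n" "k < n"
  shows "kernel_form n \<theta> (slot j a) (slot k b) = \<theta> j k (star a * b)"
proof -
  have lin: "clinear (\<theta> j k)" if "j < n" "k < n" for j k
    using assms that by (auto simp: positive_kernel_def)
  have "kernel_form n \<theta> (slot j a) (slot k b)
      = (\<Sum>i<n. \<Sum>l<n. if i = j \<and> l = k then \<theta> j k (star a * b) else 0)"
    unfolding kernel_form_def slot_def
    by (intro sum.cong) (auto simp: star.zero clinear_zero lin)
  also have "\<dots> = (\<Sum>i<n. if i = j then (\<Sum>l<n. if l = k then \<theta> j k (star a * b) else 0) else 0)"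
    by (intro sum.cong) auto
  also have "\<dots> = \<theta> j k (star a * b)"
    using assms by simp
  finally show ?thesis .
qed

text \<open>The cross terms are small because \<open>e\<^sub>j - c\<^sub>j e\<^sub>n\<close> nearly realises the distance of \<open>e\<^sub>j\<close>
  to \<open>A e\<^sub>n\<close>, hence is nearly orthogonal to \<open>A e\<^sub>n\<close>. Working with near-minimisers
  makes the completion of the pre-Hilbert space \<open>A\<^sup>n\<close> unnecessary.\<close>

lemma kernel_peel:
  fixes \<theta> :: "nat \<Rightarrow> nat \<Rightarrow> 'a::cstar_algebra_1 \<Rightarrow> complex"
  assumes \<theta>: "positive_kernel (Suc n) \<theta>" and S: "finite S" and \<epsilon>: "0 < \<epsilon>"
  obtains \<theta>' c where "positive_kernel n \<theta>'" "positive_functional (\<theta> n n)"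
    "\<And>a j k. a \<in> S \<Longrightarrow> j < Suc n \<Longrightarrow> k < Suc n \<Longrightarrow>
      cmod (\<theta> j k a - (if j < n \<and> k < n then \<theta>' j k a else 0) - \<theta> n n (star (c j) * a * c k)) < \<epsilon>"
proof -
  interpret semi_inner "kernel_form (Suc n) \<theta>"
    by (rule kernel_form_semi_inner[OF \<theta>])
  define B where "B = kernel_form (Suc n) \<theta>"
  define lm :: "'a \<Rightarrow> (nat \<Rightarrow> 'a) \<Rightarrow> nat \<Rightarrow> 'a" where "lm a u = (\<lambda>i. a * u i)" for a u
  define e :: "nat \<Rightarrow> nat \<Rightarrow> 'a" where "e j = slot j 1" for j
  define w :: "'a \<Rightarrow> nat \<Rightarrow> 'a" where "w b = slot n b" for b
  have lm_add: "lm a (u + v) = lm a u + lm a v" for a u v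
    by (rule ext) (simp add: lm_def distrib_left)
  have lm_w: "lm a (w b) = w (a * b)" for a b
    by (rule ext) (simp add: lm_def w_def slot_def)
  have w_diff: "w (a - b) = w a - w b" for a b
    by (rule ext) (simp add: w_def slot_def)
  have w_scale: "w (t *\<^sub>C b) = t *\<^sub>C w b" for t b
    by (rule ext) (simp add: w_def slot_def scaleC_right.zero)
  have shift: "B (lm a u) v = B u (lm (star a) v)" "B u (lm a v) = B (lm (star a) u) v" for a u v
    by (simp_all add: B_def lm_def kernel_form_mult_shift star_star)
  have lm_lm: "lm a (lm b u) = lm (a * b) u" for a b u
    by (rule ext) (simp add: lm_def mult.assoc)
  have lm_bound: "Re (B (lm a u) (lm a u)) \<le> (norm a)\<^sup>2 * Re (B u u)" for a u
    unfolding B_def lm_def by (rule kernel_form_mult_bound[OF \<theta>])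
  note [simp] = nonneg[folded B_def]
  have Re_nonneg [simp]: "0 \<le> Re (B u u)" for u
    using nonneg[of u] by (simp add: B_def complex_nonneg_iff)
  define A where "A = (\<Sum>a\<in>S. norm a)"
  have A: "norm a \<le> A" if "a \<in> S" for a
    unfolding A_def using S that by (intro member_le_sum) auto
  have A0: "0 \<le> A"
    unfolding A_def by (intro sum_nonneg) auto
  \<comment> \<open>By the parallelogram law for \<open>w (c j) = e j - u j\<close>: the square of
    \<open>u j\<close> exceeds that of \<open>e j\<close> by at most \<delta>, and \<delta> is at
    most 1, so this bounds the square of \<open>w (c j)\<close>.\<close>
  define M where "M = (\<Sum>j<Suc n. 4 * Re (B (e j) (e j)) + 2)"
  have M: "4 * Re (B (e j) (e j)) + 2 \<le> M" if "j < Suc n" for j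
    unfolding M_def by (rule member_le_sum) (use that in auto)
  have M0: "0 \<le> M"
    unfolding M_def by (intro sum_nonneg) auto
  \<comment> \<open>A cross term has square at most \<open>\<delta> * (A\<^sup>2 * M)\<close>, and
    two of them occur, so a bound of \<open>\<epsilon> / 4\<close> for each is ample. The summand 1
    keeps the denominator positive.\<close>
  define \<delta> where "\<delta> = min 1 ((\<epsilon> / 4)\<^sup>2 / (A\<^sup>2 * M + 1))"
  have AM: "0 < A\<^sup>2 * M + 1"
    using M0 by (simp add: add_nonneg_pos)
  have \<delta>: "0 < \<delta>" "\<delta> \<le> 1"
    using \<epsilon> AM by (simp_all add: \<delta>_def)
  have "\<delta> * (A\<^sup>2 * M + 1) \<le> (\<epsilon> / 4)\<^sup>2"
    using AM by (simp add: \<delta>_def flip: pos_le_divide_eq)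
  then have \<delta>AM: "\<delta> * (A\<^sup>2 * M) < (\<epsilon> / 4)\<^sup>2"
    using \<delta> by (simp add: algebra_simps)
  have "\<exists>c. \<forall>b. Re (B (e j - w c) (e j - w c)) - \<delta> \<le> Re (B (e j - w b) (e j - w b))" for j
    by (rule near_minimizer[of "\<lambda>c. Re (B (e j - w c) (e j - w c))" \<delta>]) (use \<delta> in auto)
  then obtain c0 where c0:
    "\<And>j b. Re (B (e j - w (c0 j)) (e j - w (c0 j))) - \<delta> \<le> Re (B (e j - w b) (e j - w b))"
    by metis
  \<comment> \<open>For \<open>j = n\<close> the coefficient 1 is an exact minimiser and makes
    \<open>u n\<close> vanish; the remainder then has nothing in row and column \<open>n\<close> and
    is a kernel of size \<open>n\<close>.\<close>
  define c where "c = c0(n := 1)"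
  define u where "u j = e j - w (c j)" for j
  have un: "u n = 0"
    by (rule ext) (simp add: u_def e_def w_def c_def)
  have min: "Re (B (u j) (u j)) - \<delta> \<le> Re (B (e j - w b) (e j - w b))" for j b
  proof (cases "j = n")
    case True
    then show ?thesis
      using un \<delta> Re_nonneg[of "e n - w b"] by (simp add: B_def right.zero)
  qed (use c0 in \<open>simp add: u_def c_def\<close>)
  have orth: "(cmod (B (w b) (u j)))\<^sup>2 \<le> \<delta> * Re (B (w b) (w b))" for b j
    unfolding B_def
  proof (rule near_orthogonal)
    fix t
    have "u j + t *\<^sub>C w b = e j - w (c j - t *\<^sub>C b)"
      by (simp add: u_def w_diff w_scale)
    then show "Re (kernel_form (Suc n) \<theta> (u j) (u j)) - \<delta>
        \<le> Re (kernel_form (Suc n) \<theta> (u j + t *\<^sub>C w b) (u j + t *\<^sub>C w b))"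
      using min[of j "c j - t *\<^sub>C b"] by (simp add: B_def)
  qed
  have wc: "Re (B (w (c j)) (w (c j))) \<le> M" if "j < Suc n" for j
  proof -
    have w: "w (c j) = e j - u j"
      by (simp add: u_def)
    have "Re (B (w (c j)) (w (c j))) + Re (B (e j + u j) (e j + u j))
        = 2 * Re (B (e j) (e j)) + 2 * Re (B (u j) (u j))"
      unfolding w by (simp add: B_def simps)
    moreover have "Re (B (u j) (u j)) - \<delta> \<le> Re (B (e j) (e j))"
      using min[of j 0] w_diff[of 0 0] by simp
    ultimately show ?thesis
      using M[OF that] \<delta>(2) Re_nonneg[of "e j + u j"] by linarith
  qed
  have cross: "cmod (B (w (a * c k)) (u j)) < \<epsilon> / 4" if "norm a \<le> A" "k < Suc n" for a j k
  proof -
    have "(cmod (B (w (a * c k)) (u j)))\<^sup>2 \<le> \<delta> * Re (B (w (a * c k)) (w (a * c k)))"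
      by (rule orth)
    also have "\<dots> \<le> \<delta> * ((norm a)\<^sup>2 * Re (B (w (c k)) (w (c k))))"
      using lm_bound[of a "w (c k)"] \<delta> by (simp add: lm_w)
    also have "\<dots> \<le> \<delta> * (A\<^sup>2 * M)"
      using that wc[of k] \<delta> A0 by (intro mult_left_mono mult_mono power_mono) auto
    also have "\<dots> < (\<epsilon> / 4)\<^sup>2"
      by (rule \<delta>AM)
    finally show ?thesis
      by (rule power_less_imp_less_base) (use \<epsilon> in simp)
  qed
  define \<theta>' where "\<theta>' j k a = B (u j) (lm a (u k))" for j k a
  have lm_linear: "lm (a + b) v = lm a v + lm b v" "lm (t *\<^sub>C a) v = t *\<^sub>C lm a v" for a b t v
    by (rule ext, simp add: lm_def distrib_right scaleC_mult_left)+
  have \<theta>'_pos: "positive_kernel n \<theta>'"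
    unfolding positive_kernel_def
  proof (intro conjI allI impI)
    fix j k
    show "clinear (\<theta>' j k)"
      by (simp add: clinear_def \<theta>'_def lm_linear B_def simps)
  next
    fix v :: "nat \<Rightarrow> 'a"
    have "kernel_form n \<theta>' v v = (\<Sum>j<n. \<Sum>k<n. B (lm (v j) (u j)) (lm (v k) (u k)))"
      by (simp add: kernel_form_def \<theta>'_def shift(1) lm_lm)
    also have "\<dots> = B (\<Sum>j<n. lm (v j) (u j)) (\<Sum>k<n. lm (v k) (u k))"
      unfolding B_def left.sum by (simp only: right.sum)
    finally show "0 \<le> kernel_form n \<theta>' v v"
      by simp
  qed
  have lin: "clinear (\<theta> n n)"
    using \<theta> by (simp add: positive_kernel_def)
  have \<theta>nn: "B (w a) (w b) = \<theta> n n (star a * b)" for a b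
    unfolding B_def w_def by (rule kernel_form_slot[OF \<theta>]) auto
  have pos: "positive_functional (\<theta> n n)"
    unfolding positive_functional_def using lin by (auto simp flip: \<theta>nn)
  have main: "cmod (\<theta> j k a - (if j < n \<and> k < n then \<theta>' j k a else 0) - \<theta> n n (star (c j) * a * c k)) < \<epsilon>"
    if a: "a \<in> S" and j: "j < Suc n" and k: "k < Suc n" for a j k
  proof -
    have e: "e j = u j + w (c j)" for j
      by (simp add: u_def)
    have "\<theta> j k a = B (e j) (lm a (e k))"
      using kernel_form_slot[OF \<theta> j k, of 1 a]
      by (simp add: B_def e_def lm_def slot_def if_distrib cong: if_cong)
    also have "\<dots> = B (u j) (lm a (u k)) + B (u j) (lm a (w (c k)))
        + (B (w (c j)) (lm a (u k)) + B (w (c j)) (lm a (w (c k))))"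
      unfolding e lm_add by (simp add: B_def simps)
    also have "B (w (c j)) (lm a (w (c k))) = \<theta> n n (star (c j) * a * c k)"
      by (simp add: lm_w \<theta>nn mult.assoc)
    also have "B (u j) (lm a (w (c k))) = cnj (B (w (a * c k)) (u j))"
      unfolding lm_w B_def by (rule commute)
    \<comment> \<open>Here \<open>a\<close> crosses to the left factor as \<open>star a\<close>,
      which has the same norm, so \<open>cross\<close> applies to both mixed terms.\<close>
    also have "B (w (c j)) (lm a (u k)) = B (w (star a * c j)) (u k)"
      by (simp add: shift(2) lm_w)
    also have "B (u j) (lm a (u k)) = (if j < n \<and> k < n then \<theta>' j k a else 0)"
    proof -
      have "lm a 0 = 0" by (rule ext) (simp add: lm_def)
      then show ?thesis
        using j k un by (auto simp: \<theta>'_def less_Suc_eq B_def right.zero left.zero)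
    qed
    finally have "\<theta> j k a - (if j < n \<and> k < n then \<theta>' j k a else 0) - \<theta> n n (star (c j) * a * c k)
        = cnj (B (w (a * c k)) (u j)) + B (w (star a * c j)) (u k)"
      by simp
    also have "cmod \<dots> \<le> cmod (B (w (a * c k)) (u j)) + cmod (B (w (star a * c j)) (u k))"
      by (rule order_trans[OF norm_triangle_ineq]) simp
    also have "\<dots> < \<epsilon> / 4 + \<epsilon> / 4"
      using A[OF a] j k by (intro add_strict_mono cross) auto
    finally show ?thesis
      using \<epsilon> by simp
  qed
  show ?thesis
    by (rule that[OF \<theta>'_pos pos main])
qed

lemma kernel_approx:
  fixes \<theta> :: "nat \<Rightarrow> nat \<Rightarrow> 'a::cstar_algebra_1 \<Rightarrow> complex"
  assumes "positive_kernel n \<theta>" and S: "finite S" and "0 < \<epsilon>"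
  obtains xs where "\<And>g c. (g, c) \<in> set xs \<Longrightarrow> positive_functional g"
    "\<And>a j k. a \<in> S \<Longrightarrow> j < n \<Longrightarrow> k < n \<Longrightarrow> cmod (\<theta> j k a - kernel_of xs j k a) < \<epsilon>"
proof -
  have "\<exists>xs. (\<forall>(g, c)\<in>set xs. positive_functional g) \<and>
      (\<forall>a\<in>S. \<forall>j<n. \<forall>k<n. cmod (\<theta> j k a - kernel_of xs j k a) < \<epsilon>)"
    using assms(1,3)
  proof (induction n arbitrary: \<theta> \<epsilon>)
    case 0
    show ?case
      by (rule exI[of _ "[]"]) auto
  next
    case (Suc n)
    from Suc.prems have "0 < \<epsilon> / 2" by simp
    then obtain \<theta>' c where \<theta>': "positive_kernel n \<theta>'" "positive_functional (\<theta> n n)" and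
      approx: "\<And>a j k. a \<in> S \<Longrightarrow> j < Suc n \<Longrightarrow> k < Suc n \<Longrightarrow>
        cmod (\<theta> j k a - (if j < n \<and> k < n then \<theta>' j k a else 0) - \<theta> n n (star (c j) * a * c k)) < \<epsilon> / 2"
      using kernel_peel[OF Suc.prems(1) S] by blast
    obtain xs where xs: "\<And>g c. (g, c) \<in> set xs \<Longrightarrow> positive_functional g"
      and xs': "\<And>a j k. a \<in> S \<Longrightarrow> j < n \<Longrightarrow> k < n \<Longrightarrow> cmod (\<theta>' j k a - kernel_of xs j k a) < \<epsilon> / 2"
      using Suc.IH[OF \<theta>'(1) \<open>0 < \<epsilon> / 2\<close>] by fast
    \<comment> \<open>The recursive kernel has size \<open>n\<close>. Its rows get the entry 0 from
      \<open>n\<close> on, so that they add nothing to row and column \<open>n\<close>, where the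
      peeled functional alone has to match \<theta>.\<close>
    define cut where "cut c = (\<lambda>j. if j < n then c j else (0::'a))" for c
    define ys where "ys = (\<theta> n n, c) # map (\<lambda>(g, c). (g, cut c)) xs"
    have ys: "\<forall>(g, c)\<in>set ys. positive_functional g"
      using xs \<theta>'(2) by (auto simp: ys_def)
    have cut: "kernel_of (map (\<lambda>(g, c). (g, cut c)) xs) j k a
        = (if j < n \<and> k < n then kernel_of xs j k a else 0)" for j k a
      using xs
    proof (induction xs)
      case (Cons x xs)
      obtain g c where x: "x = (g, c)"
        by (cases x)
      have "clinear g"
        using Cons.prems x positive_functional_clinear by auto
      then have "g 0 = 0"
        by (rule clinear_zero)
      moreover have "kernel_of (map (\<lambda>(g, c). (g, cut c)) xs) j k a
          = (if j < n \<and> k < n then kernel_of xs j k a else 0)"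
        using Cons by (meson list.set_intros(2))
      ultimately show ?case
        by (auto simp: x cut_def star.zero)
    qed simp
    have "cmod (\<theta> j k a - kernel_of ys j k a) < \<epsilon>"
      if a: "a \<in> S" and j: "j < Suc n" and k: "k < Suc n" for a j k
    proof -
      define z where "z = \<theta> j k a - (if j < n \<and> k < n then \<theta>' j k a else 0) - \<theta> n n (star (c j) * a * c k)"
      define z' where "z' = (if j < n \<and> k < n then \<theta>' j k a - kernel_of xs j k a else 0)"
      have "\<theta> j k a - kernel_of ys j k a = z + z'"
        by (simp add: z_def z'_def ys_def cut)
      moreover have "cmod z < \<epsilon> / 2"
        unfolding z_def by (rule approx[OF a j k])
      moreover have "cmod z' < \<epsilon> / 2"
        using xs'[OF a] Suc.prems by (simp add: z'_def)
      ultimately show ?thesis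
        using norm_triangle_ineq[of z z'] by simp
    qed
    with ys show ?case
      by blast
  qed
  then show ?thesis
    using that by fast
qed

section \<open>Krein-Milman in a space of complex functions\<close>

lemma linear_minimum_face_of:
  fixes L :: "'b::real_vector \<Rightarrow> real"
  assumes L: "linear L" and S: "convex S" and m: "\<And>x. x \<in> S \<Longrightarrow> m \<le> L x"
  shows "(S \<inter> {x. L x = m}) face_of S"
  unfolding face_of_def
proof (intro conjI ballI impI)
  show "convex (S \<inter> {x. L x = m})"
    by (intro convex_Int S) (auto simp: convex_def linear_add[OF L] linear_scale[OF L] simp flip: distrib_right)
next
  fix a b x
  assume ab: "a \<in> S" "b \<in> S" and "x \<in> S \<inter> {x. L x = m}" and x: "x \<in> open_segment a b"
  then have mx: "L x = m" by simp
  obtain u where u: "0 < u" "u < 1" "x = (1 - u) *\<^sub>R a + u *\<^sub>R b"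
    using x by (auto simp: in_segment)
  have "m = (1 - u) * L a + u * L b"
    using mx by (simp add: u(3) linear_add[OF L] linear_scale[OF L])
  then have "(1 - u) * (L a - m) + u * (L b - m) = 0"
    by algebra
  moreover have "0 \<le> (1 - u) * (L a - m)" "0 \<le> u * (L b - m)"
    using m[OF ab(1)] m[OF ab(2)] u by auto
  ultimately have "(1 - u) * (L a - m) = 0" "u * (L b - m) = 0"
    by linarith+
  then show "a \<in> S \<inter> {x. L x = m}" "b \<in> S \<inter> {x. L x = m}"
    using u ab by auto
qed auto

lemma linear_coordinate:
  "linear (\<lambda>x::'i \<Rightarrow> complex. Re (x i))" "linear (\<lambda>x::'i \<Rightarrow> complex. Im (x i))"
  by (auto intro!: linearI simp: scaleR_fun_def)

lemma continuous_coordinate: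
  "continuous_on S (\<lambda>x::'i \<Rightarrow> complex. x i)"
  by (rule continuous_on_product_coordinates[THEN continuous_on_subset]) simp

text \<open>A minimal non-empty closed face is a point: a continuous linear functional attains its
  minimum over the face on a closed subface, so it is constant there, and the real and imaginary
  parts of the coordinates separate points.\<close>

lemma extreme_point_exists:
  fixes S :: "('i \<Rightarrow> complex) set"
  assumes S: "compact S" "closed S" "convex S" "S \<noteq> {}"
  shows "\<exists>x. x extreme_point_of S"
proof -
  define Fs where "Fs = {F. F face_of S \<and> closed F \<and> F \<noteq> {}}"
  \<comment> \<open>Zorn's lemma yields maximal elements, so it is applied to the complements of
    faces.\<close>
  have "\<exists>M\<in>uminus ` Fs. \<forall>X\<in>uminus ` Fs. M \<subseteq> X \<longrightarrow> X = M"
  proof (rule subset_Zorn)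
    fix C assume C: "subset.chain (uminus ` Fs) C"
    show "\<exists>U\<in>uminus ` Fs. \<forall>X\<in>C. X \<subseteq> U"
    proof (cases "C = {}")
      case True
      have "S \<in> Fs"
        using S by (simp add: Fs_def face_of_refl)
      then show ?thesis
        using True by auto
    next
      case False
      define D where "D = uminus ` C"
      have D: "D \<subseteq> Fs" "D \<noteq> {}"
        using C False by (auto simp: D_def subset.chain_def)
      have D_chain: "X \<subseteq> Y \<or> Y \<subseteq> X" if mem: "X \<in> D" "Y \<in> D" for X Y
      proof -
        obtain X' Y' where XY: "X' \<in> C" "Y' \<in> C" "X = - X'" "Y = - Y'"
          using mem by (auto simp: D_def)
        then have "X' \<subseteq> Y' \<or> Y' \<subseteq> X'"
          using C by (simp add: subset_chain_def)
        then show ?thesis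
          unfolding XY by blast
      qed
      have fin: "\<exists>X\<in>D. X \<subseteq> \<Inter>F'" if "finite F'" "F' \<subseteq> D" for F'
        using that
      proof (induction F' rule: finite_induct)
        case empty
        then show ?case using D(2) by auto
      next
        case (insert Y F')
        then obtain X where X: "X \<in> D" "X \<subseteq> \<Inter>F'" by auto
        then show ?case
          using D_chain[of X Y] insert.prems by auto
      qed
      have "S \<inter> \<Inter>D \<noteq> {}"
      proof (rule compact_imp_fip[OF S(1)])
        fix F' assume "finite F'" "F' \<subseteq> D"
        then obtain X where "X \<in> D" "X \<subseteq> \<Inter>F'"
          using fin by blast
        moreover have "X \<subseteq> S" "X \<noteq> {}"
          using \<open>X \<in> D\<close> D(1) by (auto simp: Fs_def dest: face_of_imp_subset)
        ultimately show "S \<inter> \<Inter>F' \<noteq> {}"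
          by blast
      qed (use D(1) in \<open>auto simp: Fs_def\<close>)
      moreover have "\<Inter>D face_of S"
        using D by (intro face_of_Inter) (auto simp: Fs_def)
      moreover have "closed (\<Inter>D)"
        using D by (intro closed_Inter) (auto simp: Fs_def)
      ultimately have "\<Inter>D \<in> Fs"
        by (auto simp: Fs_def)
      then have "- \<Inter>D \<in> uminus ` Fs"
        by (rule imageI)
      moreover have "X \<subseteq> - \<Inter>D" if "X \<in> C" for X
      proof -
        have "- X \<in> D"
          unfolding D_def using that by (rule imageI)
        then show ?thesis by blast
      qed
      ultimately show ?thesis by blast
    qed
  qed
  then obtain M where M: "M \<in> Fs" and min: "\<And>F. F \<in> Fs \<Longrightarrow> F \<subseteq> M \<Longrightarrow> F = M"
    by auto
  have M': "M face_of S" "closed M" "M \<noteq> {}"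
    using M by (auto simp: Fs_def)
  have cM: "compact M"
    using compact_Int_closed[OF S(1) M'(2)] M'(1) by (metis Int_absorb1 face_of_imp_subset)
  have const: "L x = L y"
    if L: "linear L" "continuous_on UNIV L" and xy: "x \<in> M" "y \<in> M" for L :: "('i \<Rightarrow> complex) \<Rightarrow> real" and x y
  proof -
    obtain z where z: "z \<in> M" "\<And>x. x \<in> M \<Longrightarrow> L z \<le> L x"
      using continuous_attains_inf[OF cM M'(3) continuous_on_subset[OF L(2)]] by blast
    have "(M \<inter> {x. L x = L z}) face_of M"
      by (rule linear_minimum_face_of[OF L(1)]) (use z M'(1) face_of_imp_convex in auto)
    then have "(M \<inter> {x. L x = L z}) face_of S"
      using M'(1) face_of_trans by blast
    moreover have "closed (M \<inter> {x. L x = L z})"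
      by (intro closed_Int M'(2) closed_Collect_eq L(2) continuous_on_const)
    ultimately have "M \<inter> {x. L x = L z} = M"
      using z(1) by (intro min) (auto simp: Fs_def)
    then have "x \<in> {x. L x = L z}" "y \<in> {x. L x = L z}"
      using xy by blast+
    then show ?thesis
      by simp
  qed
  obtain x where x: "x \<in> M"
    using M'(3) by blast
  have "y = x" if "y \<in> M" for y
  proof (rule ext)
    fix i
    have "Re (y i) = Re (x i)"
      by (rule const[OF linear_coordinate(1) _ that x]) (intro continuous_intros continuous_coordinate)
    moreover have "Im (y i) = Im (x i)"
      by (rule const[OF linear_coordinate(2) _ that x]) (intro continuous_intros continuous_coordinate)
    ultimately show "y i = x i"
      by (rule complex_eqI)
  qed
  with x have "M = {x}" by blast
  with M'(1) show ?thesis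
    using face_of_singleton by metis
qed

text \<open>The minimum set of \<open>L\<close> is a compact face, and its extreme points are
  extreme in \<open>S\<close>.\<close>

lemma extreme_point_minimizing:
  fixes S :: "('i \<Rightarrow> complex) set"
  assumes S: "compact S" "closed S" "convex S" "S \<noteq> {}"
    and L: "linear L" "continuous_on UNIV L"
  obtains e where "e extreme_point_of S" "\<And>x. x \<in> S \<Longrightarrow> L e \<le> (L x :: real)"
proof -
  obtain z where z: "z \<in> S" "\<And>x. x \<in> S \<Longrightarrow> L z \<le> L x"
    using continuous_attains_inf[OF S(1,4) continuous_on_subset[OF L(2)]] by blast
  define F where "F = S \<inter> {x. L x = L z}"
  have F: "F face_of S"
    unfolding F_def by (rule linear_minimum_face_of[OF L(1) S(3)]) (use z in auto)
  have cl: "closed {x. L x = L z}"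
    by (intro closed_Collect_eq L(2) continuous_on_const)
  have "compact F" "closed F" "convex F" "F \<noteq> {}"
    using compact_Int_closed[OF S(1) cl] closed_Int[OF S(2) cl] face_of_imp_convex[OF F] z(1)
    by (auto simp: F_def)
  then obtain e where e: "e extreme_point_of F"
    using extreme_point_exists by blast
  then have "{e} face_of S"
    using F face_of_trans face_of_singleton by metis
  moreover have "L e = L z"
    using e by (auto simp: extreme_point_of_def F_def)
  ultimately show ?thesis
    using that z by (metis face_of_singleton)
qed

text \<open>Only finitely many coordinates count, so separation takes place in the semi-inner
  product of these coordinates. If the hull stays away from \<open>f\<close>, let \<open>h\<close>
  be a nearly closest point. Some extreme point \<open>e\<close> minimises the functional given by
  \<open>h - f\<close> over \<open>S\<close>, hence does no worse than \<open>f\<close> itself, and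
  a step from \<open>h\<close> towards \<open>e\<close> brings the hull closer to \<open>f\<close>
  than near-minimality permits.\<close>

theorem krein_milman_approx:
  fixes S :: "('i \<Rightarrow> complex) set"
  assumes S: "compact S" "closed S" "convex S" and f: "f \<in> S" and I: "finite I" and \<epsilon>: "0 < \<epsilon>"
  shows "\<exists>y \<in> convex hull {x. x extreme_point_of S}. \<forall>i\<in>I. cmod (f i - y i) < \<epsilon>"
proof (rule ccontr)
  assume no: "\<not> ?thesis"
  define C where "C = convex hull {x. x extreme_point_of S}"
  have CS: "C \<subseteq> S"
    unfolding C_def by (intro hull_minimal S(3)) (auto simp: extreme_point_of_def)
  define B :: "('i \<Rightarrow> complex) \<Rightarrow> ('i \<Rightarrow> complex) \<Rightarrow> complex" where
    "B u v = (\<Sum>i\<in>I. cnj (u i) * v i)" for u v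
  interpret semi_inner B
    by standard (simp_all add: B_def sum.distrib distrib_left distrib_right sum_distrib_left
        mult_ac sum_nonneg complex_nonneg_iff flip: complex_cnj_mult)
  have scaleR: "t *\<^sub>R (v :: 'i \<Rightarrow> complex) = complex_of_real t *\<^sub>C v" for t v
    by (simp add: scaleR_scaleC)
  have B_self: "Re (B u u) = (\<Sum>i\<in>I. (cmod (u i))\<^sup>2)" for u
    by (simp add: B_def cnj_mult_self)
  have far: "\<epsilon>\<^sup>2 \<le> Re (B (y - f) (y - f))" if y: "y \<in> C" for y
  proof -
    obtain i where i: "i \<in> I" "\<epsilon> \<le> cmod (f i - y i)"
      using no y unfolding C_def by (meson not_less)
    then have "\<epsilon>\<^sup>2 \<le> (cmod ((y - f) i))\<^sup>2"
      using \<epsilon> by (intro power_mono) (auto simp: norm_minus_commute)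
    also have "\<dots> \<le> Re (B (y - f) (y - f))"
      unfolding B_self by (rule member_le_sum) (use i I in auto)
    finally show ?thesis .
  qed
  have "\<exists>b. \<forall>x\<in>S. cmod (x i) \<le> b" for i
  proof -
    have "compact ((\<lambda>x. x i) ` S)"
      by (intro compact_continuous_image continuous_coordinate S)
    then show ?thesis
      using compact_imp_bounded bounded_iff by (metis imageI)
  qed
  then obtain b where b: "\<And>i x. x \<in> S \<Longrightarrow> cmod (x i) \<le> b i"
    by metis
  define M where "M = (\<Sum>i\<in>I. (2 * b i)\<^sup>2)"
  have M: "Re (B (x - y) (x - y)) \<le> M" if "x \<in> S" "y \<in> S" for x y
    unfolding B_self M_def
  proof (intro sum_mono power_mono)
    fix i
    show "cmod ((x - y) i) \<le> 2 * b i"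
      using norm_triangle_ineq4[of "x i" "y i"] b[OF that(1), of i] b[OF that(2), of i] by simp
  qed auto
  have M0: "0 \<le> M"
    unfolding M_def by (intro sum_nonneg) auto
  \<comment> \<open>Going the fraction \<open>t\<close> of the way from \<open>h\<close> to
    \<open>e\<close> changes the squared distance by
    \<open>2 * t * L z + t\<^sup>2 * Re (B z z)\<close> with \<open>z = e - h\<close>. The first
    term is at most \<open>- 2 * t * \<epsilon>\<^sup>2\<close>, the second at most
    \<open>t * \<epsilon>\<^sup>2\<close> since \<open>t * M \<le> \<epsilon>\<^sup>2\<close>; the
    gain is twice \<delta>.\<close>
  define t where "t = \<epsilon>\<^sup>2 / (M + \<epsilon>\<^sup>2)"
  have M\<epsilon>: "0 < M + \<epsilon>\<^sup>2"
    using M0 \<epsilon> by (simp add: add_nonneg_pos)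
  have t: "0 < t" "t \<le> 1"
    using M\<epsilon> M0 \<epsilon> by (simp_all add: t_def)
  have tM: "t * M \<le> \<epsilon>\<^sup>2"
    using M\<epsilon> M0 by (simp add: t_def field_simps)
  define \<delta> where "\<delta> = t * \<epsilon>\<^sup>2 / 2"
  have \<delta>: "0 < \<delta>"
    using t \<epsilon> by (simp add: \<delta>_def)
  have "C \<noteq> {}"
    using extreme_point_exists[OF S] f hull_subset[of "{x. x extreme_point_of S}" convex]
    by (auto simp: C_def)
  then obtain c0 where c0: "c0 \<in> C" by blast
  \<comment> \<open>\<open>near_minimizer\<close> ranges over a whole type, so points outside the
    hull are replaced by \<open>c0\<close>.\<close>
  obtain x0 where x0: "\<And>y. Re (B ((if x0 \<in> C then x0 else c0) - f) ((if x0 \<in> C then x0 else c0) - f)) - \<delta>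
      \<le> Re (B ((if y \<in> C then y else c0) - f) ((if y \<in> C then y else c0) - f))"
    by (rule near_minimizer[of "\<lambda>y. Re (B ((if y \<in> C then y else c0) - f) ((if y \<in> C then y else c0) - f))" \<delta>])
      (use \<delta> nonneg complex_nonneg_iff in auto)
  define h where "h = (if x0 \<in> C then x0 else c0)"
  have h: "h \<in> C" "\<And>y. y \<in> C \<Longrightarrow> Re (B (h - f) (h - f)) - \<delta> \<le> Re (B (y - f) (y - f))"
    using c0 x0 by (auto simp: h_def split: if_splits) metis+
  define w where "w = h - f"
  define L where "L x = Re (B w x)" for x
  have L: "linear L"
    by (rule linearI) (simp_all add: L_def simps scaleR)
  have "continuous_on UNIV L"
    unfolding L_def B_def by (intro continuous_intros continuous_coordinate)
  with S f L obtain e where e: "e extreme_point_of S" "\<And>x. x \<in> S \<Longrightarrow> L e \<le> L x"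
    using extreme_point_minimizing[of S L] by blast
  then have eC: "e \<in> C"
    unfolding C_def by (intro hull_inc) simp
  define z where "z = e - h"
  have "h + t *\<^sub>R z \<in> C"
  proof -
    have "h + t *\<^sub>R z = (1 - t) *\<^sub>R h + t *\<^sub>R e"
      by (simp add: z_def algebra_simps)
    then show ?thesis
      using convexD_alt[of C h e t] h(1) eC t convex_convex_hull by (auto simp: C_def)
  qed
  from h(2)[OF this] have "Re (B w w) - \<delta> \<le> Re (B (w + t *\<^sub>R z) (w + t *\<^sub>R z))"
    by (simp add: w_def algebra_simps)
  also have "\<dots> = Re (B w w) + 2 * t * L z + t * (t * Re (B z z))"
    using commute[of z w] by (simp add: scaleR simps L_def algebra_simps)
  also have "t * (t * Re (B z z)) \<le> t * \<epsilon>\<^sup>2"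
  proof -
    have "t * Re (B z z) \<le> t * M"
      unfolding z_def using M[of e h] eC h(1) CS t by (intro mult_left_mono) auto
    also note tM
    finally show ?thesis
      using t by (intro mult_left_mono) simp_all
  qed
  finally have 1: "- \<delta> \<le> 2 * t * L z + t * \<epsilon>\<^sup>2"
    by simp
  have "L z \<le> - (\<epsilon>\<^sup>2)"
  proof -
    have "L z = L e - L f - Re (B w w)"
      by (simp add: z_def L_def w_def simps)
    then show ?thesis
      using e(2)[OF f] far[OF h(1)] by (simp add: w_def)
  qed
  then have "t * L z \<le> t * (- (\<epsilon>\<^sup>2))"
    using t by (intro mult_left_mono) auto
  with 1 \<delta> show False
    by (simp add: \<delta>_def)
qed


section \<open>Pure states\<close>

text \<open>Purity is phrased through domination, the form in which the study of dominated
  completely positive maps consumes it. Extreme points of the state space enter through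
  \<open>extreme_state_pure\<close> only.\<close>

definition pure_state :: "('a::cstar_algebra_1 \<Rightarrow> complex) \<Rightarrow> bool" where
  "pure_state f \<longleftrightarrow> positive_functional f \<and> f 1 = 1 \<and>
     (\<forall>g. positive_functional g \<longrightarrow> positive_functional (\<lambda>a. f a - g a) \<longrightarrow> (\<exists>c. \<forall>a. g a = c * f a))"

definition state_space :: "('a::cstar_algebra_1 \<Rightarrow> complex) set" where
  "state_space = {f. positive_functional f \<and> f 1 = 1}"

lemma closed_state_space: "closed (state_space :: ('a::cstar_algebra_1 \<Rightarrow> complex) set)"
proof -
  have nn: "{f::'a \<Rightarrow> complex. 0 \<le> f a} = {f. 0 \<le> Re (f a)} \<inter> {f. Im (f a) = 0}" for a
    by (auto simp: complex_nonneg_iff)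
  have "(state_space :: ('a \<Rightarrow> complex) set) =
      (\<Inter>x. \<Inter>y. {f. f (x + y) = f x + f y}) \<inter> (\<Inter>c. \<Inter>x. {f. f (c *\<^sub>C x) = c * f x}) \<inter>
      (\<Inter>a. {f. 0 \<le> f (star a * a)}) \<inter> {f. f 1 = 1}"
    by (auto simp: state_space_def positive_functional_def clinear_def)
  also have "closed \<dots>"
    unfolding nn
    by (intro closed_Int closed_INT ballI closed_Collect_eq closed_Collect_le
        continuous_intros continuous_coordinate)
  finally show ?thesis .
qed

text \<open>Banach-Alaoglu by way of Tychonoff: states form a closed part of a product of discs of
  radius \<open>norm a\<close>.\<close>

lemma compact_state_space: "compact (state_space :: ('a::cstar_algebra_1 \<Rightarrow> complex) set)"
proof -
  have "compact (PiE UNIV (\<lambda>a::'a. cball (0::complex) (norm a)))"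
    using compactin_PiE[of "\<lambda>_::'a. euclidean :: complex topology" UNIV "\<lambda>a. cball 0 (norm a)"]
    by (simp add: euclidean_product_topology)
  then have "compact (PiE UNIV (\<lambda>a::'a. cball (0::complex) (norm a)) \<inter> state_space)"
    by (intro compact_Int_closed closed_state_space)
  moreover have "state_space \<subseteq> PiE UNIV (\<lambda>a::'a. cball (0::complex) (norm a))"
    using positive_functional_bound by (fastforce simp: state_space_def)
  ultimately show ?thesis
    by (simp add: Int_absorb1)
qed

lemma positive_functional_scale:
  assumes "positive_functional f" "0 \<le> r"
  shows "positive_functional (\<lambda>a. complex_of_real r * f a)"
  using assms unfolding positive_functional_def
  by (auto simp: clinear_def algebra_simps complex_nonneg_iff)

lemma positive_functional_add:
  assumes "positive_functional f" "positive_functional g"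
  shows "positive_functional (\<lambda>a. f a + g a)"
  using assms unfolding positive_functional_def
  by (auto simp: clinear_def algebra_simps)

lemma convex_state_space: "convex (state_space :: ('a::cstar_algebra_1 \<Rightarrow> complex) set)"
proof (rule convexI)
  fix f g :: "'a \<Rightarrow> complex" and u v :: real
  assume "f \<in> state_space" "g \<in> state_space" and uv: "0 \<le> u" "0 \<le> v" "u + v = 1"
  then have "positive_functional (\<lambda>a. complex_of_real u * f a + complex_of_real v * g a)"
    by (intro positive_functional_add positive_functional_scale) (auto simp: state_space_def)
  moreover have "u *\<^sub>R f + v *\<^sub>R g = (\<lambda>a. complex_of_real u * f a + complex_of_real v * g a)"
    by (rule ext) (simp add: scaleR_fun_def scaleR_conv_of_real)
  ultimately show "u *\<^sub>R f + v *\<^sub>R g \<in> state_space"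
    using \<open>f \<in> state_space\<close> \<open>g \<in> state_space\<close> uv
    by (simp add: state_space_def flip: of_real_add)
qed

lemma positive_functional_normalize:
  assumes g: "positive_functional g" and "g 1 = complex_of_real r" "r \<noteq> 0"
  shows "(\<lambda>a. complex_of_real (1 / r) * g a) \<in> state_space"
proof -
  have "0 \<le> r"
    using g assms(2) by (force simp: positive_functional_def complex_nonneg_iff dest: spec[of _ 1])
  then show ?thesis
    using assms positive_functional_scale[OF g, of "1 / r"] by (simp add: state_space_def)
qed

lemma positive_functional_at_one:
  assumes "positive_functional g"
  obtains r where "g 1 = complex_of_real r" "0 \<le> r"
proof -
  have "0 \<le> g (star 1 * 1)"
    using assms unfolding positive_functional_def by blast
  then show ?thesis
    using that[of "Re (g 1)"] by (simp add: complex_nonneg_iff complex_eq_iff)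
qed

lemma positive_functional_zero:
  assumes "positive_functional g" "g 1 = 0"
  shows "g a = 0"
  using positive_functional_bound[OF assms(1), of a] assms(2) by simp

text \<open>If neither \<open>g\<close> nor \<open>f - g\<close> vanishes at 1, normalising both
  writes \<open>f\<close> as a proper convex combination of two states, which must then coincide. A
  positive functional that vanishes at 1 is zero and is treated apart.\<close>

lemma extreme_state_pure:
  assumes "f extreme_point_of state_space"
  shows "pure_state f"
proof -
  have f: "positive_functional f" "f 1 = 1"
    using assms by (auto simp: extreme_point_of_def state_space_def)
  moreover have "\<exists>c. \<forall>a. g a = c * f a"
    if g: "positive_functional g" and fg: "positive_functional (\<lambda>a. f a - g a)" for g
  proof -
    obtain r where r: "g 1 = complex_of_real r" "0 \<le> r"
      using positive_functional_at_one[OF g] .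
    obtain s where s: "f 1 - g 1 = complex_of_real s" "0 \<le> s"
      using positive_functional_at_one[OF fg] .
    have rs: "r + s = 1"
      using r s f(2) by (metis add_diff_cancel_left' diff_add_cancel of_real_1 of_real_add of_real_eq_iff add.commute)
    consider "r = 0" | "s = 0" | "r \<noteq> 0" "s \<noteq> 0" by blast
    then show ?thesis
    proof cases
      case 1
      then show ?thesis
        using positive_functional_zero[OF g] r by (intro exI[of _ 0]) simp
    next
      case 2
      then show ?thesis
        using positive_functional_zero[OF fg] s by (intro exI[of _ 1]) simp
    next
      case 3
      define g' where "g' = (\<lambda>a. complex_of_real (1 / r) * g a)"
      define f' where "f' = (\<lambda>a. complex_of_real (1 / s) * (f a - g a))"
      have mem: "g' \<in> state_space" "f' \<in> state_space"
        unfolding g'_def f'_def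
        by (rule positive_functional_normalize[OF g r(1) 3(1)], rule positive_functional_normalize[OF fg s(1) 3(2)])
      have "f = r *\<^sub>R g' + s *\<^sub>R f'"
        using 3 by (auto simp: fun_eq_iff scaleR_fun_def g'_def f'_def scaleR_conv_of_real)
      moreover have "r = 1 - s"
        using rs by simp
      ultimately have f_eq: "f = (1 - s) *\<^sub>R g' + s *\<^sub>R f'"
        by simp
      moreover have "0 < s" "s < 1"
        using rs r s 3 by auto
      ultimately have "g' = f'"
        using assms mem by (force simp: extreme_point_of_def in_segment)
      then have "f = g'"
        using f_eq by (auto simp: fun_eq_iff scaleR_fun_def algebra_simps)
      then have "g a = complex_of_real r * f a" for a
        using 3 by (simp add: g'_def)
      then show ?thesis by blast
    qed
  qed
  ultimately show ?thesis
    by (simp add: pure_state_def)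
qed

lemma pure_state_exists:
  fixes f :: "'a::cstar_algebra_1 \<Rightarrow> complex"
  assumes "f \<in> state_space"
  obtains p :: "'a \<Rightarrow> complex" where "pure_state p"
proof -
  have "state_space \<noteq> ({} :: ('a \<Rightarrow> complex) set)"
    using assms by blast
  then obtain p :: "'a \<Rightarrow> complex" where "p extreme_point_of state_space"
    using extreme_point_exists[OF compact_state_space closed_state_space convex_state_space] by blast
  then show ?thesis
    using extreme_state_pure that by blast
qed

lemma positive_functional_approx:
  assumes g: "positive_functional g" and S: "finite S" and \<epsilon>: "0 < \<epsilon>"
  obtains ps where "\<And>p r. (p, r) \<in> set ps \<Longrightarrow> pure_state p \<and> 0 \<le> r"
    "\<And>a. a \<in> S \<Longrightarrow> cmod (g a - (\<Sum>(p, r)\<leftarrow>ps. complex_of_real r * p a)) < \<epsilon>"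
proof -
  obtain r where r: "g 1 = complex_of_real r" "0 \<le> r"
    using positive_functional_at_one[OF g] .
  show ?thesis
  proof (cases "r = 0")
    case True
    then show ?thesis
      using positive_functional_zero[OF g] r \<epsilon> by (intro that[of "[]"]) auto
  next
    case False
    then have "0 < r" using r by simp
    define f where "f = (\<lambda>a. complex_of_real (1 / r) * g a)"
    have f: "f \<in> state_space"
      unfolding f_def using g r(1) False by (rule positive_functional_normalize)
    obtain y where y: "y \<in> convex hull {x. x extreme_point_of state_space}"
      and yS: "\<And>a. a \<in> S \<Longrightarrow> cmod (f a - y a) < \<epsilon> / r"
      using krein_milman_approx[OF compact_state_space closed_state_space convex_state_space f S, of "\<epsilon> / r"]
        \<epsilon> \<open>0 < r\<close> by (meson divide_pos_pos)
    then obtain P u where P: "finite P" "P \<subseteq> {x. x extreme_point_of state_space}"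
      "\<And>x. x \<in> P \<Longrightarrow> 0 \<le> u x" and yP: "y = (\<Sum>v\<in>P. u v *\<^sub>R v)"
      unfolding convex_hull_explicit by blast
    obtain vs where vs: "set vs = P" "distinct vs"
      using finite_distinct_list[OF P(1)] by blast
    define ps where "ps = map (\<lambda>v. (v, r * u v)) vs"
    have "y a = (\<Sum>v\<in>P. complex_of_real (u v) * v a)" for a
      unfolding yP
    proof (induction P rule: infinite_finite_induct)
      case (insert v P)
      then show ?case by (simp add: scaleR_fun_def scaleR_conv_of_real)
    qed (simp_all add: zero_fun_def)
    then have "complex_of_real r * y a = (\<Sum>(p, r)\<leftarrow>ps. complex_of_real r * p a)" for a
      using vs by (simp add: ps_def sum_distrib_left mult.assoc o_def sum_list_distinct_conv_sum_set)
    moreover have "g a - complex_of_real r * y a = complex_of_real r * (f a - y a)" for a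
      using False by (simp add: f_def algebra_simps)
    ultimately have "cmod (g a - (\<Sum>(p, r)\<leftarrow>ps. complex_of_real r * p a)) < \<epsilon>" if "a \<in> S" for a
      using yS[OF that] \<open>0 < r\<close> by (metis (no_types, lifting) abs_of_pos mult.commute norm_mult norm_of_real pos_less_divide_eq)
    moreover have "pure_state p \<and> 0 \<le> s" if "(p, s) \<in> set ps" for p s
      using that P vs r extreme_state_pure by (auto simp: ps_def)
    ultimately show ?thesis
      by (rule that[rotated])
  qed
qed

lemma kernel_approx_pure:
  fixes \<theta> :: "nat \<Rightarrow> nat \<Rightarrow> 'a::cstar_algebra_1 \<Rightarrow> complex"
  assumes "positive_kernel n \<theta>" and S: "finite S" and \<epsilon>: "0 < \<epsilon>"
  obtains xs where "\<And>p c. (p, c) \<in> set xs \<Longrightarrow> pure_state p"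
    "\<And>a j k. a \<in> S \<Longrightarrow> j < n \<Longrightarrow> k < n \<Longrightarrow> cmod (\<theta> j k a - kernel_of xs j k a) < \<epsilon>"
proof -
  obtain xs where xs: "\<And>g c. (g, c) \<in> set xs \<Longrightarrow> positive_functional g"
    "\<And>a j k. a \<in> S \<Longrightarrow> j < n \<Longrightarrow> k < n \<Longrightarrow> cmod (\<theta> j k a - kernel_of xs j k a) < \<epsilon> / 2"
    using kernel_approx[OF assms(1) S, of "\<epsilon> / 2"] \<epsilon> by auto
  have "\<exists>ys. (\<forall>(p, c)\<in>set ys. pure_state p) \<and>
      (\<forall>a\<in>S. \<forall>j<n. \<forall>k<n. cmod (kernel_of xs j k a - kernel_of ys j k a) < \<epsilon>)" if "0 < \<epsilon>" for \<epsilon>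
    using xs(1) that
  proof (induction xs arbitrary: \<epsilon>)
    case Nil
    then show ?case
      by (intro exI[of _ "[]"]) simp
  next
    case (Cons x xs)
    obtain g c where x: "x = (g, c)" by (cases x)
    have \<epsilon>: "0 < \<epsilon> / 2" using Cons.prems by simp
    obtain ys where ys: "\<forall>(p, c)\<in>set ys. pure_state p"
      "\<forall>a\<in>S. \<forall>j<n. \<forall>k<n. cmod (kernel_of xs j k a - kernel_of ys j k a) < \<epsilon> / 2"
      using Cons.IH[OF _ \<epsilon>] Cons.prems(1) by (meson list.set_intros(2))
    define S' where "S' = (\<lambda>(a, j, k). star (c j) * a * c k) ` (S \<times> {..<n} \<times> {..<n})"
    have "positive_functional g" "finite S'"
      using Cons.prems x S by (auto simp: S'_def)
    then obtain ps where ps: "\<And>p r. (p, r) \<in> set ps \<Longrightarrow> pure_state p \<and> 0 \<le> r"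
      "\<And>a. a \<in> S' \<Longrightarrow> cmod (g a - (\<Sum>(p, r)\<leftarrow>ps. complex_of_real r * p a)) < \<epsilon> / 2"
      using positive_functional_approx[OF _ _ \<epsilon>] by blast
    \<comment> \<open>The weight \<open>r\<close> of a pure state is absorbed into the row as
      \<open>sqrt r\<close>, so the functionals themselves stay normalised.\<close>
    define zs where "zs = map (\<lambda>(p, r). (p, \<lambda>j. complex_of_real (sqrt r) *\<^sub>C c j)) ps"
    have zs: "kernel_of zs j k a = (\<Sum>(p, r)\<leftarrow>ps. complex_of_real r * p (star (c j) * a * c k))" for j k a
      using ps(1) unfolding zs_def
    proof (induction ps)
      case (Cons q qs)
      obtain p r where q: "q = (p, r)" by (cases q)
      have "clinear p" "0 \<le> r"
        using Cons.prems q by (auto simp: pure_state_def positive_functional_def)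
      then have "p (star (complex_of_real (sqrt r) *\<^sub>C c j) * a * complex_of_real (sqrt r) *\<^sub>C c k)
          = complex_of_real r * p (star (c j) * a * c k)"
        by (simp add: star_scaleC scaleC_mult_left scaleC_mult_right scaleC_scaleC clinear_scaleC
            flip: of_real_mult)
      moreover have "kernel_of (map (\<lambda>(p, r). (p, \<lambda>j. complex_of_real (sqrt r) *\<^sub>C c j)) qs) j k a
          = (\<Sum>(p, r)\<leftarrow>qs. complex_of_real r * p (star (c j) * a * c k))"
        using Cons by (meson list.set_intros(2))
      ultimately show ?case
        by (simp add: q)
    qed simp
    have "cmod (kernel_of (x # xs) j k a - kernel_of (zs @ ys) j k a) < \<epsilon>"
      if "a \<in> S" "j < n" "k < n" for a j k
    proof -
      have "star (c j) * a * c k \<in> S'"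
        using that by (force simp: S'_def)
      then have "cmod (g (star (c j) * a * c k) - kernel_of zs j k a) < \<epsilon> / 2"
        using ps(2) by (simp add: zs)
      moreover have "cmod (kernel_of xs j k a - kernel_of ys j k a) < \<epsilon> / 2"
        using ys that by blast
      ultimately have "cmod (g (star (c j) * a * c k) - kernel_of zs j k a)
          + cmod (kernel_of xs j k a - kernel_of ys j k a) < \<epsilon>"
        by simp
      moreover have "kernel_of (x # xs) j k a - kernel_of (zs @ ys) j k a
          = (g (star (c j) * a * c k) - kernel_of zs j k a) + (kernel_of xs j k a - kernel_of ys j k a)"
        by (simp add: x)
      ultimately show ?thesis
        using norm_triangle_lt by metis
    qed
    moreover have "\<forall>(p, c)\<in>set (zs @ ys). pure_state p"
      using ys(1) ps(1) by (auto simp: zs_def)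
    ultimately show ?case
      by blast
  qed
  then obtain ys where ys: "\<forall>(p, c)\<in>set ys. pure_state p"
      "\<forall>a\<in>S. \<forall>j<n. \<forall>k<n. cmod (kernel_of xs j k a - kernel_of ys j k a) < \<epsilon> / 2"
    using \<epsilon> half_gt_zero by blast
  show ?thesis
  proof (rule that[of ys])
    fix a j k assume *: "a \<in> S" "j < n" "k < n"
    have "\<theta> j k a - kernel_of ys j k a
        = (\<theta> j k a - kernel_of xs j k a) + (kernel_of xs j k a - kernel_of ys j k a)"
      by simp
    also have "cmod \<dots> < \<epsilon> / 2 + \<epsilon> / 2"
      using xs(2)[OF *] ys(2) * by (intro order_le_less_trans[OF norm_triangle_ineq] add_strict_mono) auto
    finally show "cmod (\<theta> j k a - kernel_of ys j k a) < \<epsilon>"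
      by simp
  qed (use ys in auto)
qed

section \<open>Positive operator matrices\<close>

lemma norm_cinner_le: "cmod (cinner x y) \<le> norm x * norm y"
  by (rule power2_le_imp_le)
    (use hilbert.cauchy_schwarz[of x y] in
      \<open>simp_all add: cinner_self power_mult_distrib mult.commute del: of_real_power\<close>)

lemma cinner_scaleR: "cinner x (r *\<^sub>R y) = complex_of_real r * cinner x y"
  by (simp add: scaleR_scaleC cinner_simps)

definition vform :: "nat \<Rightarrow> (nat \<Rightarrow> 'h::chilbert_space) \<Rightarrow> (nat \<Rightarrow> 'h) \<Rightarrow> complex" where
  "vform n x y = (\<Sum>i<n. cinner (x i) (y i))"

definition vnorm :: "nat \<Rightarrow> (nat \<Rightarrow> 'h::chilbert_space) \<Rightarrow> real" where
  "vnorm n x = L2_set (\<lambda>i. norm (x i)) {..<n}"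

definition mact :: "nat \<Rightarrow> (nat \<Rightarrow> nat \<Rightarrow> 'h::chilbert_space bop) \<Rightarrow> (nat \<Rightarrow> 'h) \<Rightarrow> nat \<Rightarrow> 'h" where
  "mact n X x i = (\<Sum>j<n. bop_apply (X i j) (x j))"

lemma vform_self: "vform n x x = complex_of_real ((vnorm n x)\<^sup>2)"
  by (simp add: vform_def vnorm_def L2_set_def cinner_self sum_nonneg)

lemma vnorm_nonneg [simp]: "0 \<le> vnorm n x"
  by (simp add: vnorm_def L2_set_def sum_nonneg)

lemma vnorm_add: "vnorm n (x + y) \<le> vnorm n x + vnorm n y"
  unfolding vnorm_def plus_fun_def
  by (rule order_trans[OF L2_set_mono L2_set_triangle_ineq]) (auto intro: norm_triangle_ineq)

lemma vnorm_scaleR: "vnorm n (r *\<^sub>R x) = \<bar>r\<bar> * vnorm n x"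
  by (simp add: vnorm_def scaleR_fun_def L2_set_left_distrib[symmetric] L2_set_right_distrib)

lemma norm_le_vnorm: "i < n \<Longrightarrow> norm (x i) \<le> vnorm n x"
  unfolding vnorm_def by (rule member_le_L2_set[where f = "\<lambda>i. norm (x i)"]) auto

lemma vnorm_le_sum: "vnorm n x \<le> (\<Sum>i<n. norm (x i))"
  unfolding vnorm_def by (rule L2_set_le_sum) auto

lemma vnorm_slot: "j < n \<Longrightarrow> vnorm n (slot j v) = norm v"
proof -
  assume "j < n"
  have "(\<Sum>i<n. (norm (slot j v i))\<^sup>2) = (\<Sum>i<n. if i = j then (norm v)\<^sup>2 else 0)"
    by (intro sum.cong) (auto simp: slot_def)
  then show ?thesis
    using \<open>j < n\<close> by (simp add: vnorm_def L2_set_def)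
qed

lemma mact_add_right: "mact n X (x + y) = mact n X x + mact n X y"
  by (rule ext) (simp add: mact_def bop_simps sum.distrib)

lemma mact_scaleC_right: "mact n X (c *\<^sub>C x) = c *\<^sub>C mact n X x"
  by (rule ext) (simp add: mact_def bop_simps scaleC_right.sum)

lemma mact_add: "mact n (X + Y) x = mact n X x + mact n Y x"
  by (rule ext) (simp add: mact_def bop_simps sum.distrib)

lemma mact_diff: "mact n (X - Y) x = mact n X x - mact n Y x"
  by (rule ext) (simp add: mact_def bop_simps sum_subtractf)

lemma mact_scaleR: "mact n (r *\<^sub>R X) x = r *\<^sub>R mact n X x"
  by (rule ext) (simp add: mact_def bop_simps scaleR_fun_def scaleR_sum_right)

definition mmult ::
  "nat \<Rightarrow> (nat \<Rightarrow> nat \<Rightarrow> 'h::chilbert_space bop) \<Rightarrow> (nat \<Rightarrow> nat \<Rightarrow> 'h bop) \<Rightarrow> nat \<Rightarrow> nat \<Rightarrow> 'h bop" where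
  "mmult n X Y i j = (\<Sum>k<n. X i k * Y k j)"

lemma mact_mmult: "mact n (mmult n X Y) x = mact n X (mact n Y x)"
proof
  fix i
  have "mact n (mmult n X Y) x i = (\<Sum>j<n. \<Sum>k<n. bop_apply (X i k) (bop_apply (Y k j) (x j)))"
    by (simp add: mact_def mmult_def bop_left.sum bop_simps)
  also have "\<dots> = mact n X (mact n Y x) i"
    unfolding mact_def bop_right.sum by (rule sum.swap)
  finally show "mact n (mmult n X Y) x i = mact n X (mact n Y x) i" .
qed

lemma mact_slot: "j < n \<Longrightarrow> mact n X (slot j v) i = bop_apply (X i j) v"
proof -
  assume "j < n"
  have "mact n X (slot j v) i = (\<Sum>k<n. if k = j then bop_apply (X i j) v else 0)"
    unfolding mact_def by (intro sum.cong) (auto simp: slot_def bop_right.zero)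
  then show ?thesis
    using \<open>j < n\<close> by simp
qed

lemma vform_slot: "i < n \<Longrightarrow> vform n (slot i u) y = cinner u (y i)"
proof -
  assume "i < n"
  have "vform n (slot i u) y = (\<Sum>k<n. if k = i then cinner u (y i) else 0)"
    unfolding vform_def by (intro sum.cong) (auto simp: slot_def cinner_left.zero)
  then show ?thesis
    using \<open>i < n\<close> by simp
qed

text \<open>An upper bound for the operator norm on the \<open>n\<close>-fold sum of
  \<open>H\<close>. The size \<open>n\<close> is a variable, so the matrices are no single instance
  of the algebra class; bounds are all that the iteration requires.\<close>

definition mbound :: "nat \<Rightarrow> (nat \<Rightarrow> nat \<Rightarrow> 'h::chilbert_space bop) \<Rightarrow> real \<Rightarrow> bool" where
  "mbound n X r \<longleftrightarrow> (\<forall>x. vnorm n (mact n X x) \<le> r * vnorm n x)"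

lemma mbound_entry:
  assumes "mbound n X r" "0 \<le> r" "i < n" "j < n"
  shows "norm (X i j) \<le> r"
proof (rule norm_bop_bound[OF assms(2)])
  fix v
  have "norm (bop_apply (X i j) v) \<le> vnorm n (mact n X (slot j v))"
    using norm_le_vnorm[OF assms(3), of "mact n X (slot j v)"] assms(4) by (simp add: mact_slot)
  also have "\<dots> \<le> r * norm v"
    using assms by (metis mbound_def vnorm_slot)
  finally show "norm (bop_apply (X i j) v) \<le> r * norm v" .
qed

lemma mbound_mmult:
  assumes "mbound n X r" "mbound n Y s" "0 \<le> r"
  shows "mbound n (mmult n X Y) (r * s)"
  unfolding mbound_def mact_mmult
proof
  fix x
  have "vnorm n (mact n X (mact n Y x)) \<le> r * vnorm n (mact n Y x)"
    using assms(1) by (simp add: mbound_def)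
  also have "\<dots> \<le> r * (s * vnorm n x)"
    using assms by (intro mult_left_mono) (auto simp: mbound_def)
  finally show "vnorm n (mact n X (mact n Y x)) \<le> r * s * vnorm n x"
    by (simp add: mult.assoc)
qed

lemma mbound_add:
  assumes "mbound n X r" "mbound n Y s"
  shows "mbound n (X + Y) (r + s)"
  unfolding mbound_def mact_add
proof
  fix x
  show "vnorm n (mact n X x + mact n Y x) \<le> (r + s) * vnorm n x"
    using vnorm_add[of n "mact n X x" "mact n Y x"] assms[unfolded mbound_def, THEN spec[of _ x]]
    by (simp add: distrib_right)
qed

lemma mbound_scaleR:
  assumes "mbound n X r" "0 \<le> c"
  shows "mbound n (c *\<^sub>R X) (c * r)"
  using assms by (auto simp: mbound_def mact_scaleR vnorm_scaleR mult.assoc intro!: mult_left_mono)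

lemma mbound_zero: "mbound n (0 :: nat \<Rightarrow> nat \<Rightarrow> 'h::chilbert_space bop) 0"
proof -
  have "mact n (0 :: nat \<Rightarrow> nat \<Rightarrow> 'h bop) x = 0" for x
    by (rule ext) (simp add: mact_def bop_simps)
  moreover have "vnorm n (0 :: nat \<Rightarrow> 'h) = 0"
    by (simp add: vnorm_def L2_set_def)
  ultimately show ?thesis
    by (simp add: mbound_def)
qed

lemma mbound_exists: "mbound n X (\<Sum>i<n. \<Sum>j<n. norm (X i j))"
  unfolding mbound_def
proof
  fix x
  have "vnorm n (mact n X x) \<le> (\<Sum>i<n. norm (mact n X x i))"
    by (rule vnorm_le_sum)
  also have "\<dots> \<le> (\<Sum>i<n. \<Sum>j<n. norm (X i j) * vnorm n x)"
    unfolding mact_def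
    by (intro sum_mono sum_norm_le order_trans[OF norm_bop_apply] mult_left_mono norm_le_vnorm) auto
  finally show "vnorm n (mact n X x) \<le> (\<Sum>i<n. \<Sum>j<n. norm (X i j)) * vnorm n x"
    by (simp add: sum_distrib_right)
qed

definition mpos :: "nat \<Rightarrow> (nat \<Rightarrow> nat \<Rightarrow> 'h::chilbert_space bop) \<Rightarrow> bool" where
  "mpos n X \<longleftrightarrow> (\<forall>x. 0 \<le> vform n x (mact n X x))"

lemma mpos_semi_inner:
  assumes "mpos n X"
  shows "semi_inner (\<lambda>x y. vform n x (mact n X y))"
proof
  fix u v w :: "nat \<Rightarrow> 'a" and c
  show "vform n u (mact n X (v + w)) = vform n u (mact n X v) + vform n u (mact n X w)"
    by (simp add: mact_add_right vform_def cinner_simps sum.distrib)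
  show "vform n (u + v) (mact n X w) = vform n u (mact n X w) + vform n v (mact n X w)"
    by (simp add: vform_def cinner_simps sum.distrib)
  show "vform n u (mact n X (c *\<^sub>C v)) = c * vform n u (mact n X v)"
    by (simp add: mact_scaleC_right vform_def cinner_simps sum_distrib_left)
  show "vform n (c *\<^sub>C u) (mact n X v) = cnj c * vform n u (mact n X v)"
    by (simp add: vform_def cinner_simps sum_distrib_left)
  show "0 \<le> vform n u (mact n X u)"
    using assms by (simp add: mpos_def)
qed

lemma mpos_hermitian:
  assumes "mpos n X" "i < n" "j < n"
  shows "star (X i j) = X j i"
proof -
  interpret semi_inner "\<lambda>x y. vform n x (mact n X y)"
    by (rule mpos_semi_inner[OF assms(1)])
  show ?thesis
  proof (rule bop_eqI, rule cinner_ext)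
    fix u v
    have "cinner v (bop_apply (star (X i j)) u) = cnj (cinner u (bop_apply (X i j) v))"
      by (simp add: cinner_star_right cinner_commute[of _ u])
    also have "\<dots> = cinner v (bop_apply (X j i) u)"
      using commute[of "slot i u" "slot j v"] assms by (simp add: vform_slot mact_slot)
    finally show "cinner v (bop_apply (star (X i j)) u) = cinner v (bop_apply (X j i) u)" .
  qed
qed

text \<open>For a positive matrix a bound on the form is already a bound on the operator:
  Cauchy-Schwarz at \<open>y = mact n X x\<close> and \<open>x\<close> bounds the fourth power of
  \<open>vnorm n y\<close> by a product of two values of the form.\<close>

lemma mpos_mbound:
  assumes pos: "mpos n X" and q: "0 \<le> q" "\<And>x. Re (vform n x (mact n X x)) \<le> q * (vnorm n x)\<^sup>2"
  shows "mbound n X q"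
  unfolding mbound_def
proof
  fix x
  interpret semi_inner "\<lambda>x y. vform n x (mact n X y)"
    by (rule mpos_semi_inner[OF pos])
  define y where "y = mact n X x"
  have pos': "0 \<le> Re (vform n x (mact n X x))" for x
    using nonneg[of x] by (simp add: complex_nonneg_iff)
  have "((vnorm n y)\<^sup>2)\<^sup>2 = (cmod (vform n y (mact n X x)))\<^sup>2"
    by (simp add: y_def vform_self norm_power)
  also have "\<dots> \<le> Re (vform n x (mact n X x)) * Re (vform n y (mact n X y))"
    by (rule cauchy_schwarz)
  also have "\<dots> \<le> (q * (vnorm n x)\<^sup>2) * (q * (vnorm n y)\<^sup>2)"
    by (intro mult_mono q pos') (simp add: q)
  also have "\<dots> = (q * vnorm n x * vnorm n y)\<^sup>2"
    by (simp add: power_mult_distrib power2_eq_square[of q])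
  finally have "(vnorm n y)\<^sup>2 \<le> q * vnorm n x * vnorm n y"
    by (rule power2_le_imp_le) (simp add: q)
  then have "vnorm n y * vnorm n y \<le> (q * vnorm n x) * vnorm n y"
    by (simp add: power2_eq_square)
  then show "vnorm n (mact n X x) \<le> q * vnorm n x"
    unfolding y_def[symmetric]
    by (cases "vnorm n y = 0") (auto simp: q mult_le_cancel_right order.strict_iff_order)
qed

definition mone :: "nat \<Rightarrow> nat \<Rightarrow> 'h::chilbert_space bop" where
  "mone i j = (if i = j then 1 else 0)"

lemma mact_mone: "i < n \<Longrightarrow> mact n mone x i = x i"
proof -
  assume "i < n"
  have "mact n mone x i = (\<Sum>j<n. if j = i then x i else 0)"
    unfolding mact_def mone_def by (intro sum.cong) (auto simp: bop_simps)
  then show ?thesis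
    using \<open>i < n\<close> by simp
qed

lemma mmult_mone: "i < n \<Longrightarrow> j < n \<Longrightarrow> mmult n mone X i j = X i j"
  "i < n \<Longrightarrow> j < n \<Longrightarrow> mmult n X mone i j = X i j"
proof -
  assume ij: "i < n" "j < n"
  have "mmult n mone X i j = (\<Sum>k<n. if k = i then X i j else 0)"
    unfolding mmult_def mone_def by (intro sum.cong) auto
  then show "mmult n mone X i j = X i j"
    using ij by simp
  have "mmult n X mone i j = (\<Sum>k<n. if k = j then X i j else 0)"
    unfolding mmult_def mone_def by (intro sum.cong) auto
  then show "mmult n X mone i j = X i j"
    using ij by simp
qed

lemma vform_mone_diff:
  "vform n x (mact n (mone - c *\<^sub>R X) x)
    = complex_of_real ((vnorm n x)\<^sup>2) - complex_of_real c * vform n x (mact n X x)"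
proof -
  have "mact n (mone - c *\<^sub>R X) x i = x i - c *\<^sub>R mact n X x i" if "i < n" for i
    unfolding mact_diff mact_scaleR using that by (simp add: mact_mone scaleR_fun_def)
  then have "vform n x (mact n (mone - c *\<^sub>R X) x)
      = (\<Sum>i<n. cinner (x i) (x i) - complex_of_real c * cinner (x i) (mact n X x i))"
    unfolding vform_def by (intro sum.cong) (simp_all add: cinner_simps cinner_scaleR)
  then show ?thesis
    using vform_self[of n x] by (simp add: sum_subtractf sum_distrib_left vform_def)
qed

lemma mpos_bounded:
  assumes "mpos n X"
  obtains K where "0 < K" "\<And>x. Re (vform n x (mact n X x)) \<le> K * (vnorm n x)\<^sup>2"
proof -
  define K where "K = (\<Sum>i<n. \<Sum>j<n. norm (X i j))"
  have "Re (vform n x (mact n X x)) \<le> (K + 1) * (vnorm n x)\<^sup>2" for x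
  proof -
    have "cmod (vform n x (mact n X x)) \<le> vnorm n x * vnorm n (mact n X x)"
    proof -
      have "cmod (vform n x (mact n X x)) \<le> (\<Sum>i<n. \<bar>norm (x i)\<bar> * \<bar>norm (mact n X x i)\<bar>)"
        unfolding vform_def by (intro sum_norm_le) (simp add: norm_cinner_le)
      also have "\<dots> \<le> vnorm n x * vnorm n (mact n X x)"
        unfolding vnorm_def by (rule L2_set_mult_ineq)
      finally show ?thesis .
    qed
    also have "\<dots> \<le> vnorm n x * (K * vnorm n x)"
      using mbound_exists[of n X] by (intro mult_left_mono) (auto simp: mbound_def K_def)
    also have "\<dots> \<le> (K + 1) * (vnorm n x)\<^sup>2"
      by (simp add: power2_eq_square algebra_simps)
    finally show ?thesis
      using complex_Re_le_cmod order_trans by blast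
  qed
  moreover have "0 < K + 1"
    unfolding K_def by (intro add_nonneg_pos sum_nonneg) auto
  ultimately show ?thesis
    using that by blast
qed

text \<open>The factor demanded by \<open>matrix_positive\<close> has to be produced from positivity
  of a form. The iteration of \<open>cstar_sqrt_one_minus\<close> is repeated for matrices:
  contractivity is measured by \<open>mbound\<close>, convergence entry by entry.\<close>

lemma matrix_sqrt:
  assumes pos: "mpos n M"
  obtains b where "\<And>i j. i < n \<Longrightarrow> j < n \<Longrightarrow> star (b i j) = b j i"
    "\<And>i j. i < n \<Longrightarrow> j < n \<Longrightarrow> mmult n b b i j = M i j"
proof -
  obtain K where K: "0 < K" "\<And>x. Re (vform n x (mact n M x)) \<le> K * (vnorm n x)\<^sup>2"
    using mpos_bounded[OF pos] by blast
  have form: "0 \<le> Re (vform n x (mact n M x))" "Im (vform n x (mact n M x)) = 0" for x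
    using pos by (auto simp: mpos_def complex_nonneg_iff)
  \<comment> \<open>\<open>K\<close> majorises the form of \<open>M\<close>, so the form of
    \<open>h\<close> lies between 0 and that of the identity and \<open>h\<close> is a contraction.
    No better bound than 1 can be expected, as \<open>M\<close> may fail to be invertible.\<close>
  define h where "h = mone - (1 / K) *\<^sub>R M"
  have h_form: "vform n x (mact n h x)
      = complex_of_real ((vnorm n x)\<^sup>2) - complex_of_real (1 / K) * vform n x (mact n M x)" for x
    unfolding h_def by (rule vform_mone_diff)
  have h_pos: "mpos n h"
    unfolding mpos_def
  proof
    fix x
    show "0 \<le> vform n x (mact n h x)"
      using K(1) K(2)[of x] form[of x] unfolding h_form
      by (simp add: complex_nonneg_iff field_simps flip: of_real_power)
  qed
  have "mbound n h 1"
    using h_pos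
  proof (rule mpos_mbound)
    fix x
    show "Re (vform n x (mact n h x)) \<le> 1 * (vnorm n x)\<^sup>2"
      using K(1) form[of x] unfolding h_form by (simp flip: of_real_power)
  qed simp
  define y where "y k = ((\<lambda>z. (1/2) *\<^sub>R (h + mmult n z z)) ^^ k) 0" for k
  have ySuc: "y (Suc k) = (1/2) *\<^sub>R (h + mmult n (y k) (y k))" for k
    by (simp add: y_def)
  have y0: "y 0 = 0"
    by (simp add: y_def)
  have bound_y: "mbound n (y k) (sqrt_iterate k)" for k
  proof (induction k)
    case 0
    show ?case
      using mbound_zero[of n] by (simp add: y0 sqrt_iterate_def zero_fun_def)
  next
    case (Suc k)
    have "mbound n (y (Suc k)) ((1/2) * (1 + sqrt_iterate k * sqrt_iterate k))"
      unfolding ySuc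
      by (intro mbound_scaleR mbound_add \<open>mbound n h 1\<close> mbound_mmult Suc) (simp_all add: sqrt_iterate_bounds)
    then show ?case
      by (simp add: sqrt_iterate_Suc)
  qed
  have mono: "sqrt_iterate k \<le> sqrt_iterate (Suc k)" for k
    using incseq_SucD[OF sqrt_iterate_incseq, of k] .
  have step: "mbound n (y (Suc k) - y k) (sqrt_iterate (Suc k) - sqrt_iterate k)" for k
  proof (induction k)
    case 0
    show ?case
      using bound_y[of 1] by (simp add: y0 sqrt_iterate_def)
  next
    case (Suc k)
    define s S where "s = sqrt_iterate k" and "S = sqrt_iterate (Suc k)"
    have "y (Suc (Suc k)) - y (Suc k) = (1/2) *\<^sub>R (h + mmult n (y (Suc k)) (y (Suc k)))
        - (1/2) *\<^sub>R (h + mmult n (y k) (y k))"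
      using ySuc[of "Suc k"] ySuc[of k] by simp
    also have "\<dots> = (1/2) *\<^sub>R (mmult n (y (Suc k)) (y (Suc k) - y k) + mmult n (y (Suc k) - y k) (y k))"
      by (intro ext) (simp add: scaleR_fun_def mmult_def algebra_simps sum.distrib sum_subtractf)
    finally have eq: "y (Suc (Suc k)) - y (Suc k)
        = (1/2) *\<^sub>R (mmult n (y (Suc k)) (y (Suc k) - y k) + mmult n (y (Suc k) - y k) (y k))" .
    have "mbound n (y (Suc (Suc k)) - y (Suc k)) ((1/2) * (S * (S - s) + (S - s) * s))"
      unfolding eq s_def S_def
      by (intro mbound_scaleR mbound_add mbound_mmult Suc bound_y) (simp_all add: sqrt_iterate_bounds mono)
    also have "(1/2) * (S * (S - s) + (S - s) * s) = sqrt_iterate (Suc (Suc k)) - sqrt_iterate (Suc k)"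
    proof -
      have "S = (1 + s * s) / 2"
        by (simp add: s_def S_def sqrt_iterate_Suc)
      then have "(1/2) * (S * (S - s) + (S - s) * s) = (1 + S * S) / 2 - S"
        by (simp add: field_simps)
      then show ?thesis
        by (simp add: s_def S_def sqrt_iterate_Suc[of "Suc k"])
    qed
    finally show ?case .
  qed
  have "\<exists>L. (\<lambda>k. y k i j) \<longlonglongrightarrow> L" if "i < n" "j < n" for i j
  proof -
    have "convergent (\<lambda>k. y k i j)"
    proof (rule dominated_convergent)
      fix k
      show "norm (y (Suc k) i j - y k i j) \<le> sqrt_iterate (Suc k) - sqrt_iterate k"
        using mbound_entry[OF step _ that, of k] mono[of k] by simp
    qed
    then show ?thesis
      by (simp add: convergent_def)
  qed
  then obtain Y where Y: "\<And>i j. i < n \<Longrightarrow> j < n \<Longrightarrow> (\<lambda>k. y k i j) \<longlonglongrightarrow> Y i j"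
    by metis
  have fix_Y: "h i j + mmult n Y Y i j = Y i j + Y i j" if "i < n" "j < n" for i j
  proof -
    have "(\<lambda>k. (1/2) *\<^sub>R (h i j + (\<Sum>l<n. y k i l * y k l j))) \<longlonglongrightarrow> (1/2) *\<^sub>R (h i j + (\<Sum>l<n. Y i l * Y l j))"
      using that by (intro tendsto_intros Y) auto
    moreover have "(\<lambda>k. y (Suc k) i j) = (\<lambda>k. (1/2) *\<^sub>R (h i j + (\<Sum>l<n. y k i l * y k l j)))"
      by (simp add: ySuc scaleR_fun_def mmult_def)
    ultimately have "(\<lambda>k. y (Suc k) i j) \<longlonglongrightarrow> (1/2) *\<^sub>R (h i j + mmult n Y Y i j)"
      by (simp add: mmult_def)
    with LIMSEQ_Suc[OF Y[OF that]] have "Y i j = (1/2) *\<^sub>R (h i j + mmult n Y Y i j)"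
      by (rule LIMSEQ_unique)
    from arg_cong[OF this, of "\<lambda>z. 2 *\<^sub>R z"] show ?thesis
      by (simp add: scaleR_2)
  qed
  have y_star: "star (y k i j) = y k j i" if "i < n" "j < n" for k i j
    using that
  proof (induction k arbitrary: i j)
    case 0
    show ?case by (simp add: y0 star.zero)
  next
    case (Suc k)
    have "star (\<Sum>l<n. y k i l * y k l j) = (\<Sum>l<n. y k j l * y k l i)"
      unfolding star.sum using Suc by (intro sum.cong) (auto simp: star_mult)
    then show ?case
      using Suc.prems mpos_hermitian[OF h_pos]
      by (simp add: ySuc scaleR_fun_def star_scaleR star_add mmult_def)
  qed
  have Y_star: "star (Y i j) = Y j i" if "i < n" "j < n" for i j
    using bounded_linear.tendsto[OF bounded_linear_star Y[OF that]] Y[OF that(2,1)]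
    by (simp add: y_star that LIMSEQ_unique)
  \<comment> \<open>The fixed point equation says that \<open>mone - Y\<close> squares to
    \<open>mone - h\<close>, that is, to \<open>M\<close> divided by \<open>K\<close>.\<close>
  define b where "b = sqrt K *\<^sub>R (mone - Y)"
  show ?thesis
  proof (rule that[of b])
    fix i j assume ij: "i < n" "j < n"
    show "star (b i j) = b j i"
      using ij by (auto simp: b_def scaleR_fun_def star_scaleR star.diff Y_star mone_def star.zero)
    have "mmult n b b i j = K *\<^sub>R mmult n (mone - Y) (mone - Y) i j"
      using K(1) by (simp add: b_def mmult_def scaleR_fun_def scaleR_sum_right)
    also have "mmult n (mone - Y) (mone - Y) i j
        = mmult n mone mone i j - mmult n mone Y i j - mmult n Y mone i j + mmult n Y Y i j"
      by (simp add: mmult_def algebra_simps sum.distrib sum_subtractf)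
    also have "\<dots> = mone i j - h i j"
      using fix_Y[OF ij] by (simp add: mmult_mone ij algebra_simps)
    also have "K *\<^sub>R (mone i j - h i j) = M i j"
      using K(1) by (simp add: h_def scaleR_fun_def)
    finally show "mmult n b b i j = M i j" .
  qed
qed


section \<open>Complete positivity\<close>

text \<open>Positivity of the sesquilinear form on \<open>A \<otimes> H\<close> from which
  Stinespring's space is built. For linear maps it amounts to complete positivity, and it passes to
  sums and compressions without a new factorisation.\<close>

definition form_positive :: "('a::cstar_algebra_1 \<Rightarrow> 'h::chilbert_space bop) \<Rightarrow> bool" where
  "form_positive \<phi> \<longleftrightarrow> (\<forall>(n::nat) a x.
     0 \<le> (\<Sum>i<n. \<Sum>j<n. cinner (x i) (bop_apply (\<phi> (star (a i) * a j)) (x j))))"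

lemma vform_mact: "vform n x (mact n X x) = (\<Sum>i<n. \<Sum>j<n. cinner (x i) (bop_apply (X i j) (x j)))"
  by (simp add: vform_def mact_def cinner_right.sum)

text \<open>A positive matrix over \<open>A\<close> is a sum, over the rows of its factor, of
  matrices with entries \<open>star (b k i) * b k j\<close>, which are the ones tested by the form.
  On the operator side \<open>matrix_sqrt\<close> supplies the factor.\<close>

lemma completely_positiveI:
  fixes \<phi> :: "'a::cstar_algebra_1 \<Rightarrow> 'h::chilbert_space bop"
  assumes lin: "clinear \<phi>" and pos: "form_positive \<phi>"
  shows "completely_positive \<phi>"
  unfolding completely_positive_def
proof (intro conjI allI impI lin)
  fix n :: nat and a :: "nat \<Rightarrow> nat \<Rightarrow> 'a"
  assume "matrix_positive n a"
  then obtain b where b: "\<And>i j. i < n \<Longrightarrow> j < n \<Longrightarrow> a i j = (\<Sum>k<n. star (b k i) * b k j)"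
    unfolding matrix_positive_def by blast
  have "mpos n (\<lambda>i j. \<phi> (a i j))"
    unfolding mpos_def vform_mact
  proof
    fix x
    have "(\<Sum>i<n. \<Sum>j<n. cinner (x i) (bop_apply (\<phi> (a i j)) (x j)))
        = (\<Sum>i<n. \<Sum>j<n. \<Sum>k<n. cinner (x i) (bop_apply (\<phi> (star (b k i) * b k j)) (x j)))"
      by (intro sum.cong) (simp_all add: b clinear_sum[OF lin] bop_left.sum cinner_right.sum)
    also have "\<dots> = (\<Sum>i<n. \<Sum>k<n. \<Sum>j<n. cinner (x i) (bop_apply (\<phi> (star (b k i) * b k j)) (x j)))"
      by (intro sum.cong sum.swap refl)
    also have "\<dots> = (\<Sum>k<n. \<Sum>i<n. \<Sum>j<n. cinner (x i) (bop_apply (\<phi> (star (b k i) * b k j)) (x j)))"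
      by (rule sum.swap)
    also have "0 \<le> \<dots>"
      by (rule sum_nonneg) (rule pos[unfolded form_positive_def, rule_format])
    finally show "0 \<le> (\<Sum>i<n. \<Sum>j<n. cinner (x i) (bop_apply (\<phi> (a i j)) (x j)))" .
  qed
  then obtain c where c: "\<And>i j. i < n \<Longrightarrow> j < n \<Longrightarrow> star (c i j) = c j i"
    "\<And>i j. i < n \<Longrightarrow> j < n \<Longrightarrow> mmult n c c i j = \<phi> (a i j)"
    using matrix_sqrt by blast
  show "matrix_positive n (\<lambda>i j. \<phi> (a i j))"
    unfolding matrix_positive_def
    by (rule exI[of _ c]) (simp add: c(1) flip: c(2) mmult_def)
qed

lemma completely_positiveD:
  fixes \<phi> :: "'a::cstar_algebra_1 \<Rightarrow> 'h::chilbert_space bop"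
  assumes "completely_positive \<phi>"
  shows "clinear \<phi>" "form_positive \<phi>"
proof -
  show "clinear \<phi>"
    using assms by (simp add: completely_positive_def)
  show "form_positive \<phi>"
    unfolding form_positive_def
  proof (intro allI)
    fix n :: nat and a :: "nat \<Rightarrow> 'a" and x :: "nat \<Rightarrow> 'h"
    have "matrix_positive n (\<lambda>i j. star (a i) * a j)"
      unfolding matrix_positive_def
    proof (intro exI allI impI)
      fix i j assume ij: "i < n" "j < n"
      \<comment> \<open>The factor has \<open>a\<close> as its row 0 and zeros below.\<close>
      have "(\<Sum>k<n. star (if k = 0 then a i else 0) * (if k = 0 then a j else 0))
          = (\<Sum>k<n. if k = 0 then star (a i) * a j else 0)"
        by (intro sum.cong) auto
      then show "star (a i) * a j = (\<Sum>k<n. star (if k = 0 then a i else 0) * (if k = 0 then a j else 0))"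
        using ij by simp
    qed
    then have "matrix_positive n (\<lambda>i j. \<phi> (star (a i) * a j))"
      using assms unfolding completely_positive_def by blast
    then obtain c where c: "\<And>i j. i < n \<Longrightarrow> j < n \<Longrightarrow> \<phi> (star (a i) * a j) = (\<Sum>k<n. star (c k i) * c k j)"
      unfolding matrix_positive_def by blast
    have "(\<Sum>i<n. \<Sum>j<n. cinner (x i) (bop_apply (\<phi> (star (a i) * a j)) (x j)))
        = (\<Sum>i<n. \<Sum>j<n. \<Sum>k<n. cinner (bop_apply (c k i) (x i)) (bop_apply (c k j) (x j)))"
      by (intro sum.cong) (simp_all add: c bop_left.sum cinner_right.sum bop_simps cinner_star_right)
    also have "\<dots> = (\<Sum>i<n. \<Sum>k<n. \<Sum>j<n. cinner (bop_apply (c k i) (x i)) (bop_apply (c k j) (x j)))"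
      by (intro sum.cong sum.swap refl)
    also have "\<dots> = (\<Sum>k<n. \<Sum>i<n. \<Sum>j<n. cinner (bop_apply (c k i) (x i)) (bop_apply (c k j) (x j)))"
      by (rule sum.swap)
    also have "\<dots> = (\<Sum>k<n. cinner (\<Sum>i<n. bop_apply (c k i) (x i)) (\<Sum>j<n. bop_apply (c k j) (x j)))"
      unfolding cinner_left.sum by (simp only: cinner_right.sum)
    also have "0 \<le> \<dots>"
      by (intro sum_nonneg) simp
    finally show "0 \<le> (\<Sum>i<n. \<Sum>j<n. cinner (x i) (bop_apply (\<phi> (star (a i) * a j)) (x j)))" .
  qed
qed

lemma form_positive_add:
  assumes "form_positive \<phi>" "form_positive \<psi>"
  shows "form_positive (\<lambda>a. \<phi> a + \<psi> a)"
  using assms unfolding form_positive_def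
  by (auto simp: bop_simps cinner_simps sum.distrib intro!: add_nonneg_nonneg)

lemma form_positive_sum:
  assumes "\<And>i. i \<in> I \<Longrightarrow> form_positive (\<phi> i)"
  shows "form_positive (\<lambda>a. \<Sum>i\<in>I. \<phi> i a)"
  using assms
proof (induction I rule: infinite_finite_induct)
  case (insert i I)
  then show ?case
    using form_positive_add[of "\<phi> i" "\<lambda>a. \<Sum>i\<in>I. \<phi> i a"] by simp
qed (simp_all add: form_positive_def bop_simps cinner_simps)

lemma form_positive_conj:
  assumes "form_positive \<phi>"
  shows "form_positive (\<lambda>a. star T * \<phi> a * T)"
  unfolding form_positive_def
proof (intro allI)
  fix n :: nat and a :: "nat \<Rightarrow> 'a" and x :: "nat \<Rightarrow> 'b"
  show "0 \<le> (\<Sum>i<n. \<Sum>j<n. cinner (x i) (bop_apply (star T * \<phi> (star (a i) * a j) * T) (x j)))"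
    using assms[unfolded form_positive_def, rule_format, where n = n and a = a and x = "\<lambda>i. bop_apply T (x i)"]
    by (simp add: bop_simps cinner_star_right)
qed

lemma clinear_conj:
  fixes \<phi> :: "'a::cstar_algebra_1 \<Rightarrow> 'b::cstar_algebra_1"
  assumes "clinear \<phi>"
  shows "clinear (\<lambda>a. S * \<phi> a * T)"
  using assms by (simp add: clinear_def algebra_simps scaleC_mult_left scaleC_mult_right)

lemma clinear_sum_fun:
  assumes "\<And>i. i \<in> I \<Longrightarrow> clinear (\<phi> i)"
  shows "clinear (\<lambda>a. \<Sum>i\<in>I. \<phi> i a)"
  using assms by (auto simp: clinear_def sum.distrib scaleC_right.sum)


section \<open>Operators on a Hilbert space\<close>



definition rank_one :: "'h::chilbert_space \<Rightarrow> 'h \<Rightarrow> 'h bop" where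
  "rank_one x y = Bop (Blinfun (\<lambda>z. cinner y z *\<^sub>C x))"

lemma rank_one_apply [simp]: "bop_apply (rank_one x y) z = cinner y z *\<^sub>C x"
proof -
  have "bounded_linear (\<lambda>z. cinner y z *\<^sub>C x)"
    by (rule bounded_linear_intro[where K = "norm x * norm y"])
      (auto simp: cinner_simps scaleR_scaleC scaleC_add_left scaleC_scaleC norm_scaleC_hilbert
        intro!: order_trans[OF mult_right_mono[OF norm_cinner_le]])
  then show ?thesis
    by (simp add: rank_one_def bop_apply.rep_eq Bop_inverse bounded_linear_Blinfun_apply
        cinner_simps scaleC_scaleC)
qed

lemma bop_eqI_cinner: "(\<And>x y. cinner x (bop_apply S y) = cinner x (bop_apply T y)) \<Longrightarrow> S = T"
  by (rule bop_eqI, rule cinner_ext)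

lemma star_rank_one: "star (rank_one x y) = rank_one y x"
proof (rule bop_eqI_cinner)
  fix u v
  show "cinner u (bop_apply (star (rank_one x y)) v) = cinner u (bop_apply (rank_one y x) v)"
    using cinner_commute[of u y] by (simp add: cinner_star_right cinner_simps)
qed



text \<open>Polarisation; the test vector \<open>x + \<i> *\<^sub>C y\<close> makes this specific to
  complex scalars.\<close>

lemma bop_zeroI:
  fixes X :: "'h::chilbert_space bop"
  assumes "\<And>y. cinner y (bop_apply X y) = 0"
  shows "X = 0"
proof (rule bop_eqI_cinner)
  fix x y
  have "cinner (x + y) (bop_apply X (x + y)) = 0" "cinner (x + \<i> *\<^sub>C y) (bop_apply X (x + \<i> *\<^sub>C y)) = 0"
    by (rule assms)+
  then have "cinner x (bop_apply X y) + cinner y (bop_apply X x) = 0"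
    "\<i> * cinner x (bop_apply X y) - \<i> * cinner y (bop_apply X x) = 0"
    using assms[of x] assms[of y] by (simp_all add: cinner_simps bop_simps)
  then show "cinner x (bop_apply X y) = cinner x (bop_apply 0 y)"
    by (simp add: bop_simps cinner_simps complex_eq_iff)
qed

lemma operator_sqrt:
  fixes E :: "'h::chilbert_space bop"
  assumes "\<And>x. 0 \<le> cinner x (bop_apply E x)"
  obtains b where "star b = b" "b * b = E"
proof -
  have "mpos 1 (\<lambda>_ _. E)"
    using assms by (simp add: mpos_def vform_def mact_def)
  then obtain c where c: "\<And>i j. i < 1 \<Longrightarrow> j < 1 \<Longrightarrow> star (c i j) = c j i"
    "\<And>i j. i < 1 \<Longrightarrow> j < 1 \<Longrightarrow> mmult 1 c c i j = E"
    by (rule matrix_sqrt) blast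
  show ?thesis
    using c[of 0 0] by (intro that[of "c 0 0"]) (simp_all add: mmult_def)
qed

lemma invertible_one_minus:
  fixes h :: "'a::cstar_algebra_1"
  assumes "norm h \<le> q" "q < 1"
  shows "invertible_elem (1 - h)"
proof -
  have q: "0 \<le> q"
    using assms(1) norm_ge_zero order_trans by blast
  \<comment> \<open>The factor \<open>norm 1\<close> covers the zero algebra, where it is 0,
    together with all others, where it is 1.\<close>
  have bound: "norm (h ^ k) \<le> norm (1::'a) * q ^ k" for k
  proof (induction k)
    case (Suc k)
    have "norm (h ^ Suc k) \<le> norm h * norm (h ^ k)"
      by (simp add: norm_mult_ineq)
    also have "\<dots> \<le> q * (norm (1::'a) * q ^ k)"
      by (intro mult_mono Suc assms q) auto
    finally show ?case
      by (simp add: mult_ac)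
  qed simp
  have "summable (\<lambda>k. norm (1::'a) * q ^ k)"
    using q assms(2) by (intro summable_mult summable_geometric) simp
  then have sm: "summable (\<lambda>k. h ^ k)"
    by (rule summable_comparison_test'[where N = 0]) (rule bound)
  define s where "s = (\<Sum>k. h ^ k)"
  have s: "s = 1 + (\<Sum>k. h ^ Suc k)"
    using suminf_split_head[OF sm] by (simp add: s_def)
  have "h * s = (\<Sum>k. h ^ Suc k)" "s * h = (\<Sum>k. h ^ Suc k)"
    using suminf_mult[OF sm, of h] suminf_mult2[OF sm, of h] by (simp_all add: s_def power_commutes)
  then have "(1 - h) * s = 1" "s * (1 - h) = 1"
    using s by (simp_all add: algebra_simps)
  then show ?thesis
    unfolding invertible_elem_def by blast
qed

text \<open>Divided by \<open>K\<close>, the operator differs from the identity by at most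
  \<open>1 - c / K\<close> in norm, and the Neumann series inverts it.\<close>

lemma invertible_positive_definite:
  fixes E :: "'h::chilbert_space bop"
  assumes pos: "\<And>x. 0 \<le> cinner x (bop_apply E x)"
    and c: "0 < c" "\<And>x. c * (norm x)\<^sup>2 \<le> Re (cinner x (bop_apply E x))"
  shows "invertible_elem E"
proof -
  define K where "K = norm E + c"
  have K: "0 < K" "c \<le> K"
    using c(1) by (simp_all add: K_def add_nonneg_pos)
  define h where "h = 1 - (1 / K) *\<^sub>R E"
  have upper: "Re (cinner x (bop_apply E x)) \<le> K * (norm x)\<^sup>2" for x
  proof -
    have "Re (cinner x (bop_apply E x)) \<le> norm x * norm (bop_apply E x)"
      using complex_Re_le_cmod norm_cinner_le order_trans by blast
    also have "\<dots> \<le> norm x * (norm E * norm x)"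
      by (intro mult_left_mono norm_bop_apply) simp
    also have "\<dots> \<le> K * (norm x)\<^sup>2"
      using c(1) by (simp add: K_def power2_eq_square algebra_simps)
    finally show ?thesis .
  qed
  have form: "cinner x (bop_apply h x)
      = complex_of_real ((norm x)\<^sup>2 - (1 / K) * Re (cinner x (bop_apply E x)))" for x
    by (simp add: h_def bop_simps cinner_simps scaleR_scaleC cinner_self flip: complex_nonneg_eq[OF pos])
  have "mpos 1 (\<lambda>_ _. h)"
    using upper K(1)
    by (simp add: mpos_def vform_def mact_def form complex_nonneg_iff field_simps del: of_real_diff of_real_mult)
  moreover have "vnorm 1 x = norm (x 0)" for x :: "nat \<Rightarrow> 'h"
    by (simp add: vnorm_def L2_set_def)
  moreover have "(norm x)\<^sup>2 - (1 / K) * Re (cinner x (bop_apply E x)) \<le> (1 - c / K) * (norm x)\<^sup>2" for x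
    using c(2)[of x] K(1) by (simp add: field_simps)
  ultimately have "mbound 1 (\<lambda>_ _. h) (1 - c / K)"
    using K by (intro mpos_mbound) (simp_all add: vform_def mact_def form del: of_real_diff of_real_mult)
  then have "norm h \<le> 1 - c / K"
    using K by (rule_tac mbound_entry[of 1 "\<lambda>_ _. h" _ 0 0]) auto
  then have "invertible_elem (1 - h)"
    by (rule invertible_one_minus) (use K c in simp)
  then obtain z where "(1 - h) * z = 1" "z * (1 - h) = 1"
    unfolding invertible_elem_def by blast
  then have "E * ((1 / K) *\<^sub>R z) = 1" "((1 / K) *\<^sub>R z) * E = 1"
    by (simp_all add: h_def)
  then show ?thesis
    unfolding invertible_elem_def by blast
qed

section \<open>Vector states of a pure state\<close>

lemma tendsto_zero_dominated:
  fixes z :: "'b \<Rightarrow> 'c::real_normed_vector"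
  assumes "\<And>r. norm (z r) \<le> e r" "(e \<longlongrightarrow> 0) G"
  shows "(z \<longlongrightarrow> 0) G"
  by (rule Lim_null_comparison[OF _ assms(2)]) (simp add: assms(1))

context semi_inner
begin

definition snorm :: "'v \<Rightarrow> real" where
  "snorm u = sqrt (Re (B u u))"

lemma Re_nonneg: "0 \<le> Re (B u u)"
  using nonneg[of u] by (simp add: complex_nonneg_iff)

lemma snorm_nonneg [simp]: "0 \<le> snorm u"
  by (simp add: snorm_def Re_nonneg)

lemma snorm_power2: "(snorm u)\<^sup>2 = Re (B u u)"
  by (simp add: snorm_def Re_nonneg)

lemma self_eq: "B u u = complex_of_real ((snorm u)\<^sup>2)"
  unfolding snorm_power2 by (rule complex_nonneg_eq[OF nonneg])

lemma cmod_le_snorm: "cmod (B u v) \<le> snorm u * snorm v"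
  by (rule power2_le_imp_le)
    (use cauchy_schwarz[of u v] in \<open>simp_all add: power_mult_distrib snorm_power2 mult.commute\<close>)

lemma snorm_triangle: "snorm (u + v) \<le> snorm u + snorm v"
proof (rule power2_le_imp_le)
  have "(snorm (u + v))\<^sup>2 = (snorm u)\<^sup>2 + (snorm v)\<^sup>2 + 2 * Re (B u v)"
    using commute[of v u] by (simp add: snorm_power2 simps)
  also have "Re (B u v) \<le> snorm u * snorm v"
    using cmod_le_snorm complex_Re_le_cmod order_trans by blast
  finally show "(snorm (u + v))\<^sup>2 \<le> (snorm u + snorm v)\<^sup>2"
    by (simp add: power2_sum)
qed simp

lemma snorm_minus: "snorm (- u) = snorm u"
  by (simp add: snorm_def simps)

lemma snorm_minus_commute: "snorm (u - v) = snorm (v - u)"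
  using snorm_minus[of "u - v"] by simp

lemma snorm_triangle_diff: "snorm (u - v) \<le> snorm u + snorm v"
  using snorm_triangle[of u "- v"] by (simp add: snorm_minus)

lemma tendsto_form:
  assumes "((\<lambda>r. snorm (x r - u)) \<longlongrightarrow> 0) G" "((\<lambda>r. snorm (y r - v)) \<longlongrightarrow> 0) G"
  shows "((\<lambda>r. B (x r) (y r)) \<longlongrightarrow> B u v) G"
proof (rule LIM_zero_cancel, rule tendsto_zero_dominated)
  show "cmod (B (x r) (y r) - B u v)
      \<le> snorm (x r - u) * snorm (y r - v) + snorm (x r - u) * snorm v + snorm u * snorm (y r - v)" for r
  proof -
    have "B (x r) (y r) - B u v = B (x r - u) (y r - v) + B (x r - u) v + B u (y r - v)"
      by (simp add: simps)
    also have "cmod \<dots> \<le> cmod (B (x r - u) (y r - v)) + cmod (B (x r - u) v) + cmod (B u (y r - v))"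
      by (intro norm_triangle_mono order_refl norm_triangle_ineq)
    also have "\<dots> \<le> snorm (x r - u) * snorm (y r - v) + snorm (x r - u) * snorm v + snorm u * snorm (y r - v)"
      by (intro add_mono cmod_le_snorm)
    finally show ?thesis .
  qed
  show "((\<lambda>r. snorm (x r - u) * snorm (y r - v) + snorm (x r - u) * snorm v + snorm u * snorm (y r - v)) \<longlongrightarrow> 0) G"
    using assms by (auto intro!: tendsto_eq_intros)
qed

end

lemma convergent_by_errors:
  fixes z :: "nat \<Rightarrow> 'b::banach"
  assumes "\<And>r s. norm (z r - z s) \<le> e r + e s" "e \<longlonglongrightarrow> 0"
  shows "convergent z"
proof -
  have "Cauchy z"
  proof (rule metric_CauchyI)
    fix \<epsilon> :: real assume "0 < \<epsilon>"
    then have "\<forall>\<^sub>F r in sequentially. dist (e r) 0 < \<epsilon> / 2"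
      using tendstoD[OF assms(2), of "\<epsilon> / 2"] by simp
    then obtain N where N: "\<And>r. r \<ge> N \<Longrightarrow> dist (e r) 0 < \<epsilon> / 2"
      unfolding eventually_sequentially by blast
    have "dist (z r) (z s) < \<epsilon>" if "r \<ge> N" "s \<ge> N" for r s
      using assms(1)[of r s] N[OF that(1)] N[OF that(2)] by (simp add: dist_norm)
    then show "\<exists>M. \<forall>r\<ge>M. \<forall>s\<ge>M. dist (z r) (z s) < \<epsilon>"
      by blast
  qed
  then show ?thesis
    by (simp add: Cauchy_convergent_iff)
qed

lemma pure_stateD:
  assumes "pure_state f"
  shows "positive_functional f" "f 1 = 1"
    "\<And>g. positive_functional g \<Longrightarrow> positive_functional (\<lambda>a. f a - g a) \<Longrightarrow> \<exists>c. \<forall>a. g a = c * f a"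
  using assms by (auto simp: pure_state_def)

lemma clinear_limit:
  assumes "\<And>r. clinear (g r)" "\<And>a. (\<lambda>r. g r a) \<longlonglongrightarrow> (h a :: complex)"
  shows "clinear h"
  unfolding clinear_def
proof (intro conjI allI)
  fix x y c
  show "h (x + y) = h x + h y"
    by (rule LIMSEQ_unique[OF assms(2)])
      (simp add: clinear_add[OF assms(1)] tendsto_add[OF assms(2) assms(2)])
  show "h (c *\<^sub>C x) = c *\<^sub>C h x"
    by (rule LIMSEQ_unique[OF assms(2)])
      (simp add: clinear_scaleC[OF assms(1)] tendsto_mult_left[OF assms(2)])
qed

lemma nonneg_limit:
  fixes z :: "nat \<Rightarrow> complex"
  assumes "z \<longlonglongrightarrow> l" "\<And>r. 0 \<le> z r"
  shows "0 \<le> l"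
proof -
  have "(\<lambda>r. Re (z r)) \<longlonglongrightarrow> Re l" "(\<lambda>r. Im (z r)) \<longlonglongrightarrow> Im l"
    using assms(1) by (auto intro: tendsto_intros)
  moreover have "0 \<le> Re (z r)" "Im (z r) = 0" for r
    using assms(2)[of r] by (auto simp: complex_nonneg_iff)
  ultimately show ?thesis
    by (simp add: complex_nonneg_iff LIMSEQ_le_const LIMSEQ_const_iff)
qed

lemma positive_functional_snorm_mult:
  assumes "positive_functional f"
  shows "semi_inner.snorm (\<lambda>a b. f (star a * b)) (a * b) \<le> norm a * semi_inner.snorm (\<lambda>a b. f (star a * b)) b"
proof -
  interpret semi_inner "\<lambda>a b. f (star a * b)"
    by (rule positive_functional_semi_inner[OF assms])
  show ?thesis
    by (rule power2_le_imp_le)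
      (use positive_functional_mult_bound[OF assms, of a b] in \<open>simp_all add: power_mult_distrib snorm_power2\<close>)
qed

text \<open>If \<open>u\<^sub>r = 1 - b\<^sub>r c\<close> nearly minimises the distance from \<open>1\<close> to \<open>A c\<close>, then
  \<open>g a = lim f (a u\<^sub>r)\<close> is a functional between \<open>0\<close> and \<open>f\<close> that annihilates \<open>c\<^sup>* c\<close>;
  purity forces \<open>g = 0\<close>, i.e. \<open>1\<close> lies in the closure of \<open>A c\<close>.\<close>

lemma pure_state_dense:
  fixes f :: "'a::cstar_algebra_1 \<Rightarrow> complex"
  assumes f: "pure_state f" and c: "f (star c * c) \<noteq> 0"
  obtains b where "(\<lambda>r. semi_inner.snorm (\<lambda>a b. f (star a * b)) (1 - b r * c)) \<longlonglongrightarrow> 0"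
proof -
  note pf = pure_stateD(1)[OF f] and f1 = pure_stateD(2)[OF f]
  note lin = positive_functional_clinear[OF pf]
  define B where "B a b = f (star a * b)" for a b
  interpret semi_inner B
    unfolding B_def by (rule positive_functional_semi_inner[OF pf])
  have mult: "snorm (a * b) \<le> norm a * snorm b" for a b
    using positive_functional_snorm_mult[OF pf] unfolding B_def[abs_def] .
  define \<delta> where "\<delta> r = inverse (real (Suc r))" for r
  have \<delta>0: "\<delta> \<longlonglongrightarrow> 0"
    unfolding \<delta>_def by (rule LIMSEQ_inverse_real_of_nat)
  have \<delta>: "0 < \<delta> r" "\<delta> r \<le> 1" for r
    by (simp_all add: \<delta>_def divide_simps)
  have "\<exists>b. \<forall>x. Re (B (1 - b * c) (1 - b * c)) - \<delta> r \<le> Re (B (1 - x * c) (1 - x * c))" for r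
    by (rule near_minimizer[of "\<lambda>b. Re (B (1 - b * c) (1 - b * c))" "\<delta> r"]) (auto simp: Re_nonneg \<delta>)
  then obtain b where b: "\<And>r x. Re (B (1 - b r * c) (1 - b r * c)) - \<delta> r \<le> Re (B (1 - x * c) (1 - x * c))"
    by metis
  define u where "u r = 1 - b r * c" for r
  have orth: "cmod (B (x * c) (u r)) \<le> sqrt (\<delta> r) * snorm (x * c)" for x r
  proof (rule power2_le_imp_le)
    have "(cmod (B (x * c) (u r)))\<^sup>2 \<le> \<delta> r * Re (B (x * c) (x * c))"
    proof (rule near_orthogonal)
      fix t
      have "u r + t *\<^sub>C (x * c) = 1 - (b r - t *\<^sub>C x) * c"
        by (simp add: u_def left_diff_distrib scaleC_mult_left)
      then show "Re (B (u r) (u r)) - \<delta> r \<le> Re (B (u r + t *\<^sub>C (x * c)) (u r + t *\<^sub>C (x * c)))"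
        using b[of r "b r - t *\<^sub>C x"] unfolding u_def[of r, symmetric] by (simp only:)
    qed
    then show "(cmod (B (x * c) (u r)))\<^sup>2 \<le> (sqrt (\<delta> r) * snorm (x * c))\<^sup>2"
      using \<delta> by (simp add: power_mult_distrib snorm_power2 less_imp_le)
  qed (use \<delta> in \<open>simp add: less_imp_le\<close>)
  \<comment> \<open>\<open>u r - u s\<close> is a left multiple of \<open>c\<close>, and both
    \<open>u r\<close> and \<open>u s\<close> are nearly orthogonal to all of these. So the sequence
    is Cauchy in the seminorm, although its limit need not exist in \<open>A\<close>.\<close>
  have u_diff: "snorm (u r - u s) \<le> sqrt (\<delta> r) + sqrt (\<delta> s)" for r s
  proof -
    define w where "w = u r - u s"
    have w: "w = (b s - b r) * c"
      by (simp add: w_def u_def algebra_simps)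
    have "snorm w * snorm w = cmod (B w w)"
      by (simp add: self_eq norm_power power2_eq_square flip: of_real_mult)
    also have "B w w = B w (u r) - B w (u s)"
      by (simp add: w_def simps)
    also have "cmod \<dots> \<le> cmod (B w (u r)) + cmod (B w (u s))"
      by (rule norm_triangle_ineq4)
    also have "\<dots> \<le> (sqrt (\<delta> r) + sqrt (\<delta> s)) * snorm w"
      using orth[of "b s - b r" r] orth[of "b s - b r" s] by (simp add: w algebra_simps)
    finally have "snorm w * snorm w \<le> (sqrt (\<delta> r) + sqrt (\<delta> s)) * snorm w" .
    moreover have "0 \<le> sqrt (\<delta> r) + sqrt (\<delta> s)"
      using \<delta>[of r] \<delta>[of s] by simp
    ultimately show ?thesis
      unfolding w_def[symmetric]
      by (cases "snorm w = 0") (auto simp: mult_le_cancel_right order.strict_iff_order)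
  qed
  have \<delta>_sqrt: "(\<lambda>r. C * sqrt (\<delta> r)) \<longlonglongrightarrow> 0" for C
    using tendsto_mult[OF tendsto_const[of C] tendsto_real_sqrt[OF \<delta>0]] by simp
  have "convergent (\<lambda>r. f (a * u r))" for a
  proof (rule convergent_by_errors)
    show "(\<lambda>r. snorm (star a) * sqrt (\<delta> r)) \<longlonglongrightarrow> 0"
      by (rule \<delta>_sqrt)
    fix r s
    have "f (a * u r) - f (a * u s) = B (star a) (u r - u s)"
      by (simp add: B_def star_star right_diff_distrib clinear_diff[OF lin])
    also have "cmod \<dots> \<le> snorm (star a) * (sqrt (\<delta> r) + sqrt (\<delta> s))"
      by (rule order_trans[OF cmod_le_snorm]) (intro mult_left_mono u_diff, simp)
    finally show "norm (f (a * u r) - f (a * u s)) \<le> snorm (star a) * sqrt (\<delta> r) + snorm (star a) * sqrt (\<delta> s)"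
      by (simp add: distrib_left)
  qed
  then obtain g where g: "\<And>a. (\<lambda>r. f (a * u r)) \<longlonglongrightarrow> g a"
    unfolding convergent_def by metis
  have g_lin: "clinear g"
  proof (rule clinear_limit[OF _ g])
    show "clinear (\<lambda>a. f (a * u r))" for r
      using lin by (auto simp: clinear_def distrib_right scaleC_mult_left)
  qed
  have "snorm 1 = 1"
    by (simp add: snorm_def B_def f1)
  have snorm_u: "snorm (u r) \<le> 2" for r
  proof (rule power2_le_imp_le)
    show "(snorm (u r))\<^sup>2 \<le> 2\<^sup>2"
      using b[of r 0] \<delta>[of r] by (simp add: snorm_power2 u_def B_def f1)
  qed simp
  have bc: "snorm (b r * c) \<le> 3" for r
  proof -
    have "b r * c = 1 - u r"
      by (simp add: u_def)
    then show ?thesis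
      using snorm_triangle_diff[of 1 "u r"] snorm_u[of r] \<open>snorm 1 = 1\<close> by simp
  qed
  have small: "(\<lambda>r. B (a * (b r * c)) (u r)) \<longlonglongrightarrow> 0" for a
  proof (rule tendsto_zero_dominated)
    show "cmod (B (a * (b r * c)) (u r)) \<le> (norm a * 3) * sqrt (\<delta> r)" for r
    proof -
      have "cmod (B (a * (b r * c)) (u r)) \<le> sqrt (\<delta> r) * snorm (a * (b r * c))"
        using orth[of "a * b r" r] by (simp add: mult.assoc)
      also have "snorm (a * (b r * c)) \<le> norm a * 3"
        by (rule order_trans[OF mult]) (intro mult_left_mono bc, simp)
      finally show ?thesis
        using \<delta>[of r] by (simp add: mult_left_mono mult.commute)
    qed
    show "(\<lambda>r. (norm a * 3) * sqrt (\<delta> r)) \<longlonglongrightarrow> 0"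
      by (rule \<delta>_sqrt)
  qed
  \<comment> \<open>Splitting 1 like this turns \<open>f (star a * a * u r)\<close> into the square
    of \<open>a * u r\<close> plus a term that vanishes in the limit by \<open>small\<close>; the
    complementary part gives the square of \<open>a * (b r * c)\<close>. Hence \<open>g\<close> and
    \<open>f - g\<close> are limits of non-negative numbers at each
    \<open>star a * a\<close>.\<close>
  have one: "1 = u r + b r * c" for r
    by (simp add: u_def)
  have lim1: "(\<lambda>r. B (a * u r) (a * u r)) \<longlonglongrightarrow> g (star a * a)" for a
  proof -
    have "f (star a * a * u r) - B (star a * a * (b r * c)) (u r) = B (a * u r) (a * u r)" for r
    proof -
      have "f (star a * a * u r) = B 1 (star a * a * u r)"
        by (simp add: B_def)
      also have "\<dots> = B (u r) (star a * a * u r) + B (b r * c) (star a * a * u r)"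
        by (subst one[of r]) (rule add_left)
      finally show ?thesis
        by (simp add: B_def star_mult star_star mult.assoc)
    qed
    moreover have "(\<lambda>r. f (star a * a * u r) - B (star a * a * (b r * c)) (u r)) \<longlonglongrightarrow> g (star a * a) - 0"
      by (intro tendsto_diff g small)
    ultimately show ?thesis
      by simp
  qed
  have lim2: "(\<lambda>r. B (a * (b r * c)) (a * (b r * c))) \<longlonglongrightarrow> f (star a * a) - g (star a * a)" for a
  proof -
    have "f (star a * a) - f (star a * a * u r) - cnj (B (star a * a * (b r * c)) (u r))
        = B (a * (b r * c)) (a * (b r * c))" for r
    proof -
      have "f (star a * a) - f (star a * a * u r) = f (star a * a * (b r * c))"
        by (simp add: u_def algebra_simps clinear_diff[OF lin])
      also have "\<dots> = B 1 (star a * a * (b r * c))"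
        by (simp add: B_def)
      also have "\<dots> = B (u r) (star a * a * (b r * c)) + B (b r * c) (star a * a * (b r * c))"
        by (subst one[of r]) (rule add_left)
      also have "B (u r) (star a * a * (b r * c)) = cnj (B (star a * a * (b r * c)) (u r))"
        by (rule commute)
      finally show ?thesis
        by (simp add: B_def star_mult star_star mult.assoc)
    qed
    moreover have "(\<lambda>r. f (star a * a) - f (star a * a * u r) - cnj (B (star a * a * (b r * c)) (u r)))
        \<longlonglongrightarrow> f (star a * a) - g (star a * a) - cnj 0"
      by (intro tendsto_intros g small)
    ultimately show ?thesis
      by simp
  qed
  have "positive_functional g"
    unfolding positive_functional_def using g_lin nonneg_limit[OF lim1 nonneg] by blast
  moreover have "positive_functional (\<lambda>a. f a - g a)"
    unfolding positive_functional_def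
    using lin g_lin nonneg_limit[OF lim2 nonneg] by (auto simp: clinear_def algebra_simps)
  ultimately obtain s where s: "\<And>a. g a = s * f a"
    using pure_stateD(3)[OF f] by blast
  have "(\<lambda>r. f (star c * c * u r)) \<longlonglongrightarrow> 0"
  proof (rule tendsto_zero_dominated)
    show "cmod (f (star c * c * u r)) \<le> snorm (star c * c) * sqrt (\<delta> r)" for r
      using orth[of "star c" r] by (simp add: B_def star_mult star_star mult.commute)
  qed (rule \<delta>_sqrt)
  then have "g (star c * c) = 0"
    using g LIMSEQ_unique by blast
  then have "s = 0"
    using s c by simp
  then have "(\<lambda>r. B (u r) (u r)) \<longlonglongrightarrow> 0"
    using lim1[of 1] by (simp add: s)
  then have "(\<lambda>r. sqrt (Re (B (u r) (u r)))) \<longlonglongrightarrow> sqrt (Re 0)"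
    by (intro tendsto_intros)
  then have "(\<lambda>r. snorm (u r)) \<longlonglongrightarrow> 0"
    by (simp add: snorm_def)
  then show ?thesis
    by (intro that[of b]) (simp add: u_def B_def[abs_def])
qed

lemma positive_functional_compress:
  assumes "positive_functional f"
  shows "positive_functional (\<lambda>a. f (star c * a * c))"
  unfolding positive_functional_def
proof (intro conjI allI)
  show "clinear (\<lambda>a. f (star c * a * c))"
    using positive_functional_clinear[OF assms]
    by (auto simp: clinear_def distrib_left distrib_right scaleC_mult_left scaleC_mult_right)
  fix a
  have "0 \<le> f (star (a * c) * (a * c))"
    using assms unfolding positive_functional_def by blast
  then show "0 \<le> f (star c * (star a * a) * c)"
    by (simp add: star_mult mult.assoc)
qed

lemma positive_functional_dominated:
  assumes g: "positive_functional g" and fg: "positive_functional (\<lambda>a. f a - g a)"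
  shows "semi_inner.snorm (\<lambda>a b. g (star a * b)) a \<le> sqrt (Re (f (star a * a)))"
proof -
  interpret semi_inner "\<lambda>a b. g (star a * b)"
    by (rule positive_functional_semi_inner[OF g])
  have "0 \<le> f (star a * a) - g (star a * a)"
    using fg unfolding positive_functional_def by blast
  then show ?thesis
    by (simp add: snorm_def complex_nonneg_iff)
qed

text \<open>Vector states of an irreducible representation are pure. As \<open>b r * c\<close> tends
  to 1, a functional \<open>g\<close> below the compressed state can be moved back to the limit
  \<open>h a\<close> of \<open>g (star (b r) * a * b r)\<close>. This \<open>h\<close> lies below
  \<open>f\<close>, so it is a multiple of \<open>f\<close>, and compressing it by \<open>c\<close>
  returns \<open>g\<close>.\<close>

lemma pure_state_compress:
  fixes f :: "'a::cstar_algebra_1 \<Rightarrow> complex"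
  assumes f: "pure_state f" and c: "f (star c * c) = 1"
  shows "pure_state (\<lambda>a. f (star c * a * c))"
  unfolding pure_state_def
proof (intro conjI allI impI)
  note pf = pure_stateD(1)[OF f]
  show "positive_functional (\<lambda>a. f (star c * a * c))"
    by (rule positive_functional_compress[OF pf])
  show "f (star c * 1 * c) = 1"
    using c by simp
  fix g assume g: "positive_functional g"
    and fg: "positive_functional (\<lambda>a. f (star c * a * c) - g a)"
  obtain b where "(\<lambda>r. semi_inner.snorm (\<lambda>a b. f (star a * b)) (1 - b r * c)) \<longlonglongrightarrow> 0"
    using pure_state_dense[OF f] c by (metis one_neq_zero)
  define B where "B a b = f (star a * b)" for a b
  define G where "G a b = g (star a * b)" for a b
  interpret B: semi_inner B
    unfolding B_def by (rule positive_functional_semi_inner[OF pf])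
  interpret G: semi_inner G
    unfolding G_def by (rule positive_functional_semi_inner[OF g])
  have B_mult: "B.snorm (a * b) \<le> norm a * B.snorm b" for a b
    using positive_functional_snorm_mult[OF pf] unfolding B_def[abs_def] .
  have G_mult: "G.snorm (a * b) \<le> norm a * G.snorm b" for a b
    using positive_functional_snorm_mult[OF g] unfolding G_def[abs_def] .
  have GB: "G.snorm a \<le> B.snorm (a * c)" for a
    using positive_functional_dominated[OF g fg, of a]
    by (simp add: G_def[abs_def] B.snorm_def) (simp add: B_def star_mult mult.assoc)
  define e where "e r = B.snorm (1 - b r * c)" for r
  have e: "e \<longlonglongrightarrow> 0"
    using \<open>(\<lambda>r. semi_inner.snorm _ _) \<longlonglongrightarrow> 0\<close> by (simp add: e_def[abs_def] B_def[abs_def])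
  have e': "B.snorm (b r * c - 1) = e r" for r
    unfolding e_def by (rule B.snorm_minus_commute)
  have e0: "0 \<le> e r" for r
    by (simp add: e_def)
  have Ce: "(\<lambda>r. C * e r) \<longlonglongrightarrow> 0" for C
    using tendsto_mult[OF tendsto_const[of C] e] by simp
  obtain E where E: "\<And>r. e r \<le> E" and E0: "0 \<le> E"
  proof -
    obtain E where "\<forall>r. norm (e r) \<le> E"
      using convergent_imp_Bseq[of e] e unfolding convergent_def Bseq_def by blast
    then show ?thesis
      by (intro that[of E]) (auto intro: order_trans[OF abs_ge_self] order_trans[OF norm_ge_zero, of "e 0"])
  qed
  have G_b: "G.snorm (b r) \<le> 1 + E" for r
  proof -
    have "B.snorm 1 = 1"
      by (simp add: B.snorm_def B_def pure_stateD(2)[OF f])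
    then have "B.snorm (b r * c) \<le> e r + 1"
      using B.snorm_triangle[of "b r * c - 1" 1] e'[of r] by simp
    with GB[of "b r"] E[of r] show ?thesis
      by simp
  qed
  have G_bb: "G.snorm (b r - b s) \<le> e r + e s" for r s
  proof -
    have "(b r - b s) * c = (b r * c - 1) - (b s * c - 1)"
      by (simp add: algebra_simps)
    then have "B.snorm ((b r - b s) * c) \<le> e r + e s"
      using B.snorm_triangle_diff[of "b r * c - 1" "b s * c - 1"] e' by simp
    then show ?thesis
      using GB order_trans by blast
  qed
  have "convergent (\<lambda>r. G (b r) (a * b r))" for a
  proof (rule convergent_by_errors)
    define C where "C = 2 * (norm a * (1 + E))"
    show "(\<lambda>r. C * e r) \<longlonglongrightarrow> 0"
      by (rule Ce)
    fix r s
    have "G (b r) (a * b r) - G (b s) (a * b s) = G (b r - b s) (a * b r) + G (b s) (a * (b r - b s))"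
      by (simp add: G.simps right_diff_distrib)
    also have "cmod \<dots> \<le> G.snorm (b r - b s) * G.snorm (a * b r) + G.snorm (b s) * G.snorm (a * (b r - b s))"
      by (rule order_trans[OF norm_triangle_ineq]) (intro add_mono G.cmod_le_snorm)
    also have "\<dots> \<le> (e r + e s) * (norm a * (1 + E)) + (1 + E) * (norm a * (e r + e s))"
      using E0
      by (intro add_mono mult_mono G_bb G_b order_trans[OF G_mult] mult_left_mono)
        (auto simp: e0 mult_nonneg_nonneg add_nonneg_nonneg)
    also have "\<dots> = C * e r + C * e s"
      by (simp add: C_def algebra_simps)
    finally show "norm (G (b r) (a * b r) - G (b s) (a * b s)) \<le> C * e r + C * e s" .
  qed
  then obtain h where h: "\<And>a. (\<lambda>r. G (b r) (a * b r)) \<longlonglongrightarrow> h a"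
    unfolding convergent_def by metis
  have h_lin: "clinear h"
  proof (rule clinear_limit[OF _ h])
    show "clinear (\<lambda>a. G (b r) (a * b r))" for r
      by (simp add: clinear_def distrib_right scaleC_mult_left G.simps)
  qed
  have G_nn: "0 \<le> G (b r) (star a * a * b r)" for a r
    using G.nonneg[of "a * b r"] by (simp add: G_def star_mult mult.assoc)
  have "positive_functional h"
    unfolding positive_functional_def using h_lin nonneg_limit[OF h G_nn] by blast
  moreover have "positive_functional (\<lambda>a. f a - h a)"
    unfolding positive_functional_def
  proof (intro conjI allI)
    show "clinear (\<lambda>a. f a - h a)"
      using positive_functional_clinear[OF pf] h_lin by (auto simp: clinear_def algebra_simps)
    fix a
    have "(\<lambda>r. B.snorm (a * (b r * c) - a)) \<longlonglongrightarrow> 0"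
    proof (rule tendsto_zero_dominated)
      show "norm (B.snorm (a * (b r * c) - a)) \<le> norm a * e r" for r
        using B_mult[of a "b r * c - 1"] e'[of r] by (simp add: algebra_simps)
    qed (rule Ce)
    then have "(\<lambda>r. B (a * (b r * c)) (a * (b r * c))) \<longlonglongrightarrow> B a a"
      by (intro B.tendsto_form)
    then have "(\<lambda>r. B (a * (b r * c)) (a * (b r * c)) - G (b r) (star a * a * b r)) \<longlonglongrightarrow> B a a - h (star a * a)"
      by (intro tendsto_diff h)
    moreover have "0 \<le> B (a * (b r * c)) (a * (b r * c)) - G (b r) (star a * a * b r)" for r
    proof -
      have "0 \<le> f (star c * (star (a * b r) * (a * b r)) * c) - g (star (a * b r) * (a * b r))"
        using fg unfolding positive_functional_def by blast
      then show ?thesis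
        by (simp add: B_def G_def star_mult mult.assoc)
    qed
    ultimately have "0 \<le> B a a - h (star a * a)"
      by (rule nonneg_limit)
    then show "0 \<le> f (star a * a) - h (star a * a)"
      by (simp add: B_def)
  qed
  ultimately obtain s where s: "\<And>a. h a = s * f a"
    using pure_stateD(3)[OF f] by blast
  have "g a = s * f (star c * a * c)" for a
  proof -
    \<comment> \<open>The seminorm of \<open>g\<close> at \<open>x\<close> is at most that of
      \<open>f\<close> at \<open>x * c\<close>. Since
      \<open>(c * b r - 1) * c = c * (b r * c - 1)\<close>, the approximate left inverse of
      \<open>c\<close> for \<open>f\<close> is an approximate right inverse for
      \<open>g\<close>.\<close>
    have cb: "(\<lambda>r. G.snorm (c * b r - 1)) \<longlonglongrightarrow> 0"
    proof (rule tendsto_zero_dominated)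
      show "norm (G.snorm (c * b r - 1)) \<le> norm c * e r" for r
      proof -
        have "(c * b r - 1) * c = c * (b r * c - 1)"
          by (simp add: algebra_simps)
        then show ?thesis
          using GB[of "c * b r - 1"] B_mult[of c "b r * c - 1"] e'[of r] by simp
      qed
    qed (rule Ce)
    have "(\<lambda>r. G.snorm (a * (c * b r) - a)) \<longlonglongrightarrow> 0"
    proof (rule tendsto_zero_dominated)
      show "norm (G.snorm (a * (c * b r) - a)) \<le> norm a * G.snorm (c * b r - 1)" for r
        using G_mult[of a "c * b r - 1"] by (simp add: algebra_simps)
      show "(\<lambda>r. norm a * G.snorm (c * b r - 1)) \<longlonglongrightarrow> 0"
        using tendsto_mult[OF tendsto_const[of "norm a"] cb] by simp
    qed
    with cb have "(\<lambda>r. G (c * b r) (a * (c * b r))) \<longlonglongrightarrow> G 1 a"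
      by (rule G.tendsto_form)
    moreover have "(\<lambda>r. G (c * b r) (a * (c * b r))) = (\<lambda>r. G (b r) ((star c * a * c) * b r))"
      by (rule ext) (simp add: G_def star_mult mult.assoc)
    ultimately have "(\<lambda>r. G (b r) ((star c * a * c) * b r)) \<longlonglongrightarrow> G 1 a"
      by simp
    then have "G 1 a = h (star c * a * c)"
      using h by (rule LIMSEQ_unique)
    then show ?thesis
      by (simp add: s G_def)
  qed
  then show "\<exists>s. \<forall>a. g a = s * f (star c * a * c)"
    by blast
qed

section \<open>A family of C*-extreme points\<close>

lemma form_positive_kernel:
  assumes lin: "clinear \<Theta>" and pos: "form_positive \<Theta>"
  shows "positive_kernel n (\<lambda>j k a. cinner (x j) (bop_apply (\<Theta> a) (x k)))"
  unfolding positive_kernel_def kernel_form_def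
proof (intro conjI allI impI)
  fix j k
  show "clinear (\<lambda>a. cinner (x j) (bop_apply (\<Theta> a) (x k)))"
    using lin by (simp add: clinear_def bop_simps cinner_simps)
qed (rule pos[unfolded form_positive_def, rule_format])

lemma form_positive_star:
  assumes lin: "clinear \<Theta>" and pos: "form_positive \<Theta>"
  shows "cinner p (bop_apply (\<Theta> (star a)) q) = cnj (cinner q (bop_apply (\<Theta> a) p))"
proof -
  define x where "x i = (if i = (0::nat) then p else q)" for i
  note ker = form_positive_kernel[OF lin pos, of 2 x]
  interpret semi_inner "kernel_form 2 (\<lambda>j k a. cinner (x j) (bop_apply (\<Theta> a) (x k)))"
    by (rule kernel_form_semi_inner[OF ker])
  have "cinner (x 0) (bop_apply (\<Theta> (star a)) (x 1)) = cnj (cinner (x 1) (bop_apply (\<Theta> a) (x 0)))"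
    using commute[of "slot 0 a" "slot 1 1"]
    by (simp add: kernel_form_slot[OF ker] del: One_nat_def)
  then show ?thesis
    by (simp add: x_def)
qed

definition defect :: "('a::cstar_algebra_1 \<Rightarrow> 'h::chilbert_space bop) \<Rightarrow> 'h \<Rightarrow> 'h \<Rightarrow> 'a \<Rightarrow> complex" where
  "defect \<Theta> p q b = cinner p (bop_apply (\<Theta> 1) p) - cinner p (bop_apply (\<Theta> b) q)
     - cinner q (bop_apply (\<Theta> (star b)) p) + cinner q (bop_apply (\<Theta> (star b * b)) q)"

text \<open>\<open>defect \<Theta> p q b\<close> is the squared length of \<open>1 \<otimes> p - b \<otimes> q\<close> in the Stinespring space of \<open>\<Theta>\<close>.\<close>

lemma defect_facts:
  assumes lin: "clinear \<Theta>" and pos: "form_positive \<Theta>"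
  shows defect_nonneg: "0 \<le> defect \<Theta> p q b"
    and defect_cauchy: "(cmod (cinner p (bop_apply (\<Theta> a) z) - cinner q (bop_apply (\<Theta> (star b * a)) z)))\<^sup>2
      \<le> Re (defect \<Theta> p q b) * Re (cinner z (bop_apply (\<Theta> (star a * a)) z))"
proof -
  \<comment> \<open>Slots 0, 1 and 2 carry the vectors \<open>1 \<otimes> p\<close>,
    \<open>b \<otimes> q\<close> and \<open>a \<otimes> z\<close>.\<close>
  define x where "x i = (if i = (0::nat) then p else if i = 1 then q else z)" for i
  note ker = form_positive_kernel[OF lin pos, of 3 x]
  interpret semi_inner "kernel_form 3 (\<lambda>j k a. cinner (x j) (bop_apply (\<Theta> a) (x k)))"
    by (rule kernel_form_semi_inner[OF ker])
  note slot = kernel_form_slot[OF ker]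
  have uu: "kernel_form 3 (\<lambda>j k a. cinner (x j) (bop_apply (\<Theta> a) (x k)))
      (slot 0 1 - slot 1 b) (slot 0 1 - slot 1 b) = defect \<Theta> p q b"
    by (simp add: simps slot defect_def) (simp add: x_def)
  show "0 \<le> defect \<Theta> p q b"
    using nonneg[of "slot 0 1 - slot 1 b"] by (simp only: uu)
  have uv: "kernel_form 3 (\<lambda>j k a. cinner (x j) (bop_apply (\<Theta> a) (x k)))
      (slot 0 1 - slot 1 b) (slot 2 a) = cinner p (bop_apply (\<Theta> a) z) - cinner q (bop_apply (\<Theta> (star b * a)) z)"
    by (simp add: simps slot) (simp add: x_def)
  have vv: "kernel_form 3 (\<lambda>j k a. cinner (x j) (bop_apply (\<Theta> a) (x k))) (slot 2 a) (slot 2 a)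
      = cinner z (bop_apply (\<Theta> (star a * a)) z)"
    by (simp add: slot) (simp add: x_def)
  show "(cmod (cinner p (bop_apply (\<Theta> a) z) - cinner q (bop_apply (\<Theta> (star b * a)) z)))\<^sup>2
      \<le> Re (defect \<Theta> p q b) * Re (cinner z (bop_apply (\<Theta> (star a * a)) z))"
    using cauchy_schwarz[of "slot 0 1 - slot 1 b" "slot 2 a"] unfolding uu uv vv by (simp only: mult.commute)
qed

text \<open>The tensor product of a positive functional with a positive semidefinite scalar matrix:
  Gram-Schmidt factors the Gram matrix of the \<open>x r\<close>, and the double sum becomes a sum
  of values of \<open>F\<close> at squares.\<close>

lemma form_positive_scalar:
  fixes F :: "'a::cstar_algebra_1 \<Rightarrow> complex"
  assumes F: "positive_functional F"
  shows "form_positive (\<lambda>a. F a *\<^sub>C (1 :: 'h::chilbert_space bop))"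
  unfolding form_positive_def
proof (intro allI)
  fix n :: nat and a :: "nat \<Rightarrow> 'a" and x :: "nat \<Rightarrow> 'h"
  interpret semi_inner "\<lambda>a b. F (star a * b)"
    by (rule positive_functional_semi_inner[OF F])
  obtain k o' t where k: "\<And>i j. i < k \<Longrightarrow> j < k \<Longrightarrow> cinner (o' i) (o' j) = (if i = j then 1 else 0)"
    and t: "\<And>j w. j < n \<Longrightarrow> cinner w (x j) = (\<Sum>i<(k::nat). t i j * cinner w (o' i))"
    by (rule hilbert.gram_schmidt[of n x]) blast
  have ox: "cinner (o' i) (x j) = t i j" if "i < k" "j < n" for i j
  proof -
    have "cinner (o' i) (x j) = (\<Sum>m<k. if m = i then t m j else 0)"
      unfolding t[OF that(2)] using that(1) by (intro sum.cong) (auto simp: k)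
    then show ?thesis
      using that by simp
  qed
  have xx: "cinner (x r) (x s) = (\<Sum>i<k. cnj (t i r) * t i s)" if "r < n" "s < n" for r s
    unfolding t[OF that(2)]
  proof (rule sum.cong)
    fix i assume "i \<in> {..<k}"
    then show "t i s * cinner (x r) (o' i) = cnj (t i r) * t i s"
      using ox[of i r] that cinner_commute[of "x r" "o' i"] by simp
  qed simp
  have "(\<Sum>r<n. \<Sum>s<n. cinner (x r) (bop_apply (F (star (a r) * a s) *\<^sub>C 1) (x s)))
      = (\<Sum>r<n. \<Sum>s<n. \<Sum>i<k. F (star (t i r *\<^sub>C a r) * (t i s *\<^sub>C a s)))"
    by (intro sum.cong) (auto simp: bop_simps cinner_simps xx sum_distrib_left simps mult_ac)
  also have "\<dots> = (\<Sum>r<n. \<Sum>i<k. \<Sum>s<n. F (star (t i r *\<^sub>C a r) * (t i s *\<^sub>C a s)))"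
    by (intro sum.cong sum.swap refl)
  also have "\<dots> = (\<Sum>i<k. \<Sum>r<n. \<Sum>s<n. F (star (t i r *\<^sub>C a r) * (t i s *\<^sub>C a s)))"
    by (rule sum.swap)
  also have "\<dots> = (\<Sum>i<k. F (star (\<Sum>r<n. t i r *\<^sub>C a r) * (\<Sum>s<n. t i s *\<^sub>C a s)))"
    unfolding left.sum by (simp only: right.sum)
  also have "0 \<le> \<dots>"
    by (intro sum_nonneg nonneg)
  finally show "0 \<le> (\<Sum>r<n. \<Sum>s<n. cinner (x r) (bop_apply (F (star (a r) * a s) *\<^sub>C 1) (x s)))" .
qed

text \<open>In Stinespring form the map below is compression of \<open>\<pi>\<^sub>f \<otimes> 1\<close> to the span of the vectors
  \<open>d\<^sub>i \<otimes> e\<^sub>0\<close> and \<open>d\<^sub>0 \<otimes> y\<close> with \<open>y\<close> orthogonal to all \<open>e\<^sub>i\<close>; here \<open>\<pi>\<^sub>f\<close> is the irreducible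
  GNS representation of the pure state \<open>f\<close>.\<close>

locale pure_dilation =
  fixes f :: "'a::cstar_algebra_1 \<Rightarrow> complex" and d :: "nat \<Rightarrow> 'a"
    and e :: "nat \<Rightarrow> 'h::chilbert_space" and k :: nat
  assumes pure: "pure_state f" and k: "0 < k"
    and d: "\<And>i j. i < k \<Longrightarrow> j < k \<Longrightarrow> f (star (d i) * d j) = (if i = j then 1 else 0)"
    and e: "\<And>i j. i < k \<Longrightarrow> j < k \<Longrightarrow> cinner (e i) (e j) = (if i = j then 1 else 0)"
begin

definition F :: "'a \<Rightarrow> complex" where
  "F a = f (star (d 0) * a * d 0)"

definition Proj :: "'h bop" where
  "Proj = (\<Sum>i<k. rank_one (e i) (e i))"

definition \<phi> :: "'a \<Rightarrow> 'h bop" where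
  "\<phi> a = (\<Sum>i<k. \<Sum>j<k. f (star (d i) * a * d j) *\<^sub>C rank_one (e i) (e j)) + F a *\<^sub>C (1 - Proj)"

sublocale f: semi_inner "\<lambda>a b. f (star a * b)"
  by (rule positive_functional_semi_inner[OF pure_stateD(1)[OF pure]])

lemma pure_F: "pure_state F"
  unfolding F_def by (rule pure_state_compress[OF pure]) (simp add: d k)

lemma f_lin: "clinear f"
  by (rule positive_functional_clinear[OF pure_stateD(1)[OF pure]])

lemma F_lin: "clinear F"
  by (rule positive_functional_clinear[OF pure_stateD(1)[OF pure_F]])

lemma Proj_apply: "bop_apply Proj q = (\<Sum>i<k. cinner (e i) q *\<^sub>C e i)"
  by (simp add: Proj_def bop_left.sum)

lemma cinner_\<phi>: "cinner p (bop_apply (\<phi> a) q)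
  = (\<Sum>i<k. \<Sum>j<k. f (star (d i) * a * d j) * (cinner p (e i) * cinner (e j) q))
    + F a * (cinner p q - (\<Sum>i<k. cinner (e i) q * cinner p (e i)))"
  by (simp add: \<phi>_def bop_left.sum bop_simps cinner_simps cinner_right.sum Proj_apply mult_ac)

lemma \<phi>_lin: "clinear \<phi>"
  unfolding clinear_def
proof (intro conjI allI)
  fix x y c
  have "f (star (d i) * (x + y) * d j) = f (star (d i) * x * d j) + f (star (d i) * y * d j)" for i j
    by (simp add: distrib_left distrib_right clinear_add[OF f_lin])
  then show "\<phi> (x + y) = \<phi> x + \<phi> y"
    by (simp add: \<phi>_def scaleC_add_left sum.distrib clinear_add[OF F_lin])
  have "f (star (d i) * (c *\<^sub>C x) * d j) = c * f (star (d i) * x * d j)" for i j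
    by (simp add: scaleC_mult_left scaleC_mult_right clinear_scaleC[OF f_lin])
  then show "\<phi> (c *\<^sub>C x) = c *\<^sub>C \<phi> x"
    by (simp add: \<phi>_def scaleC_scaleC scaleC_add_right scaleC_right.sum clinear_scaleC[OF F_lin])
qed

lemma \<phi>_one: "\<phi> 1 = 1"
proof -
  have "(\<Sum>i<k. \<Sum>j<k. f (star (d i) * 1 * d j) *\<^sub>C rank_one (e i) (e j))
      = (\<Sum>i<k. \<Sum>j<k. if j = i then rank_one (e i) (e i) else 0)"
    by (intro sum.cong) (auto simp: d scaleC_one scaleC_left.zero)
  also have "\<dots> = Proj"
    by (simp add: Proj_def)
  finally show ?thesis
    by (simp add: \<phi>_def pure_stateD(2)[OF pure_F] scaleC_one)
qed

lemma e_Proj: "l < k \<Longrightarrow> (\<Sum>i<k. cinner (e i) q * cinner (e l) (e i)) = cinner (e l) q"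
proof -
  assume "l < k"
  have "(\<Sum>i<k. cinner (e i) q * cinner (e l) (e i)) = (\<Sum>i<k. if i = l then cinner (e l) q else 0)"
    using \<open>l < k\<close> by (intro sum.cong) (auto simp: e)
  then show ?thesis
    using \<open>l < k\<close> by simp
qed

lemma star_Proj: "star Proj = Proj"
  by (simp add: Proj_def star.sum star_rank_one)

lemma Proj_e: "l < k \<Longrightarrow> bop_apply Proj (e l) = e l"
proof -
  assume "l < k"
  have "bop_apply Proj (e l) = (\<Sum>i<k. if i = l then e l else 0)"
    unfolding Proj_apply using \<open>l < k\<close> by (intro sum.cong) (auto simp: e scaleC_one scaleC_left.zero)
  then show ?thesis
    using \<open>l < k\<close> by simp
qed

lemma Proj_idem: "Proj * Proj = Proj"
proof (rule bop_eqI)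
  fix x
  have "bop_apply Proj (bop_apply Proj x) = (\<Sum>i<k. cinner (e i) x *\<^sub>C bop_apply Proj (e i))"
    by (subst (2) Proj_apply) (simp add: bop_right.sum bop_simps)
  also have "\<dots> = bop_apply Proj x"
    unfolding Proj_apply[of x] by (intro sum.cong) (simp_all add: Proj_e)
  finally show "bop_apply (Proj * Proj) x = bop_apply Proj x"
    by (simp add: bop_simps)
qed

lemma \<phi>_form_positive: "form_positive \<phi>"
proof -
  have 1: "form_positive (\<lambda>a. \<Sum>i<k. \<Sum>j<k. f (star (d i) * a * d j) *\<^sub>C rank_one (e i) (e j))"
    unfolding form_positive_def
  proof (intro allI)
    fix n :: nat and a :: "nat \<Rightarrow> 'a" and x :: "nat \<Rightarrow> 'h"
    define w where "w r = (\<Sum>i<k. cinner (e i) (x r) *\<^sub>C (a r * d i))" for r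
    have "cinner (x r) (bop_apply (\<Sum>i<k. \<Sum>j<k. f (star (d i) * (star (a r) * a s) * d j) *\<^sub>C rank_one (e i) (e j)) (x s))
        = f (star (w r) * w s)" for r s
    proof -
      have "cnj (cinner (e i) (x r)) = cinner (x r) (e i)" for i
        using cinner_commute[of "x r" "e i"] by simp
      then have "f (star (w r) * w s)
          = (\<Sum>i<k. \<Sum>j<k. cinner (e j) (x s) * (cinner (x r) (e i) * f (star (a r * d i) * (a s * d j))))"
        unfolding w_def f.left.sum by (simp only: f.right.sum f.scaleC_left f.scaleC_right)
      also have "\<dots> = (\<Sum>i<k. \<Sum>j<k. f (star (d i) * (star (a r) * a s) * d j) * (cinner (x r) (e i) * cinner (e j) (x s)))"
        by (intro sum.cong) (simp_all add: star_mult mult.assoc)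
      finally show ?thesis
        by (simp add: bop_left.sum bop_simps cinner_simps cinner_right.sum mult_ac)
    qed
    then have "(\<Sum>r<n. \<Sum>s<n. cinner (x r) (bop_apply (\<Sum>i<k. \<Sum>j<k. f (star (d i) * (star (a r) * a s) * d j) *\<^sub>C rank_one (e i) (e j)) (x s)))
        = (\<Sum>r<n. \<Sum>s<n. f (star (w r) * w s))"
      by simp
    also have "\<dots> = f (star (\<Sum>r<n. w r) * (\<Sum>s<n. w s))"
      unfolding f.left.sum by (simp only: f.right.sum)
    also have "0 \<le> \<dots>"
      by (rule f.nonneg)
    finally show "0 \<le> (\<Sum>r<n. \<Sum>s<n. cinner (x r) (bop_apply (\<Sum>i<k. \<Sum>j<k. f (star (d i) * (star (a r) * a s) * d j) *\<^sub>C rank_one (e i) (e j)) (x s)))" .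
  qed
  have C: "star (1 - Proj) * (1 - Proj) = 1 - Proj"
    by (simp add: star.diff star_Proj algebra_simps Proj_idem)
  have "star (1 - Proj) * (F a *\<^sub>C 1) * (1 - Proj) = F a *\<^sub>C (1 - Proj)" for a
    by (simp add: scaleC_mult_left scaleC_mult_right C)
  then have 2: "form_positive (\<lambda>a. F a *\<^sub>C (1 - Proj))"
    using form_positive_conj[OF form_positive_scalar[OF pure_stateD(1)[OF pure_F]], of "1 - Proj"] by simp
  show ?thesis
    unfolding \<phi>_def by (rule form_positive_add[OF 1 2])
qed

lemma \<phi>_ucp: "\<phi> \<in> ucp_maps"
  by (simp add: ucp_maps_def completely_positiveI \<phi>_lin \<phi>_form_positive \<phi>_one)

lemma \<phi>_e_left:
  assumes "l < k"
  shows "cinner (e l) (bop_apply (\<phi> a) q) = (\<Sum>j<k. f (star (d l) * a * d j) * cinner (e j) q)"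
proof -
  have "(\<Sum>i<k. \<Sum>j<k. f (star (d i) * a * d j) * (cinner (e l) (e i) * cinner (e j) q))
      = (\<Sum>i<k. if i = l then (\<Sum>j<k. f (star (d l) * a * d j) * cinner (e j) q) else 0)"
    using assms by (intro sum.cong) (auto simp: e)
  then show ?thesis
    using assms by (simp add: cinner_\<phi> e_Proj)
qed

text \<open>The multiplicity space of the dilation. Index 0 is left out of the conditions so that
  \<open>e 0\<close> belongs to it; between vectors of \<open>N\<close> the map acts as
  \<open>F\<close> times the identity.\<close>

definition N :: "'h set" where
  "N = {y. \<forall>j. 0 < j \<and> j < k \<longrightarrow> cinner (e j) y = 0}"

lemma N_D: "y \<in> N \<Longrightarrow> 0 < j \<Longrightarrow> j < k \<Longrightarrow> cinner (e j) y = 0"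
  by (simp add: N_def)

lemma N_D': "y \<in> N \<Longrightarrow> 0 < j \<Longrightarrow> j < k \<Longrightarrow> cinner y (e j) = 0"
  using N_D[of y j] cinner_commute[of y "e j"] by simp

lemma e0_N: "e 0 \<in> N"
  using k by (auto simp: N_def e)

lemma sum_only_zero:
  assumes "\<And>j. 0 < j \<Longrightarrow> j < k \<Longrightarrow> g j = 0"
  shows "(\<Sum>j<k. g j) = (g 0 :: complex)"
proof -
  have "(\<Sum>j<k. g j) = (\<Sum>j<k. if j = 0 then g 0 else 0)"
    by (intro sum.cong) (use assms in auto)
  then show ?thesis
    using k by simp
qed

lemma \<phi>_e_N:
  assumes "l < k" "y \<in> N"
  shows "cinner (e l) (bop_apply (\<phi> a) y) = f (star (d l) * a * d 0) * cinner (e 0) y"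
  unfolding \<phi>_e_left[OF assms(1)] by (rule sum_only_zero) (simp add: N_D assms)

lemma \<phi>_N_N:
  assumes "y \<in> N" "y' \<in> N"
  shows "cinner y (bop_apply (\<phi> a) y') = F a * cinner y y'"
proof -
  have "(\<Sum>i<k. \<Sum>j<k. f (star (d i) * a * d j) * (cinner y (e i) * cinner (e j) y'))
      = (\<Sum>j<k. f (star (d 0) * a * d j) * (cinner y (e 0) * cinner (e j) y'))"
    by (rule sum_only_zero) (simp add: N_D' assms)
  also have "\<dots> = F a * (cinner y (e 0) * cinner (e 0) y')"
    unfolding F_def by (rule sum_only_zero) (simp add: N_D assms)
  finally have double: "(\<Sum>i<k. \<Sum>j<k. f (star (d i) * a * d j) * (cinner y (e i) * cinner (e j) y'))
      = F a * (cinner y (e 0) * cinner (e 0) y')" .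
  have "(\<Sum>i<k. cinner (e i) y' * cinner y (e i)) = cinner (e 0) y' * cinner y (e 0)"
    by (rule sum_only_zero) (simp add: N_D assms)
  then show ?thesis
    unfolding cinner_\<phi> double by (simp add: algebra_simps)
qed

lemma \<phi>_e_e:
  assumes "i < k" "j < k"
  shows "cinner (e i) (bop_apply (\<phi> a) (e j)) = f (star (d i) * a * d j)"
proof -
  have "cinner (e i) (bop_apply (\<phi> a) (e j)) = (\<Sum>l<k. if l = j then f (star (d i) * a * d j) else 0)"
    unfolding \<phi>_e_left[OF assms(1)] using assms by (intro sum.cong) (auto simp: e)
  then show ?thesis
    using assms by simp
qed

text \<open>The orthogonal projection onto \<open>N\<close>; it exceeds \<open>1 - Proj\<close> by
  the projection onto the line of \<open>e 0\<close>.\<close>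

definition Q :: "'h bop" where
  "Q = 1 - (\<Sum>i\<in>{1..<k}. rank_one (e i) (e i))"

lemma Q_apply: "bop_apply Q p = p - (\<Sum>i\<in>{1..<k}. cinner (e i) p *\<^sub>C e i)"
  by (simp add: Q_def bop_left.sum bop_simps)

lemma Q_decomp: "p = (\<Sum>i\<in>{1..<k}. cinner (e i) p *\<^sub>C e i) + bop_apply Q p"
  by (simp add: Q_apply)

lemma Q_N: "bop_apply Q p \<in> N"
  unfolding N_def
proof (intro CollectI allI impI)
  fix j assume j: "0 < j \<and> j < k"
  have "cinner (e j) (\<Sum>i\<in>{1..<k}. cinner (e i) p *\<^sub>C e i) = (\<Sum>i\<in>{1..<k}. if i = j then cinner (e j) p else 0)"
    unfolding cinner_right.sum using j by (intro sum.cong) (auto simp: cinner_simps e)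
  then show "cinner (e j) (bop_apply Q p) = 0"
    using j by (simp add: Q_apply cinner_simps)
qed

lemma Q_id: "y \<in> N \<Longrightarrow> bop_apply Q y = y"
  unfolding Q_apply by (simp add: N_D scaleC_left.zero)

lemma star_Q: "star Q = Q"
  by (simp add: Q_def star.diff star.sum star_rank_one)



lemma Q_e: "0 < j \<Longrightarrow> j < k \<Longrightarrow> bop_apply Q (e j) = 0"
proof -
  assume j: "0 < j" "j < k"
  have "(\<Sum>i\<in>{1..<k}. cinner (e i) (e j) *\<^sub>C e i) = (\<Sum>i\<in>{1..<k}. if i = j then e j else 0)"
    using j by (intro sum.cong) (auto simp: e scaleC_one scaleC_left.zero)
  then show ?thesis
    using j by (simp add: Q_apply)
qed

text \<open>In the dilation \<open>e i\<close> sits at \<open>d i \<otimes> e 0\<close>, and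
  \<open>b\<close> moves \<open>e 0\<close> to \<open>b * d 0 \<otimes> e 0\<close>, so the defect
  is a squared GNS distance.\<close>

lemma defect_\<phi>:
  assumes "i < k"
  shows "defect \<phi> (e i) (e 0) b = f (star (d i - b * d 0) * (d i - b * d 0))"
  using assms k d[OF assms assms]
  by (simp add: defect_def \<phi>_e_e f.simps) (simp add: star_mult mult.assoc)

text \<open>Irreducibility makes \<open>d 0\<close> cyclic: \<open>pure_state_dense\<close> puts 1
  into the closure of the left ideal generated by \<open>d 0\<close>, and left multiplication by
  \<open>d i\<close> is continuous for the seminorm.\<close>

lemma approximate_d:
  assumes "i < k"
  obtains b where "(\<lambda>r. f.snorm (b r * d 0 - d i)) \<longlonglongrightarrow> 0"
proof -
  have "f (star (d 0) * d 0) \<noteq> 0"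
    by (simp add: d k)
  then obtain \<beta> where \<beta>: "(\<lambda>r. f.snorm (1 - \<beta> r * d 0)) \<longlonglongrightarrow> 0"
    using pure_state_dense[OF pure] by blast
  have "(\<lambda>r. f.snorm (d i * \<beta> r * d 0 - d i)) \<longlonglongrightarrow> 0"
  proof (rule tendsto_zero_dominated)
    fix r
    have "d i * \<beta> r * d 0 - d i = - (d i * (1 - \<beta> r * d 0))"
      by (simp add: algebra_simps)
    then have "f.snorm (d i * \<beta> r * d 0 - d i) = f.snorm (d i * (1 - \<beta> r * d 0))"
      by (simp only: f.snorm_minus)
    also have "\<dots> \<le> norm (d i) * f.snorm (1 - \<beta> r * d 0)"
      by (rule positive_functional_snorm_mult[OF pure_stateD(1)[OF pure]])
    finally show "norm (f.snorm (d i * \<beta> r * d 0 - d i)) \<le> norm (d i) * f.snorm (1 - \<beta> r * d 0)"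
      by simp
  next
    show "(\<lambda>r. norm (d i) * f.snorm (1 - \<beta> r * d 0)) \<longlonglongrightarrow> 0"
      using tendsto_mult[OF tendsto_const[of "norm (d i)"] \<beta>] by simp
  qed
  then show ?thesis
    by (rule that)
qed

section \<open>Completely positive maps dominated by the dilation map\<close>

context
  fixes \<Theta> :: "'a \<Rightarrow> 'h bop"
  assumes \<Theta>: "clinear \<Theta>" "form_positive \<Theta>" "form_positive (\<lambda>a. \<phi> a - \<Theta> a)"
begin

lemma diff_lin: "clinear (\<lambda>a. \<phi> a - \<Theta> a)"
  using \<phi>_lin \<Theta>(1) by (auto simp: clinear_def scaleC_right.diff)

text \<open>For nonzero \<open>y\<close> in \<open>N\<close> the functional
  \<open>cinner y (bop_apply (\<Theta> a) y)\<close> of \<open>a\<close>, divided by the square of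
  \<open>norm y\<close>, lies below the pure state \<open>F\<close> and is thus proportional to it.
  Polarisation extends this to pairs.\<close>

lemma dominated_N:
  assumes "y \<in> N" "y' \<in> N"
  shows "cinner y (bop_apply (\<Theta> a) y') = F a * cinner y (bop_apply (\<Theta> 1) y')"
proof -
  have quad: "cinner y (bop_apply (\<Theta> a) y) = F a * cinner y (bop_apply (\<Theta> 1) y)" if y: "y \<in> N" for y
  proof (cases "y = 0")
    case True
    then show ?thesis
      by (simp add: cinner_simps)
  next
    case False
    define c where "c = 1 / (norm y)\<^sup>2"
    have c: "0 \<le> c" "complex_of_real c * cinner y y = 1"
      using False by (simp_all add: c_def cinner_self)
    define g where "g a = complex_of_real c * cinner y (bop_apply (\<Theta> a) y)" for a
    have pos: "positive_functional (\<lambda>a. complex_of_real c * cinner y (bop_apply (\<Psi> a) y))"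
      if lin: "clinear \<Psi>" and fp: "form_positive \<Psi>" for \<Psi> :: "'a \<Rightarrow> 'h bop"
    proof (rule positive_functional_scale[OF _ c(1)])
      have "0 \<le> cinner y (bop_apply (\<Psi> (star a * a)) y)" for a
        using fp[unfolded form_positive_def, rule_format, where n = 1 and a = "\<lambda>_. a" and x = "\<lambda>_. y"] by simp
      then show "positive_functional (\<lambda>a. cinner y (bop_apply (\<Psi> a) y))"
        using lin by (simp add: positive_functional_def clinear_def bop_simps cinner_simps)
    qed
    have "positive_functional g"
      unfolding g_def by (rule pos[OF \<Theta>(1,2)])
    moreover have "positive_functional (\<lambda>a. F a - g a)"
    proof -
      have "F a - g a = complex_of_real c * cinner y (bop_apply (\<phi> a - \<Theta> a) y)" for a
      proof -
        have "complex_of_real c * (F a * cinner y y) = F a"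
          using c(2) by (simp add: mult.left_commute)
        then show ?thesis
          by (simp add: g_def bop_simps cinner_simps \<phi>_N_N[OF y y] right_diff_distrib)
      qed
      then show ?thesis
        using pos[OF diff_lin \<Theta>(3)] by simp
    qed
    ultimately obtain s where s: "\<And>a. g a = s * F a"
      using pure_stateD(3)[OF pure_F] by blast
    have "g a = F a * g 1"
      by (simp add: s pure_stateD(2)[OF pure_F])
    then have "complex_of_real c * cinner y (bop_apply (\<Theta> a) y)
        = complex_of_real c * (F a * cinner y (bop_apply (\<Theta> 1) y))"
      by (simp add: g_def mult_ac)
    then show ?thesis
      using False by (simp add: c_def)
  qed
  \<comment> \<open>\<open>bop_zeroI\<close> tests all vectors, so the quadratic identity on
    \<open>N\<close> is carried to the whole space by compressing with \<open>Q\<close>.\<close>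
  have "Q * (\<Theta> a - F a *\<^sub>C \<Theta> 1) * Q = 0"
  proof (rule bop_zeroI)
    fix p
    have "cinner p (bop_apply (Q * (\<Theta> a - F a *\<^sub>C \<Theta> 1) * Q) p)
        = cinner (bop_apply (star Q) p) (bop_apply (\<Theta> a - F a *\<^sub>C \<Theta> 1) (bop_apply Q p))"
      by (simp add: bop_simps cinner_star_left)
    then show "cinner p (bop_apply (Q * (\<Theta> a - F a *\<^sub>C \<Theta> 1) * Q) p) = 0"
      using quad[OF Q_N, of p] by (simp add: star_Q bop_simps cinner_simps)
  qed
  then have "cinner y (bop_apply (Q * (\<Theta> a - F a *\<^sub>C \<Theta> 1) * Q) y') = 0"
    by (simp add: bop_simps cinner_simps)
  moreover have "cinner y (bop_apply (Q * (\<Theta> a - F a *\<^sub>C \<Theta> 1) * Q) y')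
      = cinner (bop_apply (star Q) y) (bop_apply (\<Theta> a - F a *\<^sub>C \<Theta> 1) (bop_apply Q y'))"
    by (simp add: bop_simps cinner_star_left)
  ultimately show ?thesis
    by (simp add: star_Q Q_id assms bop_simps cinner_simps)
qed

text \<open>In the Stinespring space of \<phi> the vector of \<open>e i\<close> is the limit of the
  \<open>b r\<close> applied to that of \<open>e 0\<close>. This passes to \<Theta>: its defect is
  at most that of \<phi>, and Cauchy-Schwarz transfers the vanishing of the defect to the
  entries.\<close>

lemma dominated_limit:
  assumes "i < k" and b: "(\<lambda>r. f.snorm (b r * d 0 - d i)) \<longlonglongrightarrow> 0"
  shows "(\<lambda>r. cinner (e 0) (bop_apply (\<Theta> (star (b r) * a)) z)) \<longlonglongrightarrow> cinner (e i) (bop_apply (\<Theta> a) z)"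
proof (rule LIM_zero_cancel, rule tendsto_zero_dominated)
  define C where "C = sqrt (Re (cinner z (bop_apply (\<Theta> (star a * a)) z)))"
  have C: "C\<^sup>2 = Re (cinner z (bop_apply (\<Theta> (star a * a)) z))"
    using \<Theta>(2)[unfolded form_positive_def, rule_format, where n = 1 and a = "\<lambda>_. a" and x = "\<lambda>_. z"]
    by (simp add: C_def complex_nonneg_iff)
  show "(\<lambda>r. f.snorm (b r * d 0 - d i) * C) \<longlonglongrightarrow> 0"
    using tendsto_mult[OF b tendsto_const[of C]] by simp
  fix r
  have "0 \<le> defect (\<lambda>a. \<phi> a - \<Theta> a) (e i) (e 0) (b r)"
    by (rule defect_nonneg[OF diff_lin \<Theta>(3)])
  then have "Re (defect \<Theta> (e i) (e 0) (b r)) \<le> Re (defect \<phi> (e i) (e 0) (b r))"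
    by (simp add: defect_def bop_simps cinner_simps complex_nonneg_iff)
  also have "\<dots> = (f.snorm (b r * d 0 - d i))\<^sup>2"
    using f.snorm_minus_commute[of "b r * d 0" "d i"]
    by (simp add: defect_\<phi>[OF assms(1)] f.snorm_power2)
  finally have le: "Re (defect \<Theta> (e i) (e 0) (b r)) \<le> (f.snorm (b r * d 0 - d i))\<^sup>2" .
  have C0: "0 \<le> C\<^sup>2"
    by simp
  show "norm (cinner (e 0) (bop_apply (\<Theta> (star (b r) * a)) z) - cinner (e i) (bop_apply (\<Theta> a) z))
      \<le> f.snorm (b r * d 0 - d i) * C"
  proof (rule power2_le_imp_le)
    have "(norm (cinner (e 0) (bop_apply (\<Theta> (star (b r) * a)) z) - cinner (e i) (bop_apply (\<Theta> a) z)))\<^sup>2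
        \<le> Re (defect \<Theta> (e i) (e 0) (b r)) * C\<^sup>2"
      unfolding C norm_minus_commute[of "cinner (e 0) _"] by (rule defect_cauchy[OF \<Theta>(1,2)])
    also have "\<dots> \<le> (f.snorm (b r * d 0 - d i))\<^sup>2 * C\<^sup>2"
      by (rule mult_right_mono[OF le C0])
    finally show "(norm (cinner (e 0) (bop_apply (\<Theta> (star (b r) * a)) z) - cinner (e i) (bop_apply (\<Theta> a) z)))\<^sup>2
        \<le> (f.snorm (b r * d 0 - d i) * C)\<^sup>2"
      by (simp add: power_mult_distrib)
    show "0 \<le> f.snorm (b r * d 0 - d i) * C"
      unfolding C_def using C C0 by simp
  qed
qed

lemma limit_f:
  assumes b: "(\<lambda>r. f.snorm (b r * d 0 - d i)) \<longlonglongrightarrow> 0"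
  shows "(\<lambda>r. f (star (d 0) * (star (b r) * a) * d j)) \<longlonglongrightarrow> f (star (d i) * a * d j)"
proof -
  have "(\<lambda>r. f (star (b r * d 0) * (a * d j))) \<longlonglongrightarrow> f (star (d i) * (a * d j))"
    by (rule f.tendsto_form[OF b]) (simp add: f.snorm_def clinear_zero[OF f_lin])
  then show ?thesis
    by (simp add: star_mult mult.assoc)
qed

lemma dominated_e_N:
  assumes i: "i < k" and y: "y \<in> N"
  shows "cinner (e i) (bop_apply (\<Theta> a) y) = f (star (d i) * a * d 0) * cinner (e 0) (bop_apply (\<Theta> 1) y)"
proof -
  obtain b where b: "(\<lambda>r. f.snorm (b r * d 0 - d i)) \<longlonglongrightarrow> 0"
    using approximate_d[OF i] by blast
  have eq: "(\<lambda>r. cinner (e 0) (bop_apply (\<Theta> (star (b r) * a)) y))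
      = (\<lambda>r. f (star (d 0) * (star (b r) * a) * d 0) * cinner (e 0) (bop_apply (\<Theta> 1) y))"
    by (rule ext, subst dominated_N[OF e0_N y]) (simp add: F_def)
  have "(\<lambda>r. cinner (e 0) (bop_apply (\<Theta> (star (b r) * a)) y))
      \<longlonglongrightarrow> f (star (d i) * a * d 0) * cinner (e 0) (bop_apply (\<Theta> 1) y)"
    unfolding eq by (intro tendsto_mult tendsto_const limit_f b)
  with dominated_limit[OF i b] show ?thesis
    by (rule LIMSEQ_unique)
qed

text \<open>For \<open>j > 0\<close> the vector \<open>e j\<close> is outside \<open>N\<close>, so
  one index is treated at a time: the entries of \<open>e 0\<close> against \<open>e j\<close>
  follow from \<open>dominated_e_N\<close> by taking adjoints, and the limit then turns
  \<open>e 0\<close> into \<open>e i\<close>.\<close>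

lemma dominated_e_e:
  assumes i: "i < k" and j: "j < k"
  shows "cinner (e i) (bop_apply (\<Theta> a) (e j)) = f (star (d i) * a * d j) * cinner (e 0) (bop_apply (\<Theta> 1) (e 0))"
proof -
  obtain b where b: "(\<lambda>r. f.snorm (b r * d 0 - d i)) \<longlonglongrightarrow> 0"
    using approximate_d[OF i] by blast
  have "cinner (e 0) (bop_apply (\<Theta> x) (e j)) = f (star (d 0) * x * d j) * cinner (e 0) (bop_apply (\<Theta> 1) (e 0))" for x
  proof -
    have "cinner (e 0) (bop_apply (\<Theta> x) (e j)) = cnj (cinner (e j) (bop_apply (\<Theta> (star x)) (e 0)))"
      using form_positive_star[OF \<Theta>(1,2), of "e 0" "star x" "e j"] by (simp add: star_star)
    also have "\<dots> = cnj (f (star (d j) * star x * d 0)) * cnj (cinner (e 0) (bop_apply (\<Theta> 1) (e 0)))"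
      by (simp add: dominated_e_N[OF j e0_N])
    also have "cnj (f (star (d j) * star x * d 0)) = f (star (d 0) * x * d j)"
      using positive_functional_star[OF pure_stateD(1)[OF pure], of "star (d j) * star x * d 0"]
      by (simp add: star_mult star_star mult.assoc)
    also have "cnj (cinner (e 0) (bop_apply (\<Theta> 1) (e 0))) = cinner (e 0) (bop_apply (\<Theta> 1) (e 0))"
      using form_positive_star[OF \<Theta>(1,2), of "e 0" 1 "e 0"] by simp
    finally show ?thesis .
  qed
  then have "(\<lambda>r. cinner (e 0) (bop_apply (\<Theta> (star (b r) * a)) (e j)))
      \<longlonglongrightarrow> f (star (d i) * a * d j) * cinner (e 0) (bop_apply (\<Theta> 1) (e 0))"
    by (simp only:) (intro tendsto_mult tendsto_const limit_f b)
  with dominated_limit[OF i b] show ?thesis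
    by (rule LIMSEQ_unique)
qed

text \<open>\<Theta> is determined by \<open>\<Theta> 1\<close> on \<open>N\<close>, so it is enough
  to factor that form by an \<open>R\<close> which respects the embedding of \<open>H\<close> into
  the dilation. As \<open>e 0\<close> belongs both to \<open>N\<close> and to the
  \<open>e i\<close>, the line of \<open>e 0\<close> has to be preserved with the same factor
  \<open>s\<close> that acts on the other \<open>e i\<close>.\<close>

lemma dominated_conj:
  assumes s: "cinner (e 0) (bop_apply (\<Theta> 1) (e 0)) = complex_of_real (s * s)" "s \<noteq> 0"
    and R_e: "\<And>i. i < k \<Longrightarrow> bop_apply R (e i) = complex_of_real s *\<^sub>C e i"
    and RN: "\<And>y. y \<in> N \<Longrightarrow> bop_apply R y \<in> N"
    and RR: "\<And>y y'. y \<in> N \<Longrightarrow> y' \<in> N \<Longrightarrow>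
      cinner (bop_apply R y) (bop_apply R y') = cinner y (bop_apply (\<Theta> 1) y')"
  shows "\<Theta> a = star R * \<phi> a * R"
proof -
  define X where "X a = \<Theta> a - star R * \<phi> a * R" for a
  have X: "cinner p (bop_apply (X a) q)
      = cinner p (bop_apply (\<Theta> a) q) - cinner (bop_apply R p) (bop_apply (\<phi> a) (bop_apply R q))" for a p q
    by (simp add: X_def bop_simps cinner_simps cinner_star_right)
  have ee: "cinner (e i) (bop_apply (X a) (e j)) = 0" if "i < k" "j < k" for a i j
    unfolding X dominated_e_e[OF that] R_e[OF that(1)] R_e[OF that(2)] bop_apply_scaleC cinner_scaleC_left
      cinner_scaleC_right \<phi>_e_e[OF that] s by simp
  have eN: "cinner (e i) (bop_apply (X a) y) = 0" if "i < k" "y \<in> N" for a i y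
  proof -
    have r: "cinner (e 0) (bop_apply (\<Theta> 1) y) = complex_of_real s * cinner (e 0) (bop_apply R y)"
      using RR[OF e0_N that(2)] by (simp add: R_e[OF k] cinner_scaleC_left)
    show ?thesis
      unfolding X dominated_e_N[OF that] R_e[OF that(1)] cinner_scaleC_left \<phi>_e_N[OF that(1) RN[OF that(2)]] r
      by simp
  qed
  have Ne: "cinner y (bop_apply (X a) (e i)) = 0" if "i < k" "y \<in> N" for a i y
  proof -
    have "cinner p (bop_apply (X a) q) = cnj (cinner q (bop_apply (X (star a)) p))" for p q
      using form_positive_star[OF \<Theta>(1,2), of p "star a" q]
        form_positive_star[OF \<phi>_lin \<phi>_form_positive, of "bop_apply R p" "star a" "bop_apply R q"]
      by (simp add: X star_star)
    then show ?thesis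
      using eN[OF that] by simp
  qed
  have NN: "cinner y (bop_apply (X a) y') = 0" if "y \<in> N" "y' \<in> N" for a y y'
  proof -
    have "cinner y (bop_apply (\<Theta> a) y') = F a * cinner y (bop_apply (\<Theta> 1) y')"
      by (rule dominated_N[OF that])
    then show ?thesis
      unfolding X \<phi>_N_N[OF RN[OF that(1)] RN[OF that(2)]] RR[OF that] by simp
  qed
  have "X a = 0" for a
  proof (rule bop_eqI_cinner)
    fix p q
    have left: "cinner p (bop_apply (X a) z) = 0"
      if "\<And>i. i < k \<Longrightarrow> cinner (e i) (bop_apply (X a) z) = 0" "\<And>y. y \<in> N \<Longrightarrow> cinner y (bop_apply (X a) z) = 0" for z
    proof -
      have "cinner p (bop_apply (X a) z) = cinner ((\<Sum>i\<in>{1..<k}. cinner (e i) p *\<^sub>C e i) + bop_apply Q p) (bop_apply (X a) z)"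
        using Q_decomp[of p] by simp
      also have "\<dots> = 0"
        by (simp add: cinner_add_left cinner_left.sum cinner_scaleC_left that Q_N)
      finally show ?thesis .
    qed
    have "bop_apply (X a) q = (\<Sum>i\<in>{1..<k}. cinner (e i) q *\<^sub>C bop_apply (X a) (e i)) + bop_apply (X a) (bop_apply Q q)"
      by (subst Q_decomp[of q]) (simp add: bop_right.add bop_right.sum bop_apply_scaleC)
    then show "cinner p (bop_apply (X a) q) = cinner p (bop_apply 0 q)"
      using left[of "bop_apply Q q"] left[of "e _"]
      by (simp add: cinner_add_right cinner_right.sum cinner_scaleC_right ee Ne eN NN Q_N bop_simps cinner_simps)
  qed
  then show ?thesis
    by (simp add: X_def)
qed

end

end

text \<open>The reflection along \<open>v - w\<close>. A self-adjoint \<open>U\<close> that maps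
  \<open>v\<close> to \<open>w\<close> forces \<open>cinner w v\<close> to be real, whence the
  hypothesis on \<open>r\<close>.\<close>

lemma householder:
  fixes v w :: "'h::chilbert_space"
  assumes v: "cinner v v = 1" and w: "cinner w w = 1" and wv: "cinner w v = complex_of_real r"
  obtains U where "star U = U" "U * U = 1" "bop_apply U v = w"
    "\<And>x. cinner v x = 0 \<Longrightarrow> cinner w x = 0 \<Longrightarrow> bop_apply U x = x"
proof (cases "v = w")
  case True
  then show ?thesis
    by (intro that[of 1]) (auto simp: bop_simps)
next
  case False
  define u where "u = v - w"
  define c where "c = complex_of_real (2 / (norm u)\<^sup>2)"
  have "u \<noteq> 0"
    using False by (simp add: u_def)
  then have cu: "c * cinner u u = 2"
    by (simp add: c_def cinner_self)
  define U where "U = 1 - c *\<^sub>C rank_one u u"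
  have U: "bop_apply U x = x - (c * cinner u x) *\<^sub>C u" for x
    by (simp add: U_def bop_simps scaleC_scaleC)
  have vw: "cinner v w = complex_of_real r"
    using cinner_commute[of v w] by (simp add: wv)
  have "cinner u u = 2 * cinner u v"
    by (simp add: u_def cinner_simps v w wv vw)
  then have cv: "c * cinner u v = 1"
    using cu by simp
  show ?thesis
  proof (rule that[of U])
    show "star U = U"
      by (simp add: U_def star.diff star_scaleC star_rank_one c_def)
    show "U * U = 1"
    proof (rule bop_eqI)
      fix x
      have "c * (c * (cinner u u * cinner u x)) = (c * cinner u u) * (c * cinner u x)"
        by (simp add: mult_ac)
      then have 1: "c * (c * (cinner u u * cinner u x)) = 2 * (c * cinner u x)"
        by (simp add: cu)
      have "c * cinner u (bop_apply U x) = - (c * cinner u x)"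
        using 1 by (simp add: U cinner_simps algebra_simps)
      then show "bop_apply (U * U) x = bop_apply 1 x"
        by (simp add: bop_simps U[of "bop_apply U x"]) (simp add: U cspace_simps)
    qed
    show "bop_apply U v = w"
      by (simp add: U cv scaleC_one) (simp add: u_def)
    show "bop_apply U x = x" if "cinner v x = 0" "cinner w x = 0" for x
      by (simp add: U u_def cinner_simps that scaleC_left.zero)
  qed
qed

lemma invertible_mult:
  assumes "invertible_elem a" "invertible_elem b"
  shows "invertible_elem (a * b)"
proof -
  obtain a' b' where "a * a' = 1" "a' * a = 1" "b * b' = 1" "b' * b = 1"
    using assms unfolding invertible_elem_def by blast
  then have "(a * b) * (b' * a') = 1" "(b' * a') * (a * b) = 1"
    by (metis mult.assoc mult_1_left)+
  then show ?thesis
    unfolding invertible_elem_def by blast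
qed

lemma cinner_zero_imp: "cinner x x = 0 \<Longrightarrow> x = 0" for x :: "'h::chilbert_space"
  by (simp add: cinner_self)

section \<open>Construction of the intertwiner, and C*-extremality\<close>

context pure_dilation
begin

text \<open>The square root \<open>b\<close> of the compression of \<open>star T * T\<close> to
  \<open>N\<close> has the right form on \<open>N\<close>, but moves \<open>e 0\<close> to some
  vector of length \<open>s\<close>. As \<open>b\<close> is self-adjoint, that vector has a real
  inner product with \<open>e 0\<close>, so a Householder reflection brings it to the line of
  \<open>e 0\<close> while leaving the other \<open>e j\<close> alone.\<close>

lemma intertwiner_exists:
  assumes T: "invertible_elem T"
  obtains R s where "invertible_elem R" "s \<noteq> 0"
    "cinner (e 0) (bop_apply (star T * T) (e 0)) = complex_of_real (s * s)"
    "\<And>i. i < k \<Longrightarrow> bop_apply R (e i) = complex_of_real s *\<^sub>C e i"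
    "\<And>y. y \<in> N \<Longrightarrow> bop_apply R y \<in> N"
    "\<And>y y'. y \<in> N \<Longrightarrow> y' \<in> N \<Longrightarrow> cinner (bop_apply R y) (bop_apply R y') = cinner y (bop_apply (star T * T) y')"
proof -
  obtain T' where T': "T' * T = 1"
    using T unfolding invertible_elem_def by blast
  define K where "K = norm T' + 1"
  have K: "0 < K"
    by (simp add: K_def add_nonneg_pos)
  have T_below: "norm x \<le> K * norm (bop_apply T x)" for x
  proof -
    have "norm x = norm (bop_apply T' (bop_apply T x))"
      using arg_cong[OF T', of "\<lambda>S. bop_apply S x"] by (simp add: bop_simps)
    also have "\<dots> \<le> norm T' * norm (bop_apply T x)"
      by (rule norm_bop_apply)
    also have "\<dots> \<le> K * norm (bop_apply T x)"
      by (intro mult_right_mono) (simp_all add: K_def)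
    finally show ?thesis .
  qed
  define E where "E = Q * (star T * T) * Q"
  have E_form: "cinner x (bop_apply E y) = cinner (bop_apply T (bop_apply Q x)) (bop_apply T (bop_apply Q y))" for x y
  proof -
    have "cinner x (bop_apply E y) = cinner (bop_apply (star Q) x) (bop_apply (star T * T) (bop_apply Q y))"
      by (simp add: E_def bop_simps cinner_star_left)
    then show ?thesis
      by (simp add: star_Q bop_simps cinner_star_right)
  qed
  obtain b where b: "star b = b" "b * b = E"
    by (rule operator_sqrt[of E]) (simp add: E_form, blast)
  have bb: "cinner (bop_apply b x) (bop_apply b y) = cinner x (bop_apply E y)" for x y
  proof -
    have "cinner (bop_apply b x) (bop_apply b y) = cinner x (bop_apply (star b * b) y)"
      by (simp add: bop_simps cinner_star_right)
    then show ?thesis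
      by (simp add: b)
  qed
  have b_zero: "bop_apply b x = 0" if "bop_apply Q x = 0" for x
    by (rule cinner_zero_imp) (simp add: bb E_form that bop_simps cinner_simps)
  have b_move: "cinner x (bop_apply b y) = cinner (bop_apply b x) y" for x y
    using cinner_star_right[of x b y] by (simp add: b(1))
  have b_e: "bop_apply b (e j) = 0" if "0 < j" "j < k" for j
    by (rule b_zero[OF Q_e[OF that]])
  have b_N: "bop_apply b y \<in> N" for y
    by (simp add: N_def b_move b_e cinner_simps)
  have e0: "cinner (e 0) (e 0) = 1"
    by (simp add: e k)
  define s where "s = norm (bop_apply T (e 0))"
  have "norm (e 0) = 1"
    using e0 power2_eq_imp_eq[of "norm (e 0)" 1] by (simp add: cinner_self flip: of_real_power)
  then have s: "0 < s"
    using T_below[of "e 0"] K by (cases "bop_apply T (e 0) = 0") (auto simp: s_def)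
  have ss: "cinner (e 0) (bop_apply (star T * T) (e 0)) = complex_of_real (s * s)"
    by (simp add: bop_simps cinner_star_right cinner_self s_def power2_eq_square)
  define v where "v = complex_of_real (1 / s) *\<^sub>C bop_apply b (e 0)"
  have b_e0: "bop_apply b (e 0) = complex_of_real s *\<^sub>C v"
    using s by (simp add: v_def cspace_simps)
  have bbe0: "cinner (bop_apply b (e 0)) (bop_apply b (e 0)) = complex_of_real (s * s)"
    unfolding bb E_form Q_id[OF e0_N] by (simp add: cinner_self s_def power2_eq_square)
  have v1: "cinner v v = 1"
    using s by (simp add: v_def cinner_simps bbe0)
  have "Im (cinner (e 0) (bop_apply b (e 0))) = 0"
    using cinner_commute[of "bop_apply b (e 0)" "e 0"] b_move[of "e 0" "e 0"] by (simp add: complex_eq_iff)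
  then have e0v: "cinner (e 0) v = complex_of_real (Re (cinner (e 0) (bop_apply b (e 0))) / s)"
    by (simp add: v_def cinner_simps complex_eq_iff)
  obtain U where U: "star U = U" "U * U = 1" "bop_apply U v = e 0"
    "\<And>x. cinner v x = 0 \<Longrightarrow> cinner (e 0) x = 0 \<Longrightarrow> bop_apply U x = x"
    using householder[OF v1 e0 e0v] by blast
  \<comment> \<open>On the complement of \<open>N\<close>, where \<open>b\<close> vanishes, the
    factor \<open>s\<close> is supplied by hand so that all \<open>e i\<close> end up scaled
    alike.\<close>
  define S where "S = b + complex_of_real s *\<^sub>C (1 - Q)"
  have S_apply: "bop_apply S x = bop_apply b x + complex_of_real s *\<^sub>C (x - bop_apply Q x)" for x
    by (simp add: S_def bop_simps)
  have S_N: "bop_apply S y = bop_apply b y" if "y \<in> N" for y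
    by (simp add: S_apply Q_id that cspace_simps)
  have S_e: "bop_apply S (e j) = complex_of_real s *\<^sub>C e j" if "0 < j" "j < k" for j
    by (simp add: S_apply b_e Q_e that)
  have v_N: "v \<in> N"
    using b_N[of "e 0"] by (simp add: v_def N_def cinner_simps)
  have U_e: "bop_apply U (e j) = e j" if "0 < j" "j < k" for j
    by (rule U(4)) (use N_D'[OF v_N that] N_D'[OF e0_N that] in auto)
  have U_move: "cinner x (bop_apply U y) = cinner (bop_apply U x) y" for x y
    using cinner_star_right[of x U y] by (simp add: U(1))
  have UU: "cinner (bop_apply U x) (bop_apply U y) = cinner x y" for x y
  proof -
    have "cinner (bop_apply U x) (bop_apply U y) = cinner x (bop_apply (U * U) y)"
      by (simp add: bop_simps U_move)
    then show ?thesis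
      by (simp add: U(2) bop_simps)
  qed
  have star_S: "star S = S"
    by (simp add: S_def star_add star_scaleC star.diff star_Q b(1))
  have S_below: "(norm (bop_apply S x))\<^sup>2 = (norm (bop_apply T (bop_apply Q x)))\<^sup>2 + s\<^sup>2 * (norm (x - bop_apply Q x))\<^sup>2" for x
  proof -
    have move: "cinner y (bop_apply Q x) = cinner (bop_apply Q y) x" for x y
      using cinner_star_right[of y Q x] by (simp add: star_Q)
    have 1: "cinner (bop_apply b x) (x - bop_apply Q x) = 0"
      by (simp add: cinner_simps move Q_id[OF b_N])
    then have 2: "cinner (x - bop_apply Q x) (bop_apply b x) = 0"
      using cinner_commute[of "x - bop_apply Q x" "bop_apply b x"] by simp
    have "cinner (bop_apply S x) (bop_apply S x) = cinner (bop_apply b x) (bop_apply b x)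
        + complex_of_real s * (complex_of_real s * cinner (x - bop_apply Q x) (x - bop_apply Q x))"
      unfolding S_apply cinner_add_left cinner_add_right cinner_scaleC_left cinner_scaleC_right 1 2 by simp
    then have "complex_of_real ((norm (bop_apply S x))\<^sup>2)
        = complex_of_real ((norm (bop_apply T (bop_apply Q x)))\<^sup>2 + s\<^sup>2 * (norm (x - bop_apply Q x))\<^sup>2)"
      unfolding bb E_form unfolding cinner_self by (simp add: power2_eq_square)
    then show ?thesis
      by (simp only: of_real_eq_iff)
  qed
  \<comment> \<open>\<open>operator_sqrt\<close> says nothing about the sign of \<open>b\<close>, so
    the operator seen to be positive definite is \<open>S * S\<close>; its inverse gives
    \<open>S\<close> an inverse on either side.\<close>
  have "invertible_elem (S * S)"
  proof (rule invertible_positive_definite)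
    have SS: "cinner x (bop_apply (S * S) x) = complex_of_real ((norm (bop_apply S x))\<^sup>2)" for x
      using cinner_star_right[of x S "bop_apply S x"] by (simp add: star_S bop_simps cinner_self)
    show "0 \<le> cinner x (bop_apply (S * S) x)" for x
      unfolding SS by (simp add: complex_nonneg_iff flip: of_real_power)
    \<comment> \<open>\<open>1 / K\<close> bounds \<open>T\<close> from below and \<open>s\<close>
      is the factor off \<open>N\<close>. The half pays for \<open>(norm y + norm z)\<^sup>2 \<le> 2
      * (norm y)\<^sup>2 + 2 * (norm z)\<^sup>2\<close>.\<close>
    define c where "c = min (1 / K\<^sup>2) (s\<^sup>2) / 2"
    show "0 < c"
      using K s by (simp add: c_def)
    show "c * (norm x)\<^sup>2 \<le> Re (cinner x (bop_apply (S * S) x))" for x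
    proof -
      define y z where "y = bop_apply Q x" and "z = x - bop_apply Q x"
      have "norm x \<le> norm y + norm z"
        using norm_triangle_ineq[of y z] by (simp add: y_def z_def)
      then have "(norm x)\<^sup>2 \<le> (norm y + norm z)\<^sup>2"
        by (intro power_mono) auto
      also have "\<dots> \<le> 2 * (norm y)\<^sup>2 + 2 * (norm z)\<^sup>2"
        using zero_le_power2[of "norm y - norm z"] by (simp add: power2_eq_square algebra_simps)
      finally have "c * (norm x)\<^sup>2 \<le> c * (2 * (norm y)\<^sup>2 + 2 * (norm z)\<^sup>2)"
        using \<open>0 < c\<close> by (intro mult_left_mono) auto
      also have "\<dots> = (2 * c) * (norm y)\<^sup>2 + (2 * c) * (norm z)\<^sup>2"
        by (simp add: algebra_simps)
      also have "\<dots> \<le> (1 / K\<^sup>2) * (norm y)\<^sup>2 + s\<^sup>2 * (norm z)\<^sup>2"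
        by (intro add_mono mult_right_mono) (simp_all add: c_def)
      also have "(1 / K\<^sup>2) * (norm y)\<^sup>2 \<le> (norm (bop_apply T y))\<^sup>2"
      proof -
        have "(norm y)\<^sup>2 \<le> (K * norm (bop_apply T y))\<^sup>2"
          by (intro power_mono T_below) auto
        then show ?thesis
          using K by (simp add: power_mult_distrib field_simps)
      qed
      finally show ?thesis
        unfolding SS by (simp add: S_below y_def z_def flip: of_real_power)
    qed
  qed
  then obtain S' where "S * S * S' = 1" "S' * (S * S) = 1"
    unfolding invertible_elem_def by blast
  then have S': "S * (S * S') = 1" "(S' * S) * S = 1"
    by (simp_all add: mult.assoc)
  have "S' * S = (S' * S) * (S * (S * S'))"
    by (simp add: S'(1))
  also have "\<dots> = ((S' * S) * S) * (S * S')"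
    by (simp only: mult.assoc)
  also have "\<dots> = S * S'"
    by (simp add: S'(2))
  finally have "invertible_elem S"
    unfolding invertible_elem_def using S' by metis
  moreover have "invertible_elem U"
    unfolding invertible_elem_def using U(2) by blast
  ultimately have inv: "invertible_elem (U * S)"
    by (intro invertible_mult)
  show ?thesis
  proof (rule that[of "U * S" s])
    show "bop_apply (U * S) (e i) = complex_of_real s *\<^sub>C e i" if "i < k" for i
    proof (cases "i = 0")
      case True
      then show ?thesis
        by (simp add: bop_simps S_N[OF e0_N] b_e0 U(3))
    next
      case False
      then show ?thesis
        using that by (simp add: bop_simps S_e U_e)
    qed
    show "bop_apply (U * S) y \<in> N" if "y \<in> N" for y
      using b_N[of y] by (simp add: N_def bop_simps S_N[OF that] U_move U_e)
    show "cinner (bop_apply (U * S) y) (bop_apply (U * S) y') = cinner y (bop_apply (star T * T) y')"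
      if "y \<in> N" "y' \<in> N" for y y'
      using that by (simp add: bop_simps UU S_N bb E_form Q_id cinner_star_right)
  qed (use inv s ss in auto)
qed

theorem \<phi>_extreme: "\<phi> \<in> cstar_extreme_points"
  unfolding cstar_extreme_points_def
proof (intro CollectI conjI \<phi>_ucp allI impI ballI)
  fix n :: nat and \<psi> and T :: "nat \<Rightarrow> 'h bop" and i
  assume mem: "\<forall>i\<in>{1..n}. \<psi> i \<in> ucp_maps \<and> invertible_elem (T i)"
    and \<phi>_eq: "\<phi> = (\<lambda>a. \<Sum>i = 1..n. star (T i) * \<psi> i a * T i)" and i: "i \<in> {1..n}"
  define \<Theta> where "\<Theta> j a = star (T j) * \<psi> j a * T j" for j a
  have \<Theta>: "clinear (\<Theta> j)" "form_positive (\<Theta> j)" if "j \<in> {1..n}" for j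
  proof -
    have "completely_positive (\<psi> j)"
      using mem that by (auto simp: ucp_maps_def)
    from completely_positiveD[OF this] show "clinear (\<Theta> j)" "form_positive (\<Theta> j)"
      unfolding \<Theta>_def by (auto intro: clinear_conj form_positive_conj)
  qed
  \<comment> \<open>The remaining summands have positive forms, so each single summand is dominated
    by \<phi>.\<close>
  have "(\<lambda>a. \<phi> a - \<Theta> i a) = (\<lambda>a. \<Sum>j\<in>{1..n} - {i}. \<Theta> j a)"
    by (subst \<phi>_eq) (use i in \<open>simp add: sum_diff1 \<Theta>_def\<close>)
  then have diff: "form_positive (\<lambda>a. \<phi> a - \<Theta> i a)"
    using form_positive_sum[of "{1..n} - {i}" \<Theta>] \<Theta>(2) by simp
  have \<Theta>1: "\<Theta> i 1 = star (T i) * T i"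
    using mem i by (simp add: \<Theta>_def ucp_maps_def)
  obtain R s where R: "invertible_elem R" "s \<noteq> 0"
    "cinner (e 0) (bop_apply (star (T i) * T i) (e 0)) = complex_of_real (s * s)"
    "\<And>i. i < k \<Longrightarrow> bop_apply R (e i) = complex_of_real s *\<^sub>C e i"
    "\<And>y. y \<in> N \<Longrightarrow> bop_apply R y \<in> N"
    "\<And>y y'. y \<in> N \<Longrightarrow> y' \<in> N \<Longrightarrow> cinner (bop_apply R y) (bop_apply R y') = cinner y (bop_apply (star (T i) * T i) y')"
    using intertwiner_exists[of "T i"] mem i by blast
  have conj: "\<Theta> i a = star R * \<phi> a * R" for a
    by (rule dominated_conj[OF \<Theta>[OF i] diff, of s]) (use R \<Theta>1 in auto)
  obtain T' where T': "T i * T' = 1" "T' * T i = 1"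
    using mem i unfolding invertible_elem_def by blast
  then have T'_star: "star T' * star (T i) = 1"
    by (metis star_mult star_one)
  define U where "U = R * T'"
  have "invertible_elem T'"
    using T' unfolding invertible_elem_def by blast
  then obtain V where V: "U * V = 1" "V * U = 1"
    using invertible_mult[OF R(1)] unfolding U_def invertible_elem_def by blast
  have cancel: "star T' * (star (T i) * x * T i) * T' = x" for x
  proof -
    have "star T' * (star (T i) * x * T i) * T' = (star T' * star (T i)) * x * (T i * T')"
      by (simp only: mult.assoc)
    then show ?thesis
      by (simp add: T' T'_star)
  qed
  have \<psi>: "\<psi> i a = star U * \<phi> a * U" for a
  proof -
    have "\<psi> i a = star T' * \<Theta> i a * T'"
      unfolding \<Theta>_def by (rule cancel[symmetric])
    then show ?thesis
      by (simp add: conj U_def star_mult mult.assoc)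
  qed
  \<comment> \<open>Evaluation at 1, where both maps are unital, makes \<open>U\<close> an isometry;
    an invertible isometry is unitary.\<close>
  have "star U * U = 1"
    using \<psi>[of 1] mem i by (simp add: \<phi>_one ucp_maps_def)
  moreover from this have "star U = V"
    by (metis V(1) mult.assoc mult_1_left mult_1_right)
  ultimately have "unitary_elem U"
    using V by (simp add: unitary_elem_def)
  then show "\<exists>U. unitary_elem U \<and> \<psi> i = (\<lambda>a. star U * \<phi> a * U)"
    using \<psi> by blast
qed

end


section \<open>Density of the C*-convex hull\<close>

lemma cstar_convex_hull_list:
  assumes ys: "ys \<noteq> []" "\<And>\<phi> T. (\<phi>, T) \<in> set ys \<Longrightarrow> \<phi> \<in> K"
    and one: "(\<Sum>(\<phi>, T)\<leftarrow>ys. star T * T) = 1"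
  shows "(\<lambda>a. \<Sum>(\<phi>, T)\<leftarrow>ys. star T * \<phi> a * T) \<in> cstar_convex_hull K"
proof -
  have sum: "sum_list (map g ys) = (\<Sum>i = 1..length ys. g (ys ! (i - 1)))" for g :: "_ \<Rightarrow> 'b bop"
    by (simp add: sum_list_sum_nth sum.atLeast1_atMost_eq atLeast0LessThan)
  have "fst (ys ! (i - 1)) \<in> K" if "i \<in> {1..length ys}" for i
  proof -
    have "ys ! (i - 1) \<in> set ys"
      using that by (intro nth_mem) auto
    then show ?thesis
      using ys(2) by (metis prod.collapse)
  qed
  moreover have "(\<Sum>i = 1..length ys. star (snd (ys ! (i - 1))) * snd (ys ! (i - 1))) = 1"
    using one unfolding sum by (simp add: case_prod_beta)
  moreover have "(\<lambda>a. \<Sum>(\<phi>, T)\<leftarrow>ys. star T * \<phi> a * T)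
      = (\<lambda>a. \<Sum>i = 1..length ys. star (snd (ys ! (i - 1))) * fst (ys ! (i - 1)) a * snd (ys ! (i - 1)))"
    unfolding sum by (simp add: case_prod_beta)
  moreover have "1 \<le> length ys"
    using ys(1) by (cases ys) auto
  ultimately show ?thesis
    unfolding cstar_convex_hull_def
    by (intro CollectI exI[of _ "length ys"] exI[of _ "\<lambda>i. fst (ys ! (i - 1))"]
        exI[of _ "\<lambda>i. snd (ys ! (i - 1))"]) simp
qed

lemma cstar_convex_hull_ucp:
  assumes "K \<subseteq> ucp_maps"
  shows "cstar_convex_hull K \<subseteq> ucp_maps"
proof
  fix \<Phi> assume "\<Phi> \<in> cstar_convex_hull K"
  then obtain n :: nat and \<phi> and T where K: "\<And>i. i \<in> {1..n} \<Longrightarrow> \<phi> i \<in> K" and one: "(\<Sum>i=1..n. star (T i) * T i) = 1"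
    and \<Phi>: "\<Phi> = (\<lambda>a. \<Sum>i=1..n. star (T i) * \<phi> i a * T i)"
    unfolding cstar_convex_hull_def by blast
  have ucp: "completely_positive (\<phi> i)" "\<phi> i 1 = 1" if "i \<in> {1..n}" for i
    using K[OF that] assms by (auto simp: ucp_maps_def)
  have "clinear \<Phi>"
    unfolding \<Phi> using completely_positiveD(1)[OF ucp(1)] by (intro clinear_sum_fun clinear_conj)
  moreover have "form_positive \<Phi>"
    unfolding \<Phi> using completely_positiveD(2)[OF ucp(1)] by (intro form_positive_sum form_positive_conj)
  moreover have "\<Phi> 1 = 1"
    unfolding \<Phi> one[symmetric] by (intro sum.cong) (simp_all add: ucp)
  ultimately show "\<Phi> \<in> ucp_maps"
    by (simp add: ucp_maps_def completely_positiveI)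
qed

lemma extreme_points_ucp: "cstar_extreme_points \<subseteq> ucp_maps"
  by (auto simp: cstar_extreme_points_def)

text \<open>Gram-Schmidt for the form of \<open>p\<close> turns the row \<open>c\<close> into
  orthonormal \<open>d i\<close> with coefficients \<open>t i j\<close>. The extreme point is built
  from the \<open>d i\<close>, and \<open>T\<close> maps \<open>e j\<close> to the combination of
  the \<open>e i\<close> with these coefficients. That \<open>T\<close> vanishes off the span of the
  \<open>e j\<close> lets \<open>hull_approx_step\<close> bound the sum of the
  \<open>star T * T\<close> on all of \<open>H\<close>.\<close>

lemma realise_kernel:
  fixes p :: "'a::cstar_algebra_1 \<Rightarrow> complex" and e :: "nat \<Rightarrow> 'h::chilbert_space"
  assumes p: "pure_state p" and n: "0 < n"
    and e: "\<And>i j. i < n \<Longrightarrow> j < n \<Longrightarrow> cinner (e i) (e j) = (if i = j then 1 else 0)"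
  obtains \<phi> T where "\<phi> \<in> cstar_extreme_points"
    "\<And>a j l. j < n \<Longrightarrow> l < n \<Longrightarrow> cinner (e j) (bop_apply (star T * \<phi> a * T) (e l)) = p (star (c j) * a * c l)"
    "\<And>x. (\<And>j. j < n \<Longrightarrow> cinner (e j) x = 0) \<Longrightarrow> bop_apply T x = 0"
proof -
  interpret p: semi_inner "\<lambda>a b. p (star a * b)"
    by (rule positive_functional_semi_inner[OF pure_stateD(1)[OF p]])
  obtain k d t where k: "k \<le> n" and d: "\<And>i j. i < k \<Longrightarrow> j < k \<Longrightarrow> p (star (d i) * d j) = (if i = j then 1 else 0)"
    and t: "\<And>j w. j < n \<Longrightarrow> p (star w * c j) = (\<Sum>i<k. t i j * p (star w * d i))"
    by (rule p.gram_schmidt[of n c]) blast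
  have expand: "p (star (c j) * a * c l) = (\<Sum>i<k. \<Sum>m<k. cnj (t i j) * t m l * p (star (d i) * a * d m))"
    if "j < n" "l < n" for j l a
  proof -
    have "p (star (c j) * a * c l) = p (star (star a * c j) * c l)"
      by (simp add: star_mult star_star)
    also have "\<dots> = (\<Sum>m<k. t m l * p (star (star a * c j) * d m))"
      by (rule t[OF that(2)])
    also have "\<dots> = (\<Sum>m<k. t m l * (\<Sum>i<k. cnj (t i j) * p (star (d i) * a * d m)))"
    proof (intro sum.cong refl arg_cong2[where f = times])
      fix m
      have "p (star (star a * c j) * d m) = p (star (c j) * (a * d m))"
        by (simp add: star_mult star_star mult.assoc)
      also have "\<dots> = cnj (p (star (a * d m) * c j))"
        by (rule p.commute)
      also have "\<dots> = (\<Sum>i<k. cnj (t i j) * cnj (p (star (a * d m) * d i)))"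
        unfolding t[OF that(1)] by simp
      also have "\<dots> = (\<Sum>i<k. cnj (t i j) * p (star (d i) * a * d m))"
      proof (intro sum.cong refl arg_cong2[where f = times])
        fix i
        show "cnj (p (star (a * d m) * d i)) = p (star (d i) * a * d m)"
          using p.commute[of "d i" "a * d m"] by (simp add: mult.assoc)
      qed
      finally show "p (star (star a * c j) * d m) = (\<Sum>i<k. cnj (t i j) * p (star (d i) * a * d m))" .
    qed
    also have "\<dots> = (\<Sum>m<k. \<Sum>i<k. cnj (t i j) * t m l * p (star (d i) * a * d m))"
      by (simp add: sum_distrib_left mult_ac)
    also have "\<dots> = (\<Sum>i<k. \<Sum>m<k. cnj (t i j) * t m l * p (star (d i) * a * d m))"
      by (rule sum.swap)
    finally show ?thesis .
  qed
  show ?thesis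
  proof (cases "k = 0")
    case True
    \<comment> \<open>All \<open>c j\<close> are null for \<open>p\<close>, so the kernel is zero
      and \<open>T = 0\<close> realises it with any extreme point.\<close>
    interpret D: pure_dilation p "\<lambda>_. 1" e 1
      by standard (use p n e pure_stateD(2)[OF p] in auto)
    show ?thesis
      by (rule that[of D.\<phi> 0])
        (simp_all add: D.\<phi>_extreme expand True bop_simps cinner_simps del: One_nat_def)
  next
    case False
    interpret D: pure_dilation p d e k
      by standard (use p d e k False in auto)
    define T where "T = (\<Sum>i<k. \<Sum>j<n. t i j *\<^sub>C rank_one (e i) (e j))"
    have T_apply: "bop_apply T x = (\<Sum>i<k. \<Sum>j<n. (t i j * cinner (e j) x) *\<^sub>C e i)" for x
      by (simp add: T_def bop_left.sum bop_simps scaleC_scaleC)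
    have T_e: "bop_apply T (e l) = (\<Sum>i<k. t i l *\<^sub>C e i)" if "l < n" for l
    proof -
      have "(\<Sum>j<n. (t i j * cinner (e j) (e l)) *\<^sub>C e i) = (\<Sum>j<n. if j = l then t i l *\<^sub>C e i else 0)" for i
        using that by (intro sum.cong) (auto simp: e scaleC_left.zero)
      then show ?thesis
        using that by (simp add: T_apply)
    qed
    show ?thesis
    proof (rule that[of D.\<phi> T])
      fix a j l assume jl: "j < n" "l < n"
      have "cinner (e j) (bop_apply (star T * D.\<phi> a * T) (e l))
          = cinner (bop_apply T (e j)) (bop_apply (D.\<phi> a) (bop_apply T (e l)))"
        by (simp add: bop_simps cinner_star_right)
      also have "\<dots> = (\<Sum>i<k. \<Sum>m<k. cinner (t i j *\<^sub>C e i) (t m l *\<^sub>C bop_apply (D.\<phi> a) (e m)))"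
        unfolding T_e[OF jl(1)] T_e[OF jl(2)] cinner_left.sum bop_right.sum bop_apply_scaleC
        by (simp only: cinner_right.sum)
      also have "\<dots> = (\<Sum>i<k. \<Sum>m<k. cnj (t i j) * t m l * p (star (d i) * a * d m))"
        by (intro sum.cong refl) (simp add: cinner_scaleC_left cinner_scaleC_right D.\<phi>_e_e)
      finally show "cinner (e j) (bop_apply (star T * D.\<phi> a * T) (e l)) = p (star (c j) * a * c l)"
        by (simp only: expand[OF jl])
    qed (simp_all add: D.\<phi>_extreme T_apply scaleC_left.zero)
  qed
qed

text \<open>The dilation with a single vector: for \<open>d 0 = 1\<close> the entry at
  \<open>u\<close> and the scalar on the complement agree.\<close>

lemma scalar_extreme:
  fixes p :: "'a::cstar_algebra_1 \<Rightarrow> complex" and u :: "'h::chilbert_space"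
  assumes p: "pure_state p" and u: "cinner u u = 1"
  shows "(\<lambda>a. p a *\<^sub>C (1 :: 'h bop)) \<in> cstar_extreme_points"
proof -
  interpret D: pure_dilation p "\<lambda>_. 1" "\<lambda>_. u" "Suc 0"
    by standard (use p u pure_stateD(2)[OF p] in auto)
  have "D.\<phi> = (\<lambda>a. p a *\<^sub>C 1)"
    by (rule ext) (simp add: D.\<phi>_def D.F_def D.Proj_def scaleC_right.diff)
  then show ?thesis
    using D.\<phi>_extreme by simp
qed

lemma cinner_bop_sum_list:
  "cinner x (bop_apply (\<Sum>q\<leftarrow>xs. g q) y) = (\<Sum>q\<leftarrow>xs. cinner x (bop_apply (g q) y))"
  by (induction xs) (simp_all add: bop_simps cinner_simps)

lemma sum_list_scaleR: "(\<Sum>q\<leftarrow>xs. r *\<^sub>R g q) = r *\<^sub>R (\<Sum>q\<leftarrow>xs. g q :: 'b::real_vector)"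
  by (induction xs) (simp_all add: scaleR_add_right)

lemma orthonormal_bessel:
  fixes n :: nat
  assumes e: "\<And>i j. i < n \<Longrightarrow> j < n \<Longrightarrow> cinner (e i) (e j) = (if i = j then 1 else 0)"
  shows "(\<Sum>j<n. (cmod (cinner (e j) x))\<^sup>2) \<le> (norm x)\<^sup>2"
proof -
  define y where "y = (\<Sum>j<n. cinner (e j) x *\<^sub>C e j)"
  have ey: "cinner (e i) y = cinner (e i) x" if "i < n" for i
  proof -
    have "cinner (e i) y = (\<Sum>j<n. if j = i then cinner (e i) x else 0)"
      unfolding y_def cinner_right.sum using that by (intro sum.cong) (auto simp: cinner_simps e)
    then show ?thesis
      using that by simp
  qed
  have yz: "cinner y z = (\<Sum>j<n. cnj (cinner (e j) x) * cinner (e j) z)" for z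
    by (simp add: y_def cinner_left.sum cinner_simps)
  define s where "s = (\<Sum>j<n. (cmod (cinner (e j) x))\<^sup>2)"
  have yx: "cinner y x = complex_of_real s"
    unfolding yz s_def by (simp add: cnj_mult_self)
  have yy: "cinner y y = complex_of_real s"
    unfolding yz s_def by (simp add: ey cnj_mult_self)
  have xy: "cinner x y = complex_of_real s"
    using cinner_commute[of x y] yx by simp
  have "cinner (x - y) (x - y) = complex_of_real ((norm x)\<^sup>2 - s)"
    unfolding cinner_right.diff cinner_left.diff xy yx yy by (simp add: cinner_self)
  then have "0 \<le> (norm x)\<^sup>2 - s"
    using cinner_nonneg[of "x - y"] by (simp add: complex_nonneg_iff del: of_real_diff)
  then show ?thesis
    by (simp add: s_def)
qed

text \<open>The operators \<open>T\<^sub>q\<close> approximating \<open>\<phi>\<close> on the span of the \<open>e\<^sub>j\<close> satisfy \<open>\<kappa> \<Sum> T\<^sub>q\<^sup>* T\<^sub>q \<le> 1\<close>; the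
  remainder \<open>1 - \<kappa> \<Sum> T\<^sub>q\<^sup>* T\<^sub>q = t\<^sup>* t\<close> is used up by a scalar C*-extreme point, so that no inverse
  square root is needed to normalise the partition of unity.\<close>

lemma hull_approx_step:
  fixes \<phi> :: "'a::cstar_algebra_1 \<Rightarrow> 'h::chilbert_space bop" and e :: "nat \<Rightarrow> 'h"
  assumes \<phi>: "\<phi> \<in> ucp_maps" and n: "0 < n"
    and e: "\<And>i j. i < n \<Longrightarrow> j < n \<Longrightarrow> cinner (e i) (e j) = (if i = j then 1 else 0)"
    and S: "finite S" and \<eta>: "0 < \<eta>" and p0: "pure_state p0"
  defines "\<kappa> \<equiv> 1 / (1 + real n * real n * \<eta>)"
  obtains \<Phi> K where "\<Phi> \<in> cstar_convex_hull cstar_extreme_points"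
    "\<And>a j l. a \<in> insert 1 S \<Longrightarrow> j < n \<Longrightarrow> l < n \<Longrightarrow> cmod (cinner (e j) (bop_apply (\<phi> a) (e l)) - K j l a) < \<eta>"
    "\<And>a j l. j < n \<Longrightarrow> l < n \<Longrightarrow> cinner (e j) (bop_apply (\<Phi> a) (e l))
      = complex_of_real \<kappa> * K j l a + p0 a * ((if j = l then 1 else 0) - complex_of_real \<kappa> * K j l 1)"
proof -
  have cp: "completely_positive \<phi>" "\<phi> 1 = 1"
    using \<phi> by (auto simp: ucp_maps_def)
  have "positive_kernel n (\<lambda>j k a. cinner (e j) (bop_apply (\<phi> a) (e k)))"
    by (rule form_positive_kernel[OF completely_positiveD[OF cp(1)]])
  \<comment> \<open>The unit joins \<open>S\<close> so that the sum \<open>Z\<close> of the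
    \<open>star T * T\<close> below is close to the identity on the span of the
    \<open>e j\<close>.\<close>
  then obtain xs where xs: "\<And>p c. (p, c) \<in> set xs \<Longrightarrow> pure_state p" and
    K: "\<And>a j l. a \<in> insert 1 S \<Longrightarrow> j < n \<Longrightarrow> l < n \<Longrightarrow>
      cmod (cinner (e j) (bop_apply (\<phi> a) (e l)) - kernel_of xs j l a) < \<eta>"
    by (rule kernel_approx_pure[of n _ "insert 1 S" \<eta>]) (use S \<eta> in auto)
  define good where "good q \<phi>' T \<longleftrightarrow> \<phi>' \<in> (cstar_extreme_points :: ('a \<Rightarrow> 'h bop) set) \<and>
      (\<forall>a j l. j < n \<longrightarrow> l < n \<longrightarrow>
        cinner (e j) (bop_apply (star T * \<phi>' a * T) (e l)) = fst q (star (snd q j) * a * snd q l)) \<and>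
      (\<forall>x. (\<forall>j<n. cinner (e j) x = 0) \<longrightarrow> bop_apply T x = 0)" for q :: "('a \<Rightarrow> complex) \<times> (nat \<Rightarrow> 'a)" and \<phi>' T
  have "\<exists>r. good q (fst r) (snd r)" if q: "q \<in> set xs" for q
  proof -
    have "pure_state (fst q)"
      using xs[of "fst q" "snd q"] q by simp
    then show ?thesis
    proof (rule realise_kernel[OF _ n e, where c = "snd q"])
      fix \<phi>' and T
      assume "\<phi>' \<in> (cstar_extreme_points :: ('a \<Rightarrow> 'h bop) set)"
        "\<And>a j l. j < n \<Longrightarrow> l < n \<Longrightarrow>
          cinner (e j) (bop_apply (star T * \<phi>' a * T) (e l)) = fst q (star (snd q j) * a * snd q l)"
        "\<And>x. (\<And>j. j < n \<Longrightarrow> cinner (e j) x = 0) \<Longrightarrow> bop_apply T x = 0"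
      then have "good q \<phi>' T"
        unfolding good_def by simp
      then show "\<exists>r. good q (fst r) (snd r)"
        by (intro exI[of _ "(\<phi>', T)"]) simp
    qed
  qed
  then obtain W where W: "\<And>q. q \<in> set xs \<Longrightarrow> good q (fst (W q)) (snd (W q))"
    by metis
  define G T where "G q = fst (W q)" and "T q = snd (W q)" for q
  have G: "G q \<in> cstar_extreme_points" "G q 1 = 1"
    and GT: "\<And>a j l. j < n \<Longrightarrow> l < n \<Longrightarrow>
      cinner (e j) (bop_apply (star (T q) * G q a * T q) (e l)) = fst q (star (snd q j) * a * snd q l)"
    and T0: "\<And>x. (\<And>j. j < n \<Longrightarrow> cinner (e j) x = 0) \<Longrightarrow> bop_apply (T q) x = 0" if "q \<in> set xs" for q
  proof -
    note g = W[OF that, unfolded good_def, folded G_def T_def]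
    show "G q \<in> cstar_extreme_points"
      using g by blast
    then show "G q 1 = 1"
      using extreme_points_ucp by (auto simp: ucp_maps_def)
  qed (use W[OF that, unfolded good_def, folded G_def T_def] in blast)+
  define k where "k = kernel_of xs"
  have k: "k j l a = (\<Sum>q\<leftarrow>xs. cinner (e j) (bop_apply (star (T q) * G q a * T q) (e l)))"
    if "j < n" "l < n" for j l a
    unfolding k_def kernel_of_def
    by (rule arg_cong[where f = sum_list], rule map_cong[OF refl]) (simp add: GT that case_prod_beta)
  define Z where "Z = (\<Sum>q\<leftarrow>xs. star (T q) * T q)"
  have Zk: "cinner (e j) (bop_apply Z (e l)) = k j l 1" if "j < n" "l < n" for j l
    unfolding k[OF that] Z_def cinner_bop_sum_list
    by (rule arg_cong[where f = sum_list], rule map_cong[OF refl]) (simp add: G)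
  have Z_nonneg: "0 \<le> cinner x (bop_apply Z x)" for x
    unfolding Z_def cinner_bop_sum_list
    by (rule sum_list_nonneg) (auto simp: bop_simps cinner_star_right)
  \<comment> \<open>The \<open>n * n\<close> entries of \<open>Z\<close> each miss those of the
    identity by at most \<eta>, and coordinates are bounded by \<open>norm x\<close>. So the form of
    \<open>Z\<close> exceeds that of the identity by at most \<open>n * n * \<eta>\<close>, and
    \<kappa> scales it back below 1.\<close>
  define M where "M = 1 + real n * real n * \<eta>"
  have M: "0 < M" "\<kappa> = 1 / M"
    using \<eta> by (simp_all add: M_def \<kappa>_def add_pos_nonneg)
  have Z_le: "Re (cinner x (bop_apply Z x)) \<le> M * (norm x)\<^sup>2" for x
  proof -
    define c where "c j = cinner (e j) x" for j
    define y where "y = (\<Sum>j<n. c j *\<^sub>C e j)"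
    have "cinner (e i) (x - y) = 0" if "i < n" for i
    proof -
      have "cinner (e i) y = (\<Sum>j<n. if j = i then c i else 0)"
        unfolding y_def cinner_right.sum using that by (intro sum.cong) (auto simp: cinner_simps e)
      then show ?thesis
        using that by (simp add: cinner_simps c_def)
    qed
    \<comment> \<open>\<open>x - y\<close> is orthogonal to all \<open>e j\<close> and is therefore
      killed by the operators; only the component of \<open>x\<close> in the span matters.\<close>
    then have Tq: "bop_apply (T q) x = bop_apply (T q) y" if "q \<in> set xs" for q
      using T0[OF that, of "x - y"] by (simp add: bop_simps)
    have "cinner x (bop_apply Z x) = cinner y (bop_apply Z y)"
      unfolding Z_def cinner_bop_sum_list
      by (rule arg_cong[where f = sum_list], rule map_cong[OF refl])
        (simp add: bop_simps cinner_star_right Tq)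
    also have "\<dots> = cinner (\<Sum>j<n. c j *\<^sub>C e j) (\<Sum>l<n. c l *\<^sub>C bop_apply Z (e l))"
      by (simp add: y_def bop_right.sum bop_apply_scaleC)
    also have "\<dots> = (\<Sum>j<n. \<Sum>l<n. cinner (c j *\<^sub>C e j) (c l *\<^sub>C bop_apply Z (e l)))"
      unfolding cinner_left.sum by (simp only: cinner_right.sum)
    also have "\<dots> = (\<Sum>j<n. \<Sum>l<n. cnj (c j) * c l * k j l 1)"
      by (intro sum.cong refl) (simp add: cinner_scaleC_left cinner_scaleC_right Zk)
    also have "\<dots> = (\<Sum>j<n. \<Sum>l<n. cnj (c j) * c l * (if j = l then 1 else 0))
        + (\<Sum>j<n. \<Sum>l<n. cnj (c j) * c l * (k j l 1 - (if j = l then 1 else 0)))"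
      by (simp add: algebra_simps flip: sum.distrib)
    also have "(\<Sum>j<n. \<Sum>l<n. cnj (c j) * c l * (if j = l then 1 else 0)) = complex_of_real (\<Sum>j<n. (cmod (c j))\<^sup>2)"
    proof -
      have "(\<Sum>l<n. cnj (c j) * c l * (if j = l then 1 else 0)) = complex_of_real ((cmod (c j))\<^sup>2)" if "j < n" for j
      proof -
        have "(\<Sum>l<n. cnj (c j) * c l * (if j = l then 1 else 0)) = (\<Sum>l<n. if l = j then cnj (c j) * c j else 0)"
          by (intro sum.cong) auto
        then show ?thesis
          using that by (simp only: cnj_mult_self sum.delta finite_lessThan) simp
      qed
      then show ?thesis
        by simp
    qed
    finally have "Re (cinner x (bop_apply Z x)) = (\<Sum>j<n. (cmod (c j))\<^sup>2)
        + Re (\<Sum>j<n. \<Sum>l<n. cnj (c j) * c l * (k j l 1 - (if j = l then 1 else 0)))"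
      by simp
    also have "Re (\<Sum>j<n. \<Sum>l<n. cnj (c j) * c l * (k j l 1 - (if j = l then 1 else 0)))
        \<le> (\<Sum>j<n. \<Sum>l<n. (norm x)\<^sup>2 * \<eta>)"
    proof (rule order_trans[OF complex_Re_le_cmod], intro sum_norm_le)
      fix j l assume "j \<in> {..<n}" "l \<in> {..<n}"
      then have jl: "j < n" "l < n" by auto
      have c_le: "cmod (c i) \<le> norm x" if "i < n" for i
      proof -
        have "norm (e i) = 1"
          using e[OF that that] power2_eq_imp_eq[of "norm (e i)" 1] by (simp add: cinner_self flip: of_real_power)
        then show ?thesis
          using norm_cinner_le[of "e i" x] by (simp add: c_def)
      qed
      have "cmod (k j l 1 - (if j = l then 1 else 0)) \<le> \<eta>"
        using K[of 1 j l] jl by (simp add: cp bop_simps e k_def norm_minus_commute)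
      then have "cmod (c j) * cmod (c l) * cmod (k j l 1 - (if j = l then 1 else 0)) \<le> norm x * norm x * \<eta>"
        using c_le jl by (intro mult_mono) auto
      then show "cmod (cnj (c j) * c l * (k j l 1 - (if j = l then 1 else 0))) \<le> (norm x)\<^sup>2 * \<eta>"
        by (simp add: norm_mult power2_eq_square)
    qed
    also have "(\<Sum>j<n. (cmod (c j))\<^sup>2) \<le> (norm x)\<^sup>2"
      unfolding c_def by (rule orthonormal_bessel[OF e])
    finally show ?thesis
      by (simp add: M_def algebra_simps)
  qed
  define E where "E = 1 - \<kappa> *\<^sub>R Z"
  have "0 \<le> cinner x (bop_apply E x)" for x
  proof -
    have "cinner x (bop_apply Z x) = complex_of_real (Re (cinner x (bop_apply Z x)))"
      by (rule complex_nonneg_eq[OF Z_nonneg])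
    then have "cinner x (bop_apply E x) = complex_of_real ((norm x)\<^sup>2 - \<kappa> * Re (cinner x (bop_apply Z x)))"
      by (simp add: E_def bop_simps cinner_simps cinner_scaleR cinner_self)
    moreover have "\<kappa> * Re (cinner x (bop_apply Z x)) \<le> (norm x)\<^sup>2"
      unfolding M(2) using Z_le[of x] M(1) by (simp add: pos_divide_le_eq mult.commute)
    ultimately show ?thesis
      by (simp add: complex_nonneg_iff del: of_real_diff)
  qed
  then obtain t where t: "star t = t" "t * t = E"
    by (rule operator_sqrt)
  have \<kappa>0: "0 \<le> \<kappa>"
    using M by simp
  define ys where "ys = (\<lambda>a. p0 a *\<^sub>C 1, t) # map (\<lambda>q. (G q, sqrt \<kappa> *\<^sub>R T q)) xs"
  define \<Phi> where "\<Phi> = (\<lambda>a. \<Sum>(\<phi>, T)\<leftarrow>ys. star T * \<phi> a * T)"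
  have conj: "star (sqrt \<kappa> *\<^sub>R T q) * x * (sqrt \<kappa> *\<^sub>R T q) = \<kappa> *\<^sub>R (star (T q) * x * T q)" for q x
    using \<kappa>0 by (simp add: star_scaleR)
  have \<Phi>_apply: "\<Phi> a = p0 a *\<^sub>C E + \<kappa> *\<^sub>R (\<Sum>q\<leftarrow>xs. star (T q) * G q a * T q)" for a
  proof -
    have "\<Phi> a = star t * (p0 a *\<^sub>C 1) * t + (\<Sum>q\<leftarrow>xs. star (sqrt \<kappa> *\<^sub>R T q) * G q a * (sqrt \<kappa> *\<^sub>R T q))"
      by (simp add: \<Phi>_def ys_def o_def)
    then show ?thesis
      unfolding conj sum_list_scaleR by (simp add: t scaleC_mult_right scaleC_mult_left)
  qed
  have "cinner (e 0) (e 0) = 1"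
    using e[OF n n] by simp
  then have "\<phi>' \<in> cstar_extreme_points" if "(\<phi>', T') \<in> set ys" for \<phi>' T'
    using that scalar_extreme[OF p0] G(1) by (auto simp: ys_def)
  moreover have "(\<Sum>(\<phi>, T)\<leftarrow>ys. star T * T) = 1"
  proof -
    have "(\<Sum>(\<phi>, T)\<leftarrow>ys. star T * T) = star t * t + (\<Sum>q\<leftarrow>xs. star (sqrt \<kappa> *\<^sub>R T q) * 1 * (sqrt \<kappa> *\<^sub>R T q))"
      by (simp add: ys_def o_def)
    then show ?thesis
      unfolding conj sum_list_scaleR by (simp add: t E_def Z_def)
  qed
  moreover have "ys \<noteq> []"
    by (simp add: ys_def)
  ultimately have "\<Phi> \<in> cstar_convex_hull cstar_extreme_points"
    unfolding \<Phi>_def by (intro cstar_convex_hull_list) auto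
  moreover have "cinner (e j) (bop_apply (\<Phi> a) (e l))
      = complex_of_real \<kappa> * k j l a + p0 a * ((if j = l then 1 else 0) - complex_of_real \<kappa> * k j l 1)"
    if "j < n" "l < n" for a j l
    unfolding k[OF that, of a] using Zk[OF that]
    by (simp add: \<Phi>_apply E_def bop_left.add bop_left.diff bop_apply_simps(5,6) bop_apply_simps(2)
        cinner_simps cinner_scaleR cinner_bop_sum_list e that)
  ultimately show ?thesis
    using K by (intro that[of \<Phi> k]) (simp_all add: k_def)
qed

text \<open>As \<eta> tends to 0, \<kappa> tends to 1 and the matrix \<open>K j l 1\<close> to the
  identity, so the contribution of the scalar summand disappears in the limit.\<close>

lemma hull_approx_seq:
  fixes \<phi> :: "'a::cstar_algebra_1 \<Rightarrow> 'h::chilbert_space bop" and e :: "nat \<Rightarrow> 'h"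
  assumes \<phi>: "\<phi> \<in> ucp_maps" and n: "0 < n"
    and e: "\<And>i j. i < n \<Longrightarrow> j < n \<Longrightarrow> cinner (e i) (e j) = (if i = j then 1 else 0)"
    and S: "finite S"
  obtains \<Phi> where "\<And>r::nat. \<Phi> r \<in> cstar_convex_hull cstar_extreme_points"
    "\<And>a j l. a \<in> S \<Longrightarrow> j < n \<Longrightarrow> l < n \<Longrightarrow>
      (\<lambda>r. cinner (e j) (bop_apply (\<Phi> r a) (e l))) \<longlonglongrightarrow> cinner (e j) (bop_apply (\<phi> a) (e l))"
proof -
  have cp: "completely_positive \<phi>" "\<phi> 1 = 1"
    using \<phi> by (auto simp: ucp_maps_def)
  \<comment> \<open>The map \<phi> itself provides a state, so the state space is non-empty and has
    an extreme point.\<close>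
  have "(\<lambda>a. cinner (e 0) (bop_apply (\<phi> a) (e 0))) \<in> state_space"
  proof -
    have "0 \<le> cinner (e 0) (bop_apply (\<phi> (star a * a)) (e 0))" for a
      using completely_positiveD(2)[OF cp(1), unfolded form_positive_def, rule_format,
          where n = 1 and a = "\<lambda>_. a" and x = "\<lambda>_. e 0"] by simp
    then show ?thesis
      using completely_positiveD(1)[OF cp(1)] e[OF n n]
      by (simp add: state_space_def positive_functional_def clinear_def bop_simps cinner_simps cp)
  qed
  then obtain p0 :: "'a \<Rightarrow> complex" where p0: "pure_state p0"
    by (rule pure_state_exists)
  define \<eta> where "\<eta> r = inverse (real (Suc r))" for r
  have \<eta>: "0 < \<eta> r" for r
    by (simp add: \<eta>_def)
  have \<eta>0: "\<eta> \<longlonglongrightarrow> 0"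
    unfolding \<eta>_def by (rule LIMSEQ_inverse_real_of_nat)
  define \<kappa> where "\<kappa> r = 1 / (1 + real n * real n * \<eta> r)" for r
  have "\<kappa> \<longlonglongrightarrow> 1 / (1 + real n * real n * 0)"
    unfolding \<kappa>_def by (intro tendsto_intros \<eta>0) simp
  then have \<kappa>1: "(\<lambda>r. complex_of_real (\<kappa> r)) \<longlonglongrightarrow> complex_of_real 1"
    by (intro tendsto_of_real) simp
  have "\<exists>\<Phi> K. \<Phi> \<in> (cstar_convex_hull cstar_extreme_points :: ('a \<Rightarrow> 'h bop) set) \<and>
    (\<forall>a\<in>insert 1 S. \<forall>j<n. \<forall>l<n. cmod (cinner (e j) (bop_apply (\<phi> a) (e l)) - K j l a) < \<eta> r) \<and>
    (\<forall>a. \<forall>j<n. \<forall>l<n. cinner (e j) (bop_apply (\<Phi> a) (e l))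
      = complex_of_real (\<kappa> r) * K j l a + p0 a * ((if j = l then 1 else 0) - complex_of_real (\<kappa> r) * K j l 1))" for r
    unfolding \<kappa>_def by (rule hull_approx_step[OF \<phi> n e S \<eta>[of r] p0]) blast+
  then obtain \<Phi> K where \<Phi>: "\<And>r. \<Phi> r \<in> (cstar_convex_hull cstar_extreme_points :: ('a \<Rightarrow> 'h bop) set)"
    and K: "\<And>r. \<forall>a\<in>insert 1 S. \<forall>j<n. \<forall>l<n. cmod (cinner (e j) (bop_apply (\<phi> a) (e l)) - K r j l a) < \<eta> r"
    and \<Phi>K: "\<And>r. \<forall>a. \<forall>j<n. \<forall>l<n. cinner (e j) (bop_apply (\<Phi> r a) (e l))
      = complex_of_real (\<kappa> r) * K r j l a + p0 a * ((if j = l then 1 else 0) - complex_of_real (\<kappa> r) * K r j l 1)"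
    by metis
  have K_lim: "(\<lambda>r. K r j l a) \<longlonglongrightarrow> cinner (e j) (bop_apply (\<phi> a) (e l))"
    if "a \<in> insert 1 S" "j < n" "l < n" for a j l
  proof (rule LIM_zero_cancel, rule tendsto_zero_dominated[OF _ \<eta>0])
    fix r
    have "cmod (cinner (e j) (bop_apply (\<phi> a) (e l)) - K r j l a) < \<eta> r"
      using K[of r] that by blast
    then show "norm (K r j l a - cinner (e j) (bop_apply (\<phi> a) (e l))) \<le> \<eta> r"
      by (simp add: norm_minus_commute)
  qed
  show ?thesis
  proof (rule that[OF \<Phi>])
    fix a j l assume *: "a \<in> S" "j < n" "l < n"
    have one: "(\<lambda>r. K r j l 1) \<longlonglongrightarrow> (if j = l then 1 else 0)"
      using K_lim[of 1 j l] * by (simp add: cp bop_simps e)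
    have "(\<lambda>r. complex_of_real (\<kappa> r) * K r j l a + p0 a * ((if j = l then 1 else 0) - complex_of_real (\<kappa> r) * K r j l 1))
        \<longlonglongrightarrow> complex_of_real 1 * cinner (e j) (bop_apply (\<phi> a) (e l))
          + p0 a * ((if j = l then 1 else 0) - complex_of_real 1 * (if j = l then 1 else 0))"
      using * by (intro tendsto_intros \<kappa>1 one K_lim) auto
    then show "(\<lambda>r. cinner (e j) (bop_apply (\<Phi> r a) (e l))) \<longlonglongrightarrow> cinner (e j) (bop_apply (\<phi> a) (e l))"
      using \<Phi>K * by simp
  qed
qed

lemma hull_approx:
  fixes \<phi> :: "'a::cstar_algebra_1 \<Rightarrow> 'h::chilbert_space bop"
  assumes \<phi>: "\<phi> \<in> ucp_maps" and nz: "h0 \<noteq> (0::'h)" and W: "finite W"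
    and \<epsilon>: "\<And>w. w \<in> W \<Longrightarrow> 0 < (\<epsilon> w :: real)"
  obtains \<Phi> where "\<Phi> \<in> cstar_convex_hull cstar_extreme_points"
    "\<And>a x y. (a, x, y) \<in> W \<Longrightarrow>
      cmod (cinner x (bop_apply (\<Phi> a) y) - cinner x (bop_apply (\<phi> a) y)) < \<epsilon> (a, x, y)"
proof -
  \<comment> \<open>Adding \<open>h0\<close> makes the orthonormal family non-empty even if all test
    vectors vanish.\<close>
  define X where "X = insert h0 ((\<lambda>(a, x, y). x) ` W \<union> (\<lambda>(a, x, y). y) ` W)"
  have "finite X"
    using W by (simp add: X_def)
  then obtain vs where vs: "set vs = X"
    using finite_list by blast
  obtain n e t where "n \<le> length vs"
    and e: "\<And>i j. i < n \<Longrightarrow> j < n \<Longrightarrow> cinner (e i) (e j) = (if i = j then 1 else 0)"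
    and "\<And>j w. j < length vs \<Longrightarrow> cinner w (vs ! j) = (\<Sum>i<n. t i j * cinner w (e i))"
    and null: "\<And>j. j < length vs \<Longrightarrow>
      cinner (vs ! j - (\<Sum>i<n. t i j *\<^sub>C e i)) (vs ! j - (\<Sum>i<n. t i j *\<^sub>C e i)) = 0"
    by (rule hilbert.gram_schmidt[of "length vs" "\<lambda>j. vs ! j"]) blast
  have span: "\<exists>c. x = (\<Sum>i<n. c i *\<^sub>C e i)" if "x \<in> X" for x
  proof -
    obtain j where j: "j < length vs" "x = vs ! j"
      using \<open>x \<in> X\<close> vs by (metis in_set_conv_nth)
    then have "x = (\<Sum>i<n. t i j *\<^sub>C e i)"
      using cinner_zero_imp[OF null[OF j(1)]] by simp
    then show ?thesis
      by (intro exI[of _ "\<lambda>i. t i j"])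
  qed
  have n: "0 < n"
  proof (rule ccontr)
    assume "\<not> 0 < n"
    then show False
      using span[of h0] nz by (simp add: X_def)
  qed
  obtain \<Phi> where \<Phi>: "\<And>r::nat. \<Phi> r \<in> cstar_convex_hull cstar_extreme_points"
    and lim: "\<And>a j l. a \<in> fst ` W \<Longrightarrow> j < n \<Longrightarrow> l < n \<Longrightarrow>
      (\<lambda>r. cinner (e j) (bop_apply (\<Phi> r a) (e l))) \<longlonglongrightarrow> cinner (e j) (bop_apply (\<phi> a) (e l))"
    by (rule hull_approx_seq[OF \<phi> n e, of "fst ` W"]) (use W in auto)
  have "\<forall>\<^sub>F r in sequentially. \<forall>w\<in>W. cmod (cinner (fst (snd w)) (bop_apply (\<Phi> r (fst w)) (snd (snd w)))
      - cinner (fst (snd w)) (bop_apply (\<phi> (fst w)) (snd (snd w)))) < \<epsilon> w"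
  proof (rule eventually_ball_finite[OF W], rule ballI)
    fix w assume w: "w \<in> W"
    obtain a x y where axy: "w = (a, x, y)"
      by (cases w)
    have "x \<in> X" "y \<in> X" "a \<in> fst ` W"
      using w by (force simp: X_def axy)+
    obtain c c' where x: "x = (\<Sum>i<n. c i *\<^sub>C e i)" and y: "y = (\<Sum>i<n. c' i *\<^sub>C e i)"
      using span[OF \<open>x \<in> X\<close>] span[OF \<open>y \<in> X\<close>] by blast
    have expand: "cinner x (bop_apply R y) = (\<Sum>i<n. \<Sum>j<n. cnj (c i) * (c' j * cinner (e i) (bop_apply R (e j))))" for R
    proof -
      have "cinner x (bop_apply R y) = cinner (\<Sum>i<n. c i *\<^sub>C e i) (\<Sum>j<n. c' j *\<^sub>C bop_apply R (e j))"
        by (simp add: x y bop_right.sum bop_apply_scaleC)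
      also have "\<dots> = (\<Sum>i<n. \<Sum>j<n. cinner (c i *\<^sub>C e i) (c' j *\<^sub>C bop_apply R (e j)))"
        unfolding cinner_left.sum by (simp only: cinner_right.sum)
      finally show ?thesis
        by (simp add: cinner_scaleC_left cinner_scaleC_right mult.left_commute)
    qed
    have "(\<lambda>r. cinner x (bop_apply (\<Phi> r a) y)) \<longlonglongrightarrow> cinner x (bop_apply (\<phi> a) y)"
      unfolding expand by (intro tendsto_intros lim) (use \<open>a \<in> fst ` W\<close> in auto)
    from tendstoD[OF this \<epsilon>[OF w]] show "\<forall>\<^sub>F r in sequentially.
        cmod (cinner (fst (snd w)) (bop_apply (\<Phi> r (fst w)) (snd (snd w)))
          - cinner (fst (snd w)) (bop_apply (\<phi> (fst w)) (snd (snd w)))) < \<epsilon> w"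
      by (simp add: axy dist_norm)
  qed
  then obtain r where r: "\<forall>w\<in>W. cmod (cinner (fst (snd w)) (bop_apply (\<Phi> r (fst w)) (snd (snd w)))
      - cinner (fst (snd w)) (bop_apply (\<phi> (fst w)) (snd (snd w)))) < \<epsilon> w"
    unfolding eventually_sequentially by blast
  show ?thesis
    by (rule that[OF \<Phi>[of r]]) (use r in force)
qed

text \<open>The approximants form a net indexed by finite sets of tests \<open>(a, x, y, m)\<close>,
  where \<open>m\<close> encodes the tolerance \<open>1 / (m + 1)\<close>. One element of the hull
  meets each finite set of tests, and the filter of finite sets turns this into convergence.\<close>

lemma ucp_in_closure:
  fixes \<phi> :: "'a::cstar_algebra_1 \<Rightarrow> 'h::chilbert_space bop"
  assumes \<phi>: "\<phi> \<in> ucp_maps"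
  shows "\<phi> \<in> bw_topology closure_of cstar_convex_hull cstar_extreme_points"
proof (cases "\<exists>h0::'h. h0 \<noteq> 0")
  case True
  then obtain h0 :: 'h where h0: "h0 \<noteq> 0"
    by blast
  define near where "near W \<Phi> \<longleftrightarrow> \<Phi> \<in> (cstar_convex_hull cstar_extreme_points :: ('a \<Rightarrow> 'h bop) set) \<and>
    (\<forall>(a, x, y, m)\<in>W. cmod (cinner x (bop_apply (\<Phi> a) y) - cinner x (bop_apply (\<phi> a) y)) < inverse (real (Suc m)))"
    for W :: "('a \<times> 'h \<times> 'h \<times> nat) set" and \<Phi>
  have "\<exists>\<Phi>. finite W \<longrightarrow> near W \<Phi>" for W
  proof (cases "finite W")
    case W: True
    define V where "V = (\<lambda>(a, x, y, m). (a, x, y)) ` W"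
    \<comment> \<open>The 1 keeps the argument of \<open>Min\<close> non-empty when \<open>W\<close>
      is empty.\<close>
    define \<epsilon> where "\<epsilon> = Min (insert 1 ((\<lambda>(a, x, y, m). inverse (real (Suc m))) ` W))"
    have \<epsilon>: "0 < \<epsilon>" "\<And>a x y m. (a, x, y, m) \<in> W \<Longrightarrow> \<epsilon> \<le> inverse (real (Suc m))"
      using W by (force simp: \<epsilon>_def intro!: Min_le)+
    obtain \<Phi> where \<Phi>: "\<Phi> \<in> cstar_convex_hull cstar_extreme_points"
      and close: "\<And>a x y. (a, x, y) \<in> V \<Longrightarrow> cmod (cinner x (bop_apply (\<Phi> a) y) - cinner x (bop_apply (\<phi> a) y)) < \<epsilon>"
      by (rule hull_approx[OF \<phi> h0, of V "\<lambda>_. \<epsilon>"]) (use W \<epsilon>(1) in \<open>auto simp: V_def\<close>)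
    have "cmod (cinner x (bop_apply (\<Phi> a) y) - cinner x (bop_apply (\<phi> a) y)) < inverse (real (Suc m))"
      if "(a, x, y, m) \<in> W" for a x y m
    proof -
      have "(a, x, y) \<in> V"
        unfolding V_def using that by (rule rev_image_eqI) simp
      from close[OF this] \<epsilon>(2)[OF that] show ?thesis
        by (rule less_le_trans)
    qed
    with \<Phi> have "near W \<Phi>"
      by (auto simp: near_def)
    then show ?thesis by blast
  qed auto
  then obtain \<Phi> where \<Phi>: "\<And>W. finite W \<Longrightarrow> near W (\<Phi> W)"
    by metis
  have "limitin bw_topology \<Phi> \<phi> (finite_subsets_at_top UNIV)"
    unfolding limitin_bw_topology limitin_weak_operator_topology
  proof (intro conjI allI \<phi>)
    have "\<Phi> W \<in> ucp_maps" if "finite W" for W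
      using \<Phi>[OF that] cstar_convex_hull_ucp[OF extreme_points_ucp] unfolding near_def by blast
    then show "\<forall>\<^sub>F W in finite_subsets_at_top UNIV. \<Phi> W \<in> ucp_maps"
      by (intro eventually_finite_subsets_at_top_weakI) auto
    fix a x y
    show "((\<lambda>W. cinner x (bop_apply (\<Phi> W a) y)) \<longlongrightarrow> cinner x (bop_apply (\<phi> a) y)) (finite_subsets_at_top UNIV)"
    proof (rule tendstoI)
      fix \<delta> :: real assume "0 < \<delta>"
      then obtain m where m: "inverse (real (Suc m)) < \<delta>"
        using reals_Archimedean by blast
      show "\<forall>\<^sub>F W in finite_subsets_at_top UNIV.
          dist (cinner x (bop_apply (\<Phi> W a) y)) (cinner x (bop_apply (\<phi> a) y)) < \<delta>"
        unfolding eventually_finite_subsets_at_top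
      proof (intro exI[of _ "{(a, x, y, m)}"] conjI allI impI)
        fix W assume W: "finite W \<and> {(a, x, y, m)} \<subseteq> W \<and> W \<subseteq> UNIV"
        then have "cmod (cinner x (bop_apply (\<Phi> W a) y) - cinner x (bop_apply (\<phi> a) y)) < inverse (real (Suc m))"
          using \<Phi>[of W] unfolding near_def by blast
        then show "dist (cinner x (bop_apply (\<Phi> W a) y)) (cinner x (bop_apply (\<phi> a) y)) < \<delta>"
          using m by (simp add: dist_norm)
      qed auto
    qed
  qed
  note lim = this
  show ?thesis
    unfolding in_closure_of
  proof (intro conjI allI impI)
    show "\<phi> \<in> topspace bw_topology"
      using \<phi> by (simp add: topspace_bw_topology)
    fix U assume U: "\<phi> \<in> U \<and> openin bw_topology U"
    then have "\<forall>\<^sub>F W in finite_subsets_at_top UNIV. \<Phi> W \<in> U"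
      using lim unfolding limitin_def by blast
    then obtain W where "finite W" "\<Phi> W \<in> U"
      unfolding eventually_finite_subsets_at_top by blast
    then show "\<exists>y. y \<in> cstar_convex_hull cstar_extreme_points \<and> y \<in> U"
      using \<Phi> unfolding near_def by blast
  qed
next
  case False
  \<comment> \<open>On the zero space all operators agree, so there is a single map, and it is
    trivially C*-extreme.\<close>
  then have eq: "S = T" for S T :: "'h bop"
    by (metis bop_eqI)
  have feq: "\<psi> = \<psi>'" for \<psi> \<psi>' :: "'a \<Rightarrow> 'h bop"
    by (rule ext) (rule eq)
  have "unitary_elem (1 :: 'h bop)"
    by (simp add: unitary_elem_def)
  then have "\<phi> \<in> cstar_extreme_points"
    unfolding cstar_extreme_points_def using \<phi> feq by blast
  then have "(\<lambda>a. \<Sum>(\<phi>, T)\<leftarrow>[(\<phi>, 1)]. star T * \<phi> a * T) \<in> cstar_convex_hull cstar_extreme_points"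
    by (intro cstar_convex_hull_list) auto
  then have "\<phi> \<in> cstar_convex_hull cstar_extreme_points"
    by simp
  then show ?thesis
    using \<phi> unfolding in_closure_of topspace_bw_topology by blast
qed

theorem theorem5p3:
  assumes A: "separable_space (euclidean :: 'a::cstar_algebra_1 topology) \<or>
      (\<exists>\<pi> :: 'a \<Rightarrow> 'g::chilbert_space bop. star_isomorphism \<pi>)"
    and H: "separable_space (euclidean :: 'h::chilbert_space topology)"
  shows "bw_topology closure_of
      cstar_convex_hull (cstar_extreme_points :: ('a \<Rightarrow> 'h bop) set) = ucp_maps"
proof
  show "bw_topology closure_of cstar_convex_hull (cstar_extreme_points :: ('a \<Rightarrow> 'h bop) set) \<subseteq> ucp_maps"
    using closure_of_subset_topspace topspace_bw_topology by metis
  show "ucp_maps \<subseteq> bw_topology closure_of cstar_convex_hull (cstar_extreme_points :: ('a \<Rightarrow> 'h bop) set)"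
    using ucp_in_closure by blast
qed

end
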